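(* Let $\Omega\subset\mathbb{R}^n$ ($n\ge2$) be a bounded domain with Lipschitz boundary, $\gamma,\beta\in C^1(\bar\Omega)$ with $1\le\gamma^-\le\gamma(x)\le\gamma^+<\infty$ and $1\le\beta^-\le\beta(x)<n$, and $\theta\in M_0(\Omega)$ with $\theta(x)\ge\gamma(x)+\beta(x)+\varepsilon_0$ a.e. for some $\varepsilon_0>0$. Let $p\in M_0(\Omega)$ and suppose that for some $\varepsilon>0$, $$p(x)+\varepsilon<\frac{n(\gamma(x)+\beta(x))}{n-\beta(x)},\qquad x\in\Omega.$$ Then the embedding $S_{1,\gamma(x),\beta(x),\theta(x)}(\Omega)\hookrightarrow L^{p(x)}(\Omega)$ holds and is compact, i.e. every sequence bounded with respect to $[\cdot]_{S_{\gamma,\beta,\theta}}$ has a subsequence converging in $L^{p(x)}(\Omega)$.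
   Context: $M_0(\Omega)$: measurable $p:\Omega\to[1,\infty]$ with $1\le p^-\le p\le p^+<\infty$ a.e. $D_i=\partial/\partial x_i$. $S_{1,\gamma(x),\beta(x),\theta(x)}(\Omega)=\{u\in L^1(\Omega):\int_\Omega|u|^{\theta(x)}dx+\sum_{i=1}^n\int_\Omega|u|^{\gamma(x)}|D_iu|^{\beta(x)}dx<\infty\}$ with pseudo-norm $[u]_{S_{\gamma,\beta,\theta}}=\inf\{\lambda>0:\int_\Omega|u/\lambda|^{\theta(x)}dx+\sum_{i=1}^n\int_\Omega\big|\,|u|^{\gamma(x)/\beta(x)}D_iu\,/\lambda^{\gamma(x)/\beta(x)+1}\big|^{\beta(x)}dx\le1\}$. *)

theory Defs
  imports "HOL-Analysis.Analysis"
begin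

type_synonym 'n fn = "real^'n \<Rightarrow> real"

text \<open>Omega is locally (near each boundary point) the region strictly below the graph
  of a Lipschitz function, in a suitably rotated coordinate system whose last axis is
  the unit vector e. A Lipschitz function of the n-1 coordinates orthogonal to e is
  represented as a Lipschitz function on real^n that is invariant along e.\<close>
definition lipschitz_boundary :: "(real^'n) set \<Rightarrow> bool" where
  "lipschitz_boundary \<Omega> \<longleftrightarrow>
     (\<forall>x0 \<in> frontier \<Omega>. \<exists>r>0. \<exists>e::real^'n. \<exists>g::'n fn. \<exists>L.
        norm e = 1 \<and> L-lipschitz_on UNIV g \<and> (\<forall>y t. g (y + t *\<^sub>R e) = g y) \<and>
        \<Omega> \<inter> ball x0 r = {x \<in> ball x0 r. x \<bullet> e < g x})"

definition bounded_lipschitz_domain :: "(real^'n) set \<Rightarrow> bool" where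
  "bounded_lipschitz_domain \<Omega> \<longleftrightarrow>
     open \<Omega> \<and> connected \<Omega> \<and> \<Omega> \<noteq> {} \<and> bounded \<Omega> \<and> lipschitz_boundary \<Omega>"

definition C1_closure :: "(real^'n) set \<Rightarrow> 'n fn \<Rightarrow> bool" where
  "C1_closure \<Omega> f \<longleftrightarrow> continuous_on (closure \<Omega>) f \<and>
     (\<exists>D::'n \<Rightarrow> 'n fn. (\<forall>i. continuous_on (closure \<Omega>) (D i)) \<and>
        (\<forall>x\<in>\<Omega>. (f has_derivative (\<lambda>h. \<Sum>i\<in>UNIV. h $ i * D i x)) (at x)))"

fun Ck :: "nat \<Rightarrow> 'n::finite fn \<Rightarrow> bool" where
  "Ck 0 f \<longleftrightarrow> continuous_on UNIV f"
| "Ck (Suc k) f \<longleftrightarrow> (\<exists>D::'n \<Rightarrow> 'n fn.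
      (\<forall>x. (f has_derivative (\<lambda>h. \<Sum>i\<in>UNIV. h $ i * D i x)) (at x)) \<and> (\<forall>i. Ck k (D i)))"

definition smooth :: "'n::finite fn \<Rightarrow> bool" where
  "smooth f \<longleftrightarrow> (\<forall>k. Ck k f)"

definition test_fun :: "(real^'n::finite) set \<Rightarrow> 'n fn \<Rightarrow> bool" where
  "test_fun \<Omega> \<phi> \<longleftrightarrow> smooth \<phi> \<and> compact (closure {x. \<phi> x \<noteq> 0}) \<and> closure {x. \<phi> x \<noteq> 0} \<subseteq> \<Omega>"

definition partial :: "'n::finite \<Rightarrow> 'n fn \<Rightarrow> 'n fn" where
  "partial i f x = frechet_derivative f (at x) (axis i 1)"

definition locally_integrable :: "(real^'n::finite) set \<Rightarrow> 'n fn \<Rightarrow> bool" where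
  "locally_integrable \<Omega> f \<longleftrightarrow> (\<forall>K. compact K \<and> K \<subseteq> \<Omega> \<longrightarrow> set_integrable lebesgue K f)"

definition weak_partial :: "(real^'n::finite) set \<Rightarrow> 'n fn \<Rightarrow> 'n \<Rightarrow> 'n fn \<Rightarrow> bool" where
  "weak_partial \<Omega> u i g \<longleftrightarrow> locally_integrable \<Omega> u \<and> locally_integrable \<Omega> g \<and>
     (\<forall>\<phi>. test_fun \<Omega> \<phi> \<longrightarrow>
        (LINT x:\<Omega>|lebesgue. u x * partial i \<phi> x) = - (LINT x:\<Omega>|lebesgue. g x * \<phi> x))"

definition has_weak_partials :: "(real^'n::finite) set \<Rightarrow> 'n fn \<Rightarrow> bool" where
  "has_weak_partials \<Omega> u \<longleftrightarrow> (\<forall>i. \<exists>g. weak_partial \<Omega> u i g)"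

definition Dw :: "(real^'n::finite) set \<Rightarrow> 'n \<Rightarrow> 'n fn \<Rightarrow> 'n fn" where
  "Dw \<Omega> i u = (SOME g. weak_partial \<Omega> u i g)"

definition M0 :: "(real^'n::finite) set \<Rightarrow> 'n fn \<Rightarrow> bool" where
  "M0 \<Omega> p \<longleftrightarrow> p \<in> borel_measurable (restrict_space lebesgue \<Omega>) \<and>
     (\<exists>P. AE x in lebesgue. x \<in> \<Omega> \<longrightarrow> 1 \<le> p x \<and> p x \<le> P)"

definition modular :: "(real^'n::finite) set \<Rightarrow> 'n fn \<Rightarrow> 'n fn \<Rightarrow> ennreal" where
  "modular \<Omega> p u = (\<integral>\<^sup>+ x \<in> \<Omega>. ennreal (\<bar>u x\<bar> powr p x) \<partial>lebesgue)"

definition Lpx :: "(real^'n::finite) set \<Rightarrow> 'n fn \<Rightarrow> 'n fn set" where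
  "Lpx \<Omega> p = {u. u \<in> borel_measurable (restrict_space lebesgue \<Omega>) \<and> modular \<Omega> p u < \<infinity>}"

definition lux_norm :: "(real^'n::finite) set \<Rightarrow> 'n fn \<Rightarrow> 'n fn \<Rightarrow> real" where
  "lux_norm \<Omega> p u = Inf {l::real. l > 0 \<and> modular \<Omega> p (\<lambda>x. u x / l) \<le> 1}"

definition S_space :: "(real^'n::finite) set \<Rightarrow> 'n fn \<Rightarrow> 'n fn \<Rightarrow> 'n fn \<Rightarrow> 'n fn set" where
  "S_space \<Omega> \<gamma> \<beta> \<theta> = {u. set_integrable lebesgue \<Omega> u \<and> has_weak_partials \<Omega> u \<and>
     modular \<Omega> \<theta> u
     + (\<Sum>i\<in>UNIV. \<integral>\<^sup>+ x \<in> \<Omega>. ennreal (\<bar>u x\<bar> powr \<gamma> x * \<bar>Dw \<Omega> i u x\<bar> powr \<beta> x) \<partial>lebesgue)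
     < \<infinity>}"

definition S_pnorm :: "(real^'n::finite) set \<Rightarrow> 'n fn \<Rightarrow> 'n fn \<Rightarrow> 'n fn \<Rightarrow> 'n fn \<Rightarrow> real" where
  "S_pnorm \<Omega> \<gamma> \<beta> \<theta> u = Inf {l::real. l > 0 \<and>
     modular \<Omega> \<theta> (\<lambda>x. u x / l)
     + (\<Sum>i\<in>UNIV. \<integral>\<^sup>+ x \<in> \<Omega>. ennreal (\<bar>\<bar>u x\<bar> powr (\<gamma> x / \<beta> x) * Dw \<Omega> i u x
            / l powr (\<gamma> x / \<beta> x + 1)\<bar> powr \<beta> x) \<partial>lebesgue) \<le> 1}"

end

theory Submission
  imports Defs "HOL-Complex_Analysis.Great_Picard" "HOL-Library.Diagonal_Subsequence"
begin

text \<open>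
  Near every point of the closure, the Lipschitz condition provides a cone \<open>x + (0,T] \<cdot> cball c d\<close> inside
  \<open>\<Omega>\<close>. Testing the weak gradient with a bump supported in this cone bounds, at almost every \<open>x\<close>, the distance
  of a function to its average at scale \<open>T\<close> by a dyadic sum of averages of the gradient. Integrating
  this sum gives the subcritical Sobolev inequality without any extension theorem.

  On a small ball the exponents are replaced by constants \<open>b \<le> \<beta>\<close> and \<open>s \<le> \<gamma> / \<beta>\<close>; the inequality is applied to
  a truncation of \<open>\<bar>u\<bar>\<^sup>s u\<close> that is flat on \<open>\<bar>u\<bar> < 1\<close>. A finite cover of the closure yields a uniform bound for
  \<open>\<integral>\<bar>u\<bar>\<close> to the power \<open>p(x) + \<epsilon>/2\<close>. For compactness, \<open>F(u)\<close> with \<open>F' = min(\<bar>t\<bar>\<^sup>Q, 1)\<close> is bounded in \<open>W\<^sup>1\<^sup>,\<^sup>1\<close>, so by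
  the interior Rellich theorem a subsequence converges almost everywhere, and Vitali's argument upgrades this to
  convergence in the space with exponent \<open>p\<close>.
\<close>

section \<open>Smooth bump functions\<close>

text \<open>The energy carries the weight |u|^\<gamma>, so it gives no control of the gradient where
  u is small, and no Sobolev bound for u itself follows; only nonlinear functions of u are bounded
  in such spaces. The pseudo-norm is an infimum over scalings; it is turned once into bounds for the
  integrals inside it, and only these are used afterwards. |u|^(\<gamma>/\<beta>) u has its gradient
  in L^\<beta>, and \<gamma>/\<beta> + 1 times the Sobolev exponent n \<beta> / (n - \<beta>) is
  exactly the critical exponent of the statement. The gap \<epsilon> below it is spent twice: one
  half pays for freezing the exponents near a point, the other half is the surplus of integrability
  over p that Vitali's argument needs. At boundary points \<beta> may reach n, where the critical
  exponent blows up; there any large q will do because p is essentially bounded. Strict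
  subcriticality makes the dyadic series geometric, with room to spare. Crude constants therefore
  suffice throughout, and elementary substitutes replace the sharp convolution inequalities.\<close>

lemma Ck_continuous: "Ck k f \<Longrightarrow> continuous_on UNIV f"
  by (cases k) (auto simp: continuous_on_eq_continuous_at dest: has_derivative_continuous)

lemma Ck_Suc_imp_Ck: "Ck (Suc k) f \<Longrightarrow> Ck k f"
proof (induction k arbitrary: f)
  case 0
  then show ?case using Ck_continuous[of "Suc 0" f] by simp
next
  case (Suc k)
  from Suc.prems obtain D where D: "\<forall>x. (f has_derivative (\<lambda>h. \<Sum>i\<in>UNIV. h $ i * D i x)) (at x)"
    "\<forall>i. Ck (Suc k) (D i)" by auto
  with Suc.IH have "\<forall>i. Ck k (D i)" by blast
  with D(1) show ?case unfolding Ck.simps(2)[of k f] by blast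
qed

lemma Ck_const: "Ck k (\<lambda>_. c)"
proof (induction k arbitrary: c)
  case (Suc k)
  show ?case unfolding Ck.simps by (rule exI[of _ "\<lambda>_ _. 0"]) (simp add: Suc)
qed simp

lemma Ck_nth: "Ck k (\<lambda>x. x $ (j::'n::finite))"
proof (cases k)
  case (Suc k)
  have eq: "(\<Sum>i\<in>UNIV. h $ i * (if i = j then 1 else 0)) = h $ j" for h :: "real^'n"
    by (simp add: if_distrib cong: if_cong)
  have "((\<lambda>x. x $ j) has_derivative (\<lambda>h. \<Sum>i\<in>UNIV. h $ i * (if i = j then 1 else 0))) (at x)" for x :: "real^'n"
    unfolding eq by (rule bounded_linear_imp_has_derivative) (rule bounded_linear_vec_nth)
  then show ?thesis unfolding Suc Ck.simps
    by (intro exI[of _ "\<lambda>i x. if i = j then 1 else 0"]) (auto intro: Ck_const)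
qed (simp add: continuous_intros)

lemma Ck_add: "Ck k f \<Longrightarrow> Ck k g \<Longrightarrow> Ck k (\<lambda>x. f x + g x)"
proof (induction k arbitrary: f g)
  case 0
  then show ?case by (simp add: continuous_intros)
next
  case (Suc k)
  then obtain D E where D: "\<forall>x. (f has_derivative (\<lambda>h. \<Sum>i\<in>UNIV. h $ i * D i x)) (at x)" "\<forall>i. Ck k (D i)"
    and E: "\<forall>x. (g has_derivative (\<lambda>h. \<Sum>i\<in>UNIV. h $ i * E i x)) (at x)" "\<forall>i. Ck k (E i)" by auto
  have "((\<lambda>x. f x + g x) has_derivative (\<lambda>h. \<Sum>i\<in>UNIV. h $ i * (D i x + E i x))) (at x)" for x
    using has_derivative_add[OF D(1)[rule_format, of x] E(1)[rule_format, of x]]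
    by (simp add: distrib_left sum.distrib)
  with D E Suc.IH show ?case unfolding Ck.simps
    by (intro exI[of _ "\<lambda>i x. D i x + E i x"]) auto
qed

lemma Ck_mult: "Ck k f \<Longrightarrow> Ck k g \<Longrightarrow> Ck k (\<lambda>x. f x * g x)"
proof (induction k arbitrary: f g)
  case 0
  then show ?case by (simp add: continuous_intros)
next
  case (Suc k)
  then obtain D E where D: "\<forall>x. (f has_derivative (\<lambda>h. \<Sum>i\<in>UNIV. h $ i * D i x)) (at x)" "\<forall>i. Ck k (D i)"
    and E: "\<forall>x. (g has_derivative (\<lambda>h. \<Sum>i\<in>UNIV. h $ i * E i x)) (at x)" "\<forall>i. Ck k (E i)" by auto
  have "((\<lambda>x. f x * g x) has_derivative (\<lambda>h. \<Sum>i\<in>UNIV. h $ i * (f x * E i x + D i x * g x))) (at x)" for x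
    using has_derivative_mult[OF D(1)[rule_format, of x] E(1)[rule_format, of x]]
    by (simp add: distrib_left sum.distrib sum_distrib_left sum_distrib_right mult_ac)
  moreover have "Ck k f" "Ck k g" using Suc.prems Ck_Suc_imp_Ck by auto
  ultimately show ?case using D E Suc.IH unfolding Ck.simps
    by (intro exI[of _ "\<lambda>i x. f x * E i x + D i x * g x"]) (auto intro!: Ck_add)
qed

lemma Ck_sum: "(\<And>j. j \<in> J \<Longrightarrow> Ck k (f j)) \<Longrightarrow> Ck k (\<lambda>x. \<Sum>j\<in>J. f j x)"
proof (induction J rule: infinite_finite_induct)
  case (insert j J)
  then show ?case by (simp add: Ck_add del: Ck.simps)
qed (simp_all add: Ck_const del: Ck.simps)

text \<open>The whole sequence of derivatives is taken as data: the induction on \<open>k\<close>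
  generalises over the index \<open>m\<close>, and the chain rule merely shifts \<open>m\<close> to
  \<open>Suc m\<close>.\<close>

lemma Ck_compose_real:
  assumes H: "\<And>k t. (H k has_real_derivative H (Suc k) t) (at t)"
  shows "Ck k f \<Longrightarrow> Ck k (\<lambda>x. H m (f x))"
proof (induction k arbitrary: m)
  case 0
  have "continuous_on UNIV (H m)"
    by (rule DERIV_continuous_on) (rule has_field_derivative_at_within[OF H])
  from continuous_on_compose2[OF this] 0 show ?case by simp
next
  case (Suc k)
  then obtain D where D: "\<forall>x. (f has_derivative (\<lambda>h. \<Sum>i\<in>UNIV. h $ i * D i x)) (at x)" "\<forall>i. Ck k (D i)"
    by auto
  have "((\<lambda>x. H m (f x)) has_derivative (\<lambda>h. \<Sum>i\<in>UNIV. h $ i * (H (Suc m) (f x) * D i x))) (at x)" for x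
    using has_derivative_compose[OF D(1)[rule_format, of x] H[of m "f x", unfolded has_field_derivative_def]]
    by (simp add: sum_distrib_left algebra_simps)
  moreover have "Ck k (\<lambda>x. H (Suc m) (f x))" using Suc Ck_Suc_imp_Ck by blast
  ultimately show ?case using D unfolding Ck.simps
    by (intro exI[of _ "\<lambda>i x. H (Suc m) (f x) * D i x"]) (auto intro!: Ck_mult)
qed

lemma Ck_compose_affine: "Ck k f \<Longrightarrow> Ck k (\<lambda>y. f (a *\<^sub>R (y - x)))"
proof (induction k arbitrary: f)
  case 0
  then show ?case by (auto intro!: continuous_intros continuous_on_compose2[of UNIV f])
next
  case (Suc k)
  then obtain D where D: "\<forall>x. (f has_derivative (\<lambda>h. \<Sum>i\<in>UNIV. h $ i * D i x)) (at x)" "\<forall>i. Ck k (D i)"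
    by auto
  have "((\<lambda>y. a *\<^sub>R (y - x)) has_derivative (\<lambda>h. a *\<^sub>R h)) (at y)" for y
    by (auto intro!: derivative_eq_intros)
  from has_derivative_compose[OF this D(1)[rule_format]]
  have "((\<lambda>y. f (a *\<^sub>R (y - x))) has_derivative (\<lambda>h. \<Sum>i\<in>UNIV. h $ i * (a * D i (a *\<^sub>R (y - x))))) (at y)" for y
    by (simp add: algebra_simps)
  with D Suc.IH show ?case unfolding Ck.simps
    by (intro exI[of _ "\<lambda>i y. a * D i (a *\<^sub>R (y - x))"]) (auto intro!: Ck_mult Ck_const)
qed

text \<open>\<open>Ck\<close> binds its partial derivatives existentially. Uniqueness of the Frechet
  derivative identifies them with \<open>partial\<close>, so both claims follow from
  \<open>Ck (Suc 0)\<close>.\<close>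

lemma smooth_partial:
  assumes "smooth f"
  shows "(f has_derivative (\<lambda>h. \<Sum>i\<in>UNIV. h $ i * partial i f x)) (at x)"
    and "continuous_on UNIV (partial i f)"
proof -
  from assms have "Ck (Suc 0) f" by (simp add: smooth_def del: Ck.simps)
  then obtain D where D: "\<forall>x. (f has_derivative (\<lambda>h. \<Sum>i\<in>UNIV. h $ i * D i x)) (at x)" "\<forall>i. continuous_on UNIV (D i)"
    by auto
  have "partial i f x = D i x" for i x
    unfolding partial_def frechet_derivative_at[OF D(1)[rule_format, of x], symmetric]
    by (simp add: axis_def if_distrib if_distribR cong: if_cong)
  then have "partial i f = D i" for i by auto
  with D show "(f has_derivative (\<lambda>h. \<Sum>i\<in>UNIV. h $ i * partial i f x)) (at x)"
     "continuous_on UNIV (partial i f)" by auto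
qed

text \<open>For \<open>p = 1\<close> this is \<open>exp (- 1 / t)\<close>; the family is closed under differentiation.\<close>

definition flat_fun :: "real poly \<Rightarrow> real \<Rightarrow> real" where
  "flat_fun p t = (if t > 0 then poly p (1/t) * exp (- (1/t)) else 0)"

lemma poly_times_exp_tendsto_0: "((\<lambda>x::real. poly p x * exp (- x)) \<longlongrightarrow> 0) at_top"
proof -
  have eq: "poly p x * exp (- x) = (\<Sum>i\<le>degree p. coeff p i * (x ^ i / exp x))" for x
    by (simp add: poly_altdef sum_distrib_right exp_minus divide_inverse mult.assoc)
  have "((\<lambda>x. \<Sum>i\<le>degree p. coeff p i * (x ^ i / exp x)) \<longlongrightarrow> (\<Sum>i\<le>degree p. coeff p i * 0)) at_top"
    by (intro tendsto_sum tendsto_mult tendsto_const tendsto_power_div_exp_0)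
  then show ?thesis unfolding eq by simp
qed

lemma flat_fun_tendsto_0: "(flat_fun p \<longlongrightarrow> 0) (at 0)"
proof -
  have "((\<lambda>t. poly p (1/t) * exp (- (1/t))) \<longlongrightarrow> 0) (at_right 0)"
    using filterlim_compose[OF poly_times_exp_tendsto_0 filterlim_inverse_at_top_right]
    by (simp add: divide_inverse)
  then have "(flat_fun p \<longlongrightarrow> 0) (at_right 0)"
    by (rule Lim_transform_eventually) (auto simp: flat_fun_def eventually_at_filter)
  moreover have "(flat_fun p \<longlongrightarrow> 0) (at_left 0)"
    by (rule Lim_transform_eventually[OF tendsto_const]) (auto simp: flat_fun_def eventually_at_filter)
  ultimately show ?thesis by (simp add: filterlim_split_at)
qed

lemma flat_fun_deriv:
  "(flat_fun p has_real_derivative flat_fun ([:0,0,1:] * (p - pderiv p)) t) (at t)"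
proof (cases t "0::real" rule: linorder_cases)
  case less
  have "((\<lambda>_. 0) has_real_derivative 0) (at t)" by simp
  then have "(flat_fun p has_real_derivative 0) (at t)"
    by (rule has_field_derivative_transform_within_open[where S="{..<0}"]) (use less in \<open>auto simp: flat_fun_def\<close>)
  with less show ?thesis by (simp add: flat_fun_def)
next
  case greater
  have "((\<lambda>t. poly p (1/t) * exp (- (1/t))) has_real_derivative
     flat_fun ([:0,0,1:] * (p - pderiv p)) t) (at t)"
  proof -
    have "((\<lambda>t. 1/t) has_real_derivative - (1/t^2)) (at t)"
      using greater by (auto intro!: derivative_eq_intros simp: power2_eq_square field_simps)
    from DERIV_mult[OF DERIV_chain2[OF poly_DERIV this] DERIV_fun_exp[OF DERIV_minus[OF this]], of p]
    show ?thesis by (rule DERIV_cong) (use greater in \<open>simp add: flat_fun_def power2_eq_square algebra_simps\<close>)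
  qed
  then show ?thesis
    by (rule has_field_derivative_transform_within_open[where S="{0<..}"]) (use greater in \<open>auto simp: flat_fun_def\<close>)
next
  case equal
  \<comment> \<open>The difference quotient at 0 is again a flat function, with \<open>p\<close>
    multiplied by the variable, so its limit is known.\<close>
  have "((\<lambda>y. (flat_fun p y - flat_fun p 0) / (y - 0)) \<longlongrightarrow> 0) (at 0)"
    by (rule Lim_transform_eventually[OF flat_fun_tendsto_0[of "[:0,1:] * p"]])
      (auto simp: flat_fun_def eventually_at_filter)
  then show ?thesis unfolding has_field_derivative_iff equal by (simp add: flat_fun_def)
qed

lemma smooth_flat_fun:
  assumes "\<And>k. Ck k f" shows "Ck k (\<lambda>x. flat_fun p (f x))"
proof -
  define P where "P k = ((\<lambda>p. [:0,0,1:] * (p - pderiv p)) ^^ k) p" for k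
  have "Ck k (\<lambda>x. flat_fun (P 0) (f x))"
  proof (rule Ck_compose_real[where H="\<lambda>k. flat_fun (P k)" and m=0])
    show "(flat_fun (P k) has_real_derivative flat_fun (P (Suc k)) t) (at t)" for k t
      unfolding P_def funpow.simps o_apply by (rule flat_fun_deriv)
  qed (rule assms)
  then show ?thesis by (simp add: P_def)
qed

text \<open>The centre \<open>c\<close> is a direction into the domain: with the support in
  \<open>cball c d\<close>, the sets x + t * support sweep out the cone with vertex x.\<close>

definition bump :: "real^'n \<Rightarrow> real \<Rightarrow> 'n fn \<Rightarrow> bool" where
  "bump c d \<phi> \<longleftrightarrow> smooth \<phi> \<and> (\<forall>z. 0 \<le> \<phi> z) \<and> (\<forall>z. z \<notin> cball c d \<longrightarrow> \<phi> z = 0) \<and> integral\<^sup>L lborel \<phi> = 1"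

lemma continuous_bounded_support_integrable:
  fixes f :: "'a::euclidean_space \<Rightarrow> real"
  assumes "continuous_on UNIV f" "compact K" "\<And>x. x \<notin> K \<Longrightarrow> f x = 0"
  shows "integrable lborel f"
proof -
  have "integrable lborel (\<lambda>x. indicator K x *\<^sub>R f x)"
    by (rule borel_integrable_compact[OF assms(2)]) (rule continuous_on_subset[OF assms(1)], simp)
  moreover have "(\<lambda>x. indicator K x *\<^sub>R f x) = f" using assms(3) by (auto simp: indicator_def fun_eq_iff)
  ultimately show ?thesis by simp
qed

lemma bump_exists:
  fixes c :: "real^'n"
  assumes d: "d > 0"
  obtains \<phi> where "bump c d \<phi>"
proof -
  \<comment> \<open>The argument is d^2 - |z - c|^2, written as a sum of products so that the
    closure rules for \<open>Ck\<close> apply; \<open>flat_fun 1\<close> cuts it off smoothly at the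
    sphere.\<close>
  define \<psi> where "\<psi> z = flat_fun 1 (d\<^sup>2 + (\<Sum>i\<in>UNIV. (-1) * ((z$i + - c$i) * (z$i + - c$i))))" for z
  have eq: "d\<^sup>2 + (\<Sum>i\<in>UNIV. (-1) * ((z$i + - c$i) * (z$i + - c$i))) = d\<^sup>2 - (dist z c)\<^sup>2" for z
    by (simp add: dist_vec_def L2_set_def sum_nonneg sum_negf power2_eq_square dist_real_def)
  have Ck: "Ck k \<psi>" for k unfolding \<psi>_def
    by (intro smooth_flat_fun Ck_add Ck_sum Ck_mult Ck_const Ck_nth)
  have nonneg: "\<psi> z \<ge> 0" for z unfolding \<psi>_def eq by (simp add: flat_fun_def)
  have zero: "\<psi> z = 0" if "z \<notin> cball c d" for z
  proof -
    have "d < dist z c" using that by (simp add: dist_commute)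
    then have "d\<^sup>2 < (dist z c)\<^sup>2" using d by (intro power_strict_mono) auto
    then show ?thesis unfolding \<psi>_def eq by (simp add: flat_fun_def)
  qed
  have pos: "\<psi> c > 0" unfolding \<psi>_def eq using d by (simp add: flat_fun_def)
  have cont: "continuous_on UNIV \<psi>" using Ck Ck_continuous by blast
  have int: "integrable lborel \<psi>"
    by (rule continuous_bounded_support_integrable[OF cont, of "cball c d"]) (use zero in auto)
  have "integral\<^sup>L lborel \<psi> \<noteq> 0"
  proof
    assume "integral\<^sup>L lborel \<psi> = 0"
    then have ae: "AE z in lborel. \<psi> z = 0"
      using integral_nonneg_eq_0_iff_AE[OF int] nonneg by auto
    \<comment> \<open>The set of positivity is open and contains c; a vanishing integral would make
      it null.\<close>
    have op: "open {z. \<psi> z > 0}" using cont by (simp add: open_Collect_less)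
    have "{z. \<psi> z > 0} \<in> null_sets lborel"
      by (rule iffD2[OF AE_iff_null_sets]) (use op ae in \<open>auto elim: eventually_mono\<close>)
    then have "negligible {z. \<psi> z > 0}"
      by (simp add: negligible_iff_null_sets null_sets_completionI)
    then have "{z. \<psi> z > 0} = {}" using open_not_negligible[OF op] by auto
    with pos show False by auto
  qed
  moreover have "integral\<^sup>L lborel \<psi> \<ge> 0" using nonneg by simp
  ultimately have I: "integral\<^sup>L lborel \<psi> > 0" by linarith
  define \<phi> where "\<phi> z = (1 / integral\<^sup>L lborel \<psi>) * \<psi> z" for z
  have "bump c d \<phi>" unfolding bump_def smooth_def
  proof (intro conjI allI impI)
    show "Ck k \<phi>" for k unfolding \<phi>_def by (intro Ck_mult Ck_const Ck)
    show "0 \<le> \<phi> z" for z using nonneg I by (simp add: \<phi>_def)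
    show "\<phi> z = 0" if "z \<notin> cball c d" for z using zero[OF that] by (simp add: \<phi>_def)
    show "integral\<^sup>L lborel \<phi> = 1" unfolding \<phi>_def using I by (subst integral_mult_right_zero) simp
  qed
  with that show ?thesis .
qed

section \<open>Mollification in L1\<close>

lemma nn_integral_lborel_affine:
  fixes f :: "'a::euclidean_space \<Rightarrow> ennreal"
  assumes [measurable]: "f \<in> borel_measurable borel" and "c \<noteq> 0"
  shows "(\<integral>\<^sup>+x. f x \<partial>lborel) = ennreal (\<bar>c\<bar> ^ DIM('a)) * (\<integral>\<^sup>+x. f (t + c *\<^sub>R x) \<partial>lborel)"
  by (subst lborel_affine[OF assms(2), of t])
    (simp add: nn_integral_density nn_integral_distr nn_integral_cmult)

lemma integral_lborel_affine:
  fixes f :: "'a::euclidean_space \<Rightarrow> real"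
  assumes [measurable]: "f \<in> borel_measurable borel" and "c \<noteq> 0"
  shows "(\<integral>x. f x \<partial>lborel) = \<bar>c\<bar> ^ DIM('a) * (\<integral>x. f (t + c *\<^sub>R x) \<partial>lborel)"
  by (subst lborel_affine[OF assms(2), of t])
    (simp add: integral_density integral_distr)

lemma integrable_lborel_affine:
  fixes f :: "'a::euclidean_space \<Rightarrow> real"
  assumes f: "integrable lborel f" and "c \<noteq> 0"
  shows "integrable lborel (\<lambda>x. f (t + c *\<^sub>R x))"
proof -
  have [measurable]: "f \<in> borel_measurable borel" using f by auto
  show ?thesis
  proof (rule integrableI_bounded)
    have "(\<integral>\<^sup>+ x. ennreal (norm (f x)) \<partial>lborel) < \<infinity>" using f by (simp add: integrable_iff_bounded)
    then show "(\<integral>\<^sup>+ x. ennreal (norm (f (t + c *\<^sub>R x))) \<partial>lborel) < \<infinity>"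
      by (subst (asm) nn_integral_lborel_affine[OF _ assms(2), of _ t])
        (auto simp: ennreal_mult_less_top assms(2))
  qed simp
qed

lemma integrable_lborel_translate:
  fixes f :: "'a::euclidean_space \<Rightarrow> real"
  shows "integrable lborel f \<Longrightarrow> integrable lborel (\<lambda>x. f (x + h))"
  using integrable_lborel_affine[of f 1 h] by (simp add: add.commute)

lemma integral_lborel_translate:
  fixes f :: "'a::euclidean_space \<Rightarrow> real"
  shows "f \<in> borel_measurable borel \<Longrightarrow> (\<integral>x. f (x + h) \<partial>lborel) = (\<integral>x. f x \<partial>lborel)"
  using integral_lborel_affine[of f 1 h] by (simp add: add.commute)

text \<open>For values a, b in {0, 1} one has |a - b| = (a - b) + 2 b (1 - a). With a the translated
  indicator, the first part integrates to 0 by translation invariance, and the second tends to 0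
  pointwise because U is open.\<close>

lemma L1_translation_open:
  fixes U :: "'a::euclidean_space set"
  assumes U: "open U" "emeasure lborel U < \<infinity>" and h: "h \<longlonglongrightarrow> 0"
  shows "(\<lambda>n. \<integral>x. \<bar>indicator U (x + h n) - indicator U x :: real\<bar> \<partial>lborel) \<longlonglongrightarrow> 0"
proof -
  let ?I = "indicator U :: 'a \<Rightarrow> real"
  have [measurable]: "U \<in> sets borel" using U by auto
  have int: "integrable lborel ?I" using U by (auto simp: integrable_indicator_iff)
  have "\<bar>?I (x + h n) - ?I x\<bar> = (?I (x + h n) - ?I x) + 2 * (?I x * (1 - ?I (x + h n)))" for x n
    by (auto simp: indicator_def)
  then have eq: "(\<integral>x. \<bar>?I (x + h n) - ?I x\<bar> \<partial>lborel) = 2 * (\<integral>x. ?I x * (1 - ?I (x + h n)) \<partial>lborel)" for n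
  proof -
    have i: "integrable lborel (\<lambda>x. ?I x * (1 - ?I (x + h n)))"
      by (rule Bochner_Integration.integrable_bound[OF int]) (auto simp: indicator_def)
    have "(\<integral>x. \<bar>?I (x + h n) - ?I x\<bar> \<partial>lborel)
      = (\<integral>x. (?I (x + h n) - ?I x) + 2 * (?I x * (1 - ?I (x + h n))) \<partial>lborel)"
      by (rule Bochner_Integration.integral_cong) (auto simp: indicator_def)
    also have "\<dots> = ((\<integral>x. ?I (x + h n) \<partial>lborel) - (\<integral>x. ?I x \<partial>lborel)) + 2 * (\<integral>x. ?I x * (1 - ?I (x + h n)) \<partial>lborel)"
      using int i integrable_lborel_translate[OF int, of "h n"] by simp
    finally show ?thesis using integral_lborel_translate[of ?I "h n"] by simp
  qed
  have "(\<lambda>n. \<integral>x. ?I x * (1 - ?I (x + h n)) \<partial>lborel) \<longlonglongrightarrow> (\<integral>x. 0 \<partial>(lborel::'a measure))"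
  proof (rule integral_dominated_convergence[where w="?I"])
    show "AE x in lborel. (\<lambda>n. ?I x * (1 - ?I (x + h n))) \<longlonglongrightarrow> 0"
    proof (intro AE_I2)
      fix x
      show "(\<lambda>n. ?I x * (1 - ?I (x + h n))) \<longlonglongrightarrow> 0"
      proof (cases "x \<in> U")
        case True
        have "(\<lambda>n. x + h n) \<longlonglongrightarrow> x + 0" by (intro tendsto_intros h)
        then have "eventually (\<lambda>n. x + h n \<in> U) sequentially"
          using topological_tendstoD[OF _ U(1)] True by simp
        then have "eventually (\<lambda>n. ?I x * (1 - ?I (x + h n)) = 0) sequentially"
          by eventually_elim simp
        then show ?thesis by (rule tendsto_eventually)
      qed simp
    qed
  qed (auto simp: int indicator_def)
  then have "(\<lambda>n. 2 * (\<integral>x. ?I x * (1 - ?I (x + h n)) \<partial>lborel)) \<longlonglongrightarrow> 2 * 0"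
    by (intro tendsto_mult tendsto_const) simp
  then show ?thesis unfolding eq by simp
qed

text \<open>The property passes to L1 limits: translation preserves the L1 distance to an
  approximant, which is therefore paid twice. The set case and the limit case of the following
  induction are instances.\<close>

lemma L1_translation_approx:
  fixes f :: "'a::euclidean_space \<Rightarrow> real"
  assumes f: "integrable lborel f"
    and ap: "\<And>e. e > 0 \<Longrightarrow> \<exists>g. integrable lborel g \<and> (\<integral>x. \<bar>f x - g x\<bar> \<partial>lborel) \<le> e \<and>
       (\<lambda>n. \<integral>x. \<bar>g (x + h n) - g x\<bar> \<partial>lborel) \<longlonglongrightarrow> 0"
  shows "(\<lambda>n. \<integral>x. \<bar>f (x + h n) - f x\<bar> \<partial>lborel) \<longlonglongrightarrow> 0"
proof (rule LIMSEQ_I)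
  fix e :: real assume e: "e > 0"
  then obtain g where g: "integrable lborel g" "(\<integral>x. \<bar>f x - g x\<bar> \<partial>lborel) \<le> e/4"
    "(\<lambda>n. \<integral>x. \<bar>g (x + h n) - g x\<bar> \<partial>lborel) \<longlonglongrightarrow> 0" using ap[of "e/4"] by auto
  have [measurable]: "f \<in> borel_measurable borel" "g \<in> borel_measurable borel" using f g by auto
  from LIMSEQ_D[OF g(3), of "e/4"] e obtain N where
    N: "\<And>n. n \<ge> N \<Longrightarrow> (\<integral>x. \<bar>g (x + h n) - g x\<bar> \<partial>lborel) < e/4" by (auto)
  have le: "(\<integral>x. \<bar>f (x + h n) - f x\<bar> \<partial>lborel) \<le>
     2 * (\<integral>x. \<bar>f x - g x\<bar> \<partial>lborel) + (\<integral>x. \<bar>g (x + h n) - g x\<bar> \<partial>lborel)" for n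
  proof -
    let ?D = "\<lambda>x. \<bar>f x - g x\<bar>"
    have i1: "integrable lborel ?D" using f g by auto
    have i2: "integrable lborel (\<lambda>x. ?D (x + h n))" by (rule integrable_lborel_translate[OF i1])
    have i3: "integrable lborel (\<lambda>x. \<bar>g (x + h n) - g x\<bar>)" 
      using integrable_lborel_translate[OF g(1), of "h n"] g by auto
    have "(\<integral>x. \<bar>f (x + h n) - f x\<bar> \<partial>lborel) \<le> (\<integral>x. ?D (x + h n) + (\<bar>g (x + h n) - g x\<bar> + ?D x) \<partial>lborel)"
      by (rule integral_mono)
        (use integrable_lborel_translate[OF f, of "h n"] f i1 i2 i3 in auto)
    also have "\<dots> = (\<integral>x. ?D (x + h n) \<partial>lborel) + ((\<integral>x. \<bar>g (x + h n) - g x\<bar> \<partial>lborel) + (\<integral>x. ?D x \<partial>lborel))"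
      using i1 i2 i3 by simp
    finally show ?thesis using integral_lborel_translate[of ?D "h n"] by simp
  qed
  show "\<exists>N. \<forall>n\<ge>N. norm ((\<integral>x. \<bar>f (x + h n) - f x\<bar> \<partial>lborel) - 0) < e"
  proof (intro exI allI impI)
    fix n assume "n \<ge> N"
    then show "norm ((\<integral>x. \<bar>f (x + h n) - f x\<bar> \<partial>lborel) - 0) < e"
      using N[of n] le[of n] g(2) e by simp
  qed
qed

text \<open>Induction over integrable functions. A Borel set of finite measure is approximated from
  outside by an open set, for which the claim is known; sums and dominated limits inherit
  it.\<close>

lemma L1_translation_continuous:
  fixes f :: "'a::euclidean_space \<Rightarrow> real"
  assumes f: "integrable lborel f" and h: "h \<longlonglongrightarrow> 0"
  shows "(\<lambda>n. \<integral>x. \<bar>f (x + h n) - f x\<bar> \<partial>lborel) \<longlonglongrightarrow> 0"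
  using f
proof (induction rule: integrable_induct)
  case (base A c)
  have [measurable]: "A \<in> sets borel" using base by auto
  show ?case
  proof (rule L1_translation_approx)
    fix e :: real assume e: "e > 0"
    \<comment> \<open>The summand 1 covers the coefficient c = 0.\<close>
    define e' where "e' = e / (\<bar>c\<bar> + 1)"
    have e': "e' > 0" using e by (simp add: e'_def)
    from outer_regular_lborel[OF \<open>A \<in> sets borel\<close> e'] obtain U where
      U: "open U" "A \<subseteq> U" "emeasure lborel (U - A) < e'" by metis
    have [measurable]: "U \<in> sets borel" using U by auto
    have "emeasure lborel U = emeasure lborel A + emeasure lborel (U - A)"
      using U by (subst plus_emeasure) (auto simp: Un_absorb1)
    moreover have "emeasure lborel (U - A) < \<infinity>" using U(3) by (auto intro: order.strict_trans)
    ultimately have Uf: "emeasure lborel U < \<infinity>" using base by simp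
    have "(\<integral>x. \<bar>indicator A x *\<^sub>R c - c * indicator U x\<bar> \<partial>lborel) = (\<integral>x. \<bar>c\<bar> * indicator (U - A) x \<partial>lborel)"
      by (rule Bochner_Integration.integral_cong) (use U(2) in \<open>auto simp: indicator_def\<close>)
    also have "\<dots> = \<bar>c\<bar> * measure lborel (U - A)" by simp
    also have "\<dots> \<le> \<bar>c\<bar> * e'"
      using U(3) e' by (intro mult_left_mono)
         (metis emeasure_eq_ennreal_measure ennreal_less_iff less_eq_real_def measure_nonneg not_less_iff_gr_or_eq order_less_imp_not_less top.not_eq_extremum ennreal_less_top order.strict_trans, simp)
    also have "\<dots> \<le> e" using e by (simp add: e'_def field_simps)
    finally have 1: "(\<integral>x. \<bar>indicator A x *\<^sub>R c - c * indicator U x\<bar> \<partial>lborel) \<le> e" .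
    have "(\<lambda>n. \<bar>c\<bar> * (\<integral>x. \<bar>indicator U (x + h n) - indicator U x\<bar> \<partial>lborel)) \<longlonglongrightarrow> \<bar>c\<bar> * 0"
      by (intro tendsto_mult tendsto_const L1_translation_open U Uf h)
    then have 2: "(\<lambda>n. \<integral>x. \<bar>c * indicator U (x + h n) - c * indicator U x\<bar> \<partial>lborel) \<longlonglongrightarrow> 0"
      by (simp add: abs_mult right_diff_distrib[symmetric])
    show "\<exists>g. integrable lborel g \<and> (\<integral>x. \<bar>indicator A x *\<^sub>R c - g x\<bar> \<partial>lborel) \<le> e \<and>
       (\<lambda>n. \<integral>x. \<bar>g (x + h n) - g x\<bar> \<partial>lborel) \<longlonglongrightarrow> 0"
      using 1 2 Uf by (intro exI[of _ "\<lambda>x. c * indicator U x"]) (auto simp: integrable_indicator_iff)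
  qed (use base in \<open>auto simp: integrable_indicator_iff\<close>)
next
  case (add f g)
  have [measurable]: "f \<in> borel_measurable borel" "g \<in> borel_measurable borel" using add by auto
  have "(\<lambda>n. (\<integral>x. \<bar>f (x + h n) - f x\<bar> \<partial>lborel) + (\<integral>x. \<bar>g (x + h n) - g x\<bar> \<partial>lborel)) \<longlonglongrightarrow> 0 + 0"
    by (intro tendsto_add add)
  then have l: "(\<lambda>n. (\<integral>x. \<bar>f (x + h n) - f x\<bar> \<partial>lborel) + (\<integral>x. \<bar>g (x + h n) - g x\<bar> \<partial>lborel)) \<longlonglongrightarrow> 0"
    by simp
  show ?case
  proof (rule Lim_null_comparison[OF _ l])
    have "(\<integral>x. \<bar>f (x + h n) + g (x + h n) - (f x + g x)\<bar> \<partial>lborel) \<le>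
       (\<integral>x. \<bar>f (x + h n) - f x\<bar> \<partial>lborel) + (\<integral>x. \<bar>g (x + h n) - g x\<bar> \<partial>lborel)" for n
      using integrable_lborel_translate[OF add.hyps(1), of "h n"] integrable_lborel_translate[OF add.hyps(2), of "h n"] add.hyps
      by (subst Bochner_Integration.integral_add[symmetric])
        (auto intro!: integral_mono simp del: Bochner_Integration.integral_add)
    then show "eventually (\<lambda>n. norm (\<integral>x. \<bar>f (x + h n) + g (x + h n) - (f x + g x)\<bar> \<partial>lborel) \<le>
       (\<integral>x. \<bar>f (x + h n) - f x\<bar> \<partial>lborel) + (\<integral>x. \<bar>g (x + h n) - g x\<bar> \<partial>lborel)) sequentially"
      by (intro always_eventually) simp
  qed
next
  case (lim f s)
  have [measurable]: "f \<in> borel_measurable borel" "s i \<in> borel_measurable borel" for i using lim by auto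
  show ?case
  proof (rule L1_translation_approx)
    fix e :: real assume e: "e > 0"
    have "(\<lambda>i. \<integral>x. \<bar>f x - s i x\<bar> \<partial>lborel) \<longlonglongrightarrow> (\<integral>x. 0 \<partial>(lborel::'a measure))"
    proof (rule integral_dominated_convergence[where w="\<lambda>x. 3 * \<bar>f x\<bar>"])
      show "AE x in lborel. (\<lambda>i. \<bar>f x - s i x\<bar>) \<longlonglongrightarrow> 0"
      proof (intro AE_I2)
        fix x show "(\<lambda>i. \<bar>f x - s i x\<bar>) \<longlonglongrightarrow> 0"
          using tendsto_rabs[OF tendsto_diff[OF tendsto_const[of "f x"] lim.hyps(2)[of x]]] by simp
      qed
      show "AE x in lborel. norm \<bar>f x - s i x\<bar> \<le> 3 * \<bar>f x\<bar>" for i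
        using lim.hyps(3)[of _ i] by (intro AE_I2) (smt (verit) UNIV_I real_norm_def space_lborel)
    qed (use lim in auto)
    then have "(\<lambda>i. \<integral>x. \<bar>f x - s i x\<bar> \<partial>lborel) \<longlonglongrightarrow> 0" by simp
    from LIMSEQ_D[OF this e] obtain i where "(\<integral>x. \<bar>f x - s i x\<bar> \<partial>lborel) < e" by auto
    then show "\<exists>g. integrable lborel g \<and> (\<integral>x. \<bar>f x - g x\<bar> \<partial>lborel) \<le> e \<and>
       (\<lambda>n. \<integral>x. \<bar>g (x + h n) - g x\<bar> \<partial>lborel) \<longlonglongrightarrow> 0"
      using lim by (intro exI[of _ "s i"]) auto
  qed (use lim in auto)
qed

section \<open>Differentiation under the integral sign and averages at scale t\<close>

lemma has_derivative_under_integral: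
  fixes \<Phi> :: "real \<Rightarrow> 'a \<Rightarrow> real"
  assumes d: "d > 0"
    and der: "\<And>s y. \<bar>s - s0\<bar> < d \<Longrightarrow> ((\<lambda>s. \<Phi> s y) has_real_derivative \<Phi>' s y) (at s)"
    and int: "\<And>s. \<bar>s - s0\<bar> < d \<Longrightarrow> integrable M (\<Phi> s)"
    and meas: "\<Phi>' s0 \<in> borel_measurable M"
    and bd: "\<And>s y. \<bar>s - s0\<bar> < d \<Longrightarrow> \<bar>\<Phi>' s y\<bar> \<le> w y" and w: "integrable M w"
  shows "((\<lambda>s. \<integral>y. \<Phi> s y \<partial>M) has_real_derivative (\<integral>y. \<Phi>' s0 y \<partial>M)) (at s0)"
  unfolding has_field_derivative_iff tendsto_at_iff_sequentially comp_def
proof (intro allI impI)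
  fix X :: "nat \<Rightarrow> real" assume X0: "\<forall>i. X i \<in> UNIV - {s0}" and X: "X \<longlonglongrightarrow> s0"
  from LIMSEQ_D[OF X d] obtain N where N: "\<And>n. n \<ge> N \<Longrightarrow> \<bar>X n - s0\<bar> < d" by auto
  \<comment> \<open>A sequence tending to \<open>s0\<close> may start outside the interval on which
    the hypotheses hold; its tail does not.\<close>
  define Y where "Y n = X (n + N)" for n
  have Y: "\<bar>Y n - s0\<bar> < d" "Y n \<noteq> s0" for n using N X0 by (auto simp: Y_def)
  have Yl: "Y \<longlonglongrightarrow> s0" unfolding Y_def using X by (rule LIMSEQ_ignore_initial_segment)
  have "(\<lambda>n. \<integral>y. (\<Phi> (Y n) y - \<Phi> s0 y) / (Y n - s0) \<partial>M) \<longlonglongrightarrow> (\<integral>y. \<Phi>' s0 y \<partial>M)"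
  proof (rule integral_dominated_convergence[OF meas _ w])
    have "integrable M (\<Phi> (Y n))" "integrable M (\<Phi> s0)" for n using int Y d by auto
    then show "(\<lambda>y. (\<Phi> (Y n) y - \<Phi> s0 y) / (Y n - s0)) \<in> borel_measurable M" for n
      by (auto dest!: borel_measurable_integrable)
    show "AE y in M. (\<lambda>n. (\<Phi> (Y n) y - \<Phi> s0 y) / (Y n - s0)) \<longlonglongrightarrow> \<Phi>' s0 y"
    proof (intro AE_I2)
      fix y
      have "((\<lambda>s. (\<Phi> s y - \<Phi> s0 y) / (s - s0)) \<longlongrightarrow> \<Phi>' s0 y) (at s0)"
        using der[of s0 y] d by (simp add: has_field_derivative_iff)
      then show "(\<lambda>n. (\<Phi> (Y n) y - \<Phi> s0 y) / (Y n - s0)) \<longlonglongrightarrow> \<Phi>' s0 y"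
        using Y Yl unfolding tendsto_at_iff_sequentially comp_def by auto
    qed
    show "AE y in M. norm ((\<Phi> (Y n) y - \<Phi> s0 y) / (Y n - s0)) \<le> w y" for n
    proof (intro AE_I2)
      fix y
      have "norm (\<Phi> (Y n) y - \<Phi> s0 y) \<le> w y * norm (Y n - s0)"
      proof (rule field_differentiable_bound[of "{s0-d<..<s0+d}" "\<lambda>s. \<Phi> s y" "\<lambda>s. \<Phi>' s y"])
        fix s assume s: "s \<in> {s0-d<..<s0+d}"
        then have "\<bar>s - s0\<bar> < d" by auto
        from has_field_derivative_at_within[OF der[OF this]] bd[OF this, of y]
        show "((\<lambda>s. \<Phi> s y) has_field_derivative \<Phi>' s y) (at s within {s0 - d<..<s0 + d})" "norm (\<Phi>' s y) \<le> w y"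
          by auto
      qed (use Y[of n] d in auto)
      then show "norm ((\<Phi> (Y n) y - \<Phi> s0 y) / (Y n - s0)) \<le> w y"
        using Y[of n] by (simp add: norm_divide divide_le_eq)
    qed
  qed
  moreover have "(\<integral>y. (\<Phi> (Y n) y - \<Phi> s0 y) / (Y n - s0) \<partial>M)
      = ((\<integral>y. \<Phi> (Y n) y \<partial>M) - (\<integral>y. \<Phi> s0 y \<partial>M)) / (Y n - s0)" for n
    using int[of "Y n"] int[of s0] Y d by simp
  ultimately have "(\<lambda>n. ((\<integral>y. \<Phi> (Y n) y \<partial>M) - (\<integral>y. \<Phi> s0 y \<partial>M)) / (Y n - s0)) \<longlonglongrightarrow> (\<integral>y. \<Phi>' s0 y \<partial>M)"
    by (simp only:)
  then show "(\<lambda>n. ((\<integral>y. \<Phi> (X n) y \<partial>M) - (\<integral>y. \<Phi> s0 y \<partial>M)) / (X n - s0)) \<longlonglongrightarrow> (\<integral>y. \<Phi>' s0 y \<partial>M)"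
    unfolding Y_def by (rule LIMSEQ_offset)
qed

text \<open>For a kernel of integral 1 this is a mollification of f. Leaving the kernel unnormalised
  also covers \<open>partial i \<eta>\<close> and z_i \<phi>, the kernels that arise by
  differentiation.\<close>

definition moll :: "'n::finite fn \<Rightarrow> real \<Rightarrow> 'n fn \<Rightarrow> 'n fn" where
  "moll \<eta> t f x = (\<integral>z. f (x + t *\<^sub>R z) * \<eta> z \<partial>lborel)"

text \<open>Neither sign nor integral nor smoothness is asked for, so partial derivatives of smooth
  kernels and products with a coordinate are kernels again.\<close>

definition kern :: "real^'n \<Rightarrow> real \<Rightarrow> 'n fn \<Rightarrow> bool" where
  "kern c d \<eta> \<longleftrightarrow> continuous_on UNIV \<eta> \<and> (\<forall>z. z \<notin> cball c d \<longrightarrow> \<eta> z = 0)"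

lemma kernD:
  assumes "kern c d \<eta>"
  shows "continuous_on UNIV \<eta>" "z \<notin> cball c d \<Longrightarrow> \<eta> z = 0" "\<eta> \<in> borel_measurable borel"
  using assms by (auto simp: kern_def intro: borel_measurable_continuous_onI)

lemma kern_bounded:
  assumes "kern c d \<eta>"
  obtains B where "B > 0" "\<And>z. \<bar>\<eta> z\<bar> \<le> B"
proof -
  have "compact (\<eta> ` cball c d)"
    by (intro compact_continuous_image continuous_on_subset[OF kernD(1)[OF assms]]) auto
  then obtain B where B: "B > 0" "\<And>z. z \<in> cball c d \<Longrightarrow> \<bar>\<eta> z\<bar> \<le> B"
    using compact_imp_bounded[of "\<eta> ` cball c d"] unfolding bounded_pos by (metis imageI real_norm_def)
  then have "\<bar>\<eta> z\<bar> \<le> B" for z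
    using kernD(2)[OF assms, of z] by (cases "z \<in> cball c d") auto
  with B that show ?thesis by blast
qed

lemma kern_integrable: "kern c d \<eta> \<Longrightarrow> integrable lborel \<eta>"
  by (rule continuous_bounded_support_integrable[of \<eta> "cball c d"]) (auto dest: kernD)

text \<open>The substitution y = x + t z moves x and t from f into the kernel. Derivatives in x and
  t can then be taken although f has no regularity.\<close>

lemma moll_eq:
  assumes t: "t > 0" and [measurable]: "f \<in> borel_measurable borel" "\<eta> \<in> borel_measurable borel"
  shows "moll \<eta> t f x = (1 / t ^ CARD('n)) * (\<integral>y. f y * \<eta> ((1/t) *\<^sub>R (y - x :: real^'n::finite)) \<partial>lborel)"
proof -
  have "(\<integral>y. f y * \<eta> ((1/t) *\<^sub>R (y - x)) \<partial>lborel) = t ^ CARD('n) * (\<integral>z. f (x + t *\<^sub>R z) * \<eta> ((1/t) *\<^sub>R (x + t *\<^sub>R z - x)) \<partial>lborel)"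
    using t by (subst integral_lborel_affine[of _ t x]) auto
  then show ?thesis using t unfolding moll_def by simp
qed

lemma moll_integrand_integrable:
  fixes f :: "'n::finite fn"
  assumes f: "integrable lborel f" and \<eta>: "kern c d \<eta>" and t: "t > 0"
  shows "integrable lborel (\<lambda>z. f (x + t *\<^sub>R z) * \<eta> z)"
proof -
  obtain B where B: "B > 0" "\<And>z. \<bar>\<eta> z\<bar> \<le> B" using kern_bounded[OF \<eta>] by auto
  have [measurable]: "f \<in> borel_measurable borel" "\<eta> \<in> borel_measurable borel" using f kernD[OF \<eta>] by auto
  have "integrable lborel (\<lambda>z. B * f (x + t *\<^sub>R z))"
    using integrable_lborel_affine[OF f, of t x] t by auto
  then show ?thesis
    by (rule Bochner_Integration.integrable_bound)
      (use B in \<open>auto simp: abs_mult mult.commute[of B] intro!: mult_left_mono\<close>)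
qed

lemma borel_measurable_moll[measurable]:
  assumes [measurable]: "f \<in> borel_measurable borel" "\<eta> \<in> borel_measurable borel"
  shows "moll \<eta> t f \<in> borel_measurable borel"
  unfolding moll_def[abs_def] by measurable

text \<open>As \<phi> has integral 1, f x is the \<phi>-average of the constant f x. Tonelli's
  theorem then leaves the L1 moduli of translation by t z, averaged over z.\<close>

lemma moll_diff_bound:
  fixes f :: "'n::finite fn"
  assumes f: "integrable lborel f" and \<phi>: "kern c d \<phi>" "\<And>z. \<phi> z \<ge> 0" "integral\<^sup>L lborel \<phi> = 1" and t: "t > 0"
  shows "(\<integral>\<^sup>+x. ennreal \<bar>moll \<phi> t f x - f x\<bar> \<partial>lborel)
     \<le> (\<integral>\<^sup>+z. ennreal (\<phi> z * (\<integral>x. \<bar>f (x + t *\<^sub>R z) - f x\<bar> \<partial>lborel)) \<partial>lborel)"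
proof -
  have [measurable]: "f \<in> borel_measurable borel" "\<phi> \<in> borel_measurable borel" using f kernD[OF \<phi>(1)] by auto
  have i: "integrable lborel (\<lambda>z. f (x + t *\<^sub>R z) * \<phi> z)" for x
    by (rule moll_integrand_integrable[OF f \<phi>(1) t])
  have i2: "integrable lborel (\<lambda>z. f x * \<phi> z)" for x using kern_integrable[OF \<phi>(1)] by simp
  have le: "\<bar>moll \<phi> t f x - f x\<bar> \<le> (\<integral>z. \<bar>f (x + t *\<^sub>R z) - f x\<bar> * \<phi> z \<partial>lborel)" for x
  proof -
    have "moll \<phi> t f x - f x = (\<integral>z. f (x + t *\<^sub>R z) * \<phi> z \<partial>lborel) - (\<integral>z. f x * \<phi> z \<partial>lborel)"
      using \<phi>(3) by (simp add: moll_def)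
    also have "\<dots> = (\<integral>z. (f (x + t *\<^sub>R z) - f x) * \<phi> z \<partial>lborel)"
      by (subst Bochner_Integration.integral_diff[OF i i2, symmetric]) (simp add: left_diff_distrib)
    finally show ?thesis
      using integral_abs_bound[of lborel "\<lambda>z. (f (x + t *\<^sub>R z) - f x) * \<phi> z"] \<phi>(2) by (simp add: abs_mult)
  qed
  have ii: "integrable lborel (\<lambda>z. \<bar>f (x + t *\<^sub>R z) - f x\<bar> * \<phi> z)" for x
  proof -
    have "integrable lborel (\<lambda>z. \<bar>f (x + t *\<^sub>R z) * \<phi> z - f x * \<phi> z\<bar>)" using i i2 by auto
    moreover have "\<bar>f (x + t *\<^sub>R z) * \<phi> z - f x * \<phi> z\<bar> = \<bar>f (x + t *\<^sub>R z) - f x\<bar> * \<phi> z" for z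
      using \<phi>(2)[of z] by (simp add: left_diff_distrib[symmetric] abs_mult)
    ultimately show ?thesis by simp
  qed
  have "(\<integral>\<^sup>+x. ennreal \<bar>moll \<phi> t f x - f x\<bar> \<partial>lborel)
     \<le> (\<integral>\<^sup>+x. (\<integral>\<^sup>+z. ennreal (\<bar>f (x + t *\<^sub>R z) - f x\<bar> * \<phi> z) \<partial>lborel) \<partial>lborel)"
    using le \<phi>(2) by (intro nn_integral_mono) (subst nn_integral_eq_integral[OF ii], auto simp: ennreal_leI)
  also have "\<dots> = (\<integral>\<^sup>+z. (\<integral>\<^sup>+x. ennreal (\<bar>f (x + t *\<^sub>R z) - f x\<bar> * \<phi> z) \<partial>lborel) \<partial>lborel)"
    by (rule lborel_pair.Fubini') measurable
  also have "\<dots> = (\<integral>\<^sup>+z. ennreal (\<phi> z * (\<integral>x. \<bar>f (x + t *\<^sub>R z) - f x\<bar> \<partial>lborel)) \<partial>lborel)"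
  proof (rule nn_integral_cong)
    fix z
    have "integrable lborel (\<lambda>x. \<bar>f (x + t *\<^sub>R z) - f x\<bar> * \<phi> z)"
      using integrable_lborel_translate[OF f, of "t *\<^sub>R z"] f by auto
    then show "(\<integral>\<^sup>+x. ennreal (\<bar>f (x + t *\<^sub>R z) - f x\<bar> * \<phi> z) \<partial>lborel)
      = ennreal (\<phi> z * (\<integral>x. \<bar>f (x + t *\<^sub>R z) - f x\<bar> \<partial>lborel))"
      using \<phi>(2) by (subst nn_integral_eq_integral) (auto simp: mult.commute)
  qed
  finally show ?thesis .
qed

lemma translation_modulus:
  fixes f :: "'n::finite fn"
  assumes f: "integrable lborel f"
  shows "(\<lambda>z. \<integral>x. \<bar>f (x + t *\<^sub>R z) - f x\<bar> \<partial>lborel) \<in> borel_measurable borel"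
    and "0 \<le> (\<integral>x. \<bar>f (x + h) - f x\<bar> \<partial>lborel)"
    and "(\<integral>x. \<bar>f (x + h) - f x\<bar> \<partial>lborel) \<le> 2 * (\<integral>x. \<bar>f x\<bar> \<partial>lborel)"
proof -
  have [measurable]: "f \<in> borel_measurable borel" using f by auto
  show "(\<lambda>z. \<integral>x. \<bar>f (x + t *\<^sub>R z) - f x\<bar> \<partial>lborel) \<in> borel_measurable borel" by measurable
  show "0 \<le> (\<integral>x. \<bar>f (x + h) - f x\<bar> \<partial>lborel)" by simp
  have i: "integrable lborel (\<lambda>x. f (x + h))" by (rule integrable_lborel_translate[OF f])
  have "(\<integral>x. \<bar>f (x + h) - f x\<bar> \<partial>lborel) \<le> (\<integral>x. \<bar>f (x + h)\<bar> + \<bar>f x\<bar> \<partial>lborel)"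
    using i f by (intro integral_mono) auto
  also have "\<dots> = 2 * (\<integral>x. \<bar>f x\<bar> \<partial>lborel)"
    using i f integral_lborel_translate[of "\<lambda>x. \<bar>f x\<bar>" h] by simp
  finally show "(\<integral>x. \<bar>f (x + h) - f x\<bar> \<partial>lborel) \<le> 2 * (\<integral>x. \<bar>f x\<bar> \<partial>lborel)" .
qed

text \<open>The translation moduli in \<open>moll_diff_bound\<close> tend to 0 for each z and are at
  most twice the L1 norm of f, so a multiple of \<phi> dominates. The centre of the support is
  arbitrary, as cones demand.\<close>

lemma moll_tendsto_L1:
  fixes f :: "'n::finite fn"
  assumes f: "integrable lborel f" and \<phi>: "kern c d \<phi>" "\<And>z. \<phi> z \<ge> 0" "integral\<^sup>L lborel \<phi> = 1"
    and t: "\<And>n. t n > 0" "t \<longlonglongrightarrow> 0"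
  shows "integrable lborel (moll \<phi> (t n) f)"
    and "(\<lambda>n. \<integral>x. \<bar>moll \<phi> (t n) f x - f x\<bar> \<partial>lborel) \<longlonglongrightarrow> 0"
proof -
  have [measurable]: "f \<in> borel_measurable borel" "\<phi> \<in> borel_measurable borel" using f kernD[OF \<phi>(1)] by auto
  note [measurable] = translation_modulus(1)[OF f]
  define R where "R n z = \<phi> z * (\<integral>x. \<bar>f (x + t n *\<^sub>R z) - f x\<bar> \<partial>lborel)" for n z
  have R0: "R n z \<ge> 0" for n z using \<phi>(2) translation_modulus(2)[OF f] by (simp add: R_def)
  have Rle: "R n z \<le> \<phi> z * (2 * (\<integral>x. \<bar>f x\<bar> \<partial>lborel))" for n z
    unfolding R_def using \<phi>(2) translation_modulus(3)[OF f] by (intro mult_left_mono) auto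
  have iw: "integrable lborel (\<lambda>z. \<phi> z * (2 * (\<integral>x. \<bar>f x\<bar> \<partial>lborel)))"
    using kern_integrable[OF \<phi>(1)] by simp
  have iR: "integrable lborel (R n)" for n
  proof (rule Bochner_Integration.integrable_bound[OF iw])
    show "R n \<in> borel_measurable lborel" by (simp add: R_def[abs_def])
    show "AE z in lborel. norm (R n z) \<le> norm (\<phi> z * (2 * (\<integral>x. \<bar>f x\<bar> \<partial>lborel)))"
      using R0 Rle by (intro AE_I2) (metis abs_of_nonneg order_trans real_norm_def)
  qed
  have bd: "(\<integral>\<^sup>+x. ennreal \<bar>moll \<phi> (t n) f x - f x\<bar> \<partial>lborel) \<le> ennreal (\<integral>z. R n z \<partial>lborel)" for n
    using moll_diff_bound[OF f \<phi> t(1)[of n], folded R_def] nn_integral_eq_integral[OF iR[of n]] R0 by simp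
  have id: "integrable lborel (\<lambda>x. moll \<phi> (t n) f x - f x)" for n
    by (rule integrableI_bounded) (use le_less_trans[OF bd[of n] ennreal_less_top] in auto)
  from Bochner_Integration.integrable_add[OF id f] show "integrable lborel (moll \<phi> (t n) f)" by simp
  have le: "(\<integral>x. \<bar>moll \<phi> (t n) f x - f x\<bar> \<partial>lborel) \<le> (\<integral>z. R n z \<partial>lborel)" for n
    using bd[of n] id[of n] R0 by (subst (asm) nn_integral_eq_integral) auto
  have "(\<lambda>n. \<integral>z. R n z \<partial>lborel) \<longlonglongrightarrow> (\<integral>z. 0 \<partial>(lborel::(real^'n) measure))"
  proof (rule integral_dominated_convergence[OF _ _ iw])
    show "AE z in lborel. (\<lambda>n. R n z) \<longlonglongrightarrow> 0"
    proof (intro AE_I2)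
      fix z :: "real^'n"
      have "(\<lambda>n. t n *\<^sub>R z) \<longlonglongrightarrow> 0 *\<^sub>R z" by (rule tendsto_scaleR[OF t(2) tendsto_const])
      then have "(\<lambda>n. R n z) \<longlonglongrightarrow> \<phi> z * 0" unfolding R_def
        by (intro tendsto_mult tendsto_const L1_translation_continuous f) simp
      then show "(\<lambda>n. R n z) \<longlonglongrightarrow> 0" by simp
    qed
    show "AE z in lborel. norm (R n z) \<le> \<phi> z * (2 * (\<integral>x. \<bar>f x\<bar> \<partial>lborel))" for n
      using R0 Rle by auto
    show "R n \<in> borel_measurable lborel" for n using iR by auto
  qed auto
  then have l: "(\<lambda>n. \<integral>z. R n z \<partial>lborel) \<longlonglongrightarrow> 0" by simp
  show "(\<lambda>n. \<integral>x. \<bar>moll \<phi> (t n) f x - f x\<bar> \<partial>lborel) \<longlonglongrightarrow> 0"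
    by (rule Lim_null_comparison[OF always_eventually l]) (use le in auto)
qed

section \<open>Weak derivatives\<close>

text \<open>Weak derivatives of Borel functions with respect to \<open>lborel\<close> rather than \<open>lebesgue\<close>:
  only there are Tonelli's theorem and the measurability of \<open>\<lambda>(x, z). f (x + t *\<^sub>R z)\<close> available.\<close>

definition wder :: "(real^'n::finite) set \<Rightarrow> 'n fn \<Rightarrow> 'n \<Rightarrow> 'n fn \<Rightarrow> bool" where
  "wder \<Omega> u i g \<longleftrightarrow> u \<in> borel_measurable borel \<and> g \<in> borel_measurable borel \<and>
     (\<forall>K. compact K \<and> K \<subseteq> \<Omega> \<longrightarrow> set_integrable lborel K u \<and> set_integrable lborel K g) \<and>
     (\<forall>\<phi>. test_fun \<Omega> \<phi> \<longrightarrow>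
        (\<integral>x. u x * partial i \<phi> x \<partial>lborel) = - (\<integral>x. g x * \<phi> x \<partial>lborel))"

lemma partialI: "(f has_derivative (\<lambda>h. \<Sum>i\<in>UNIV. h $ i * D i)) (at x) \<Longrightarrow> partial i f x = D i"
  unfolding partial_def
  by (subst frechet_derivative_at[symmetric], assumption) (simp add: axis_def if_distrib if_distribR cong: if_cong)

lemma partial_scaled:
  assumes "smooth \<eta>"
  shows "partial i (\<lambda>y. \<eta> (a *\<^sub>R (y - x))) y = a * partial i \<eta> (a *\<^sub>R (y - x))"
proof (rule partialI)
  have "((\<lambda>y. a *\<^sub>R (y - x)) has_derivative (\<lambda>h. a *\<^sub>R h)) (at y)"
    by (auto intro!: derivative_eq_intros)
  from has_derivative_compose[OF this smooth_partial(1)[OF assms]]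
  show "((\<lambda>y. \<eta> (a *\<^sub>R (y - x))) has_derivative (\<lambda>h. \<Sum>i\<in>UNIV. h $ i * (a * partial i \<eta> (a *\<^sub>R (y - x))))) (at y)"
    by (simp add: algebra_simps)
qed

lemma partial_eq_0:
  assumes "open U" "x \<in> U" "\<And>y. y \<in> U \<Longrightarrow> f y = 0"
  shows "partial i f x = 0"
proof (rule partialI[where D="\<lambda>_. 0", simplified])
  show "(f has_derivative (\<lambda>h. 0)) (at x)"
    by (rule has_derivative_transform_within_open[of "\<lambda>_. 0" _ _ _ U]) (use assms in auto)
qed

lemma kern_smooth_partial:
  assumes "smooth \<eta>" "kern c d \<eta>"
  shows "kern c d (partial i \<eta>)"
  unfolding kern_def
  using smooth_partial(2)[OF assms(1)] partial_eq_0[of "- cball c d" _ \<eta> i] kernD(2)[OF assms(2)] by auto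

lemma kern_coord_mult: "kern c d \<phi> \<Longrightarrow> kern c d (\<lambda>z. z $ i * \<phi> z)"
  by (auto simp: kern_def intro!: continuous_intros)

lemma kern_sum: "(\<And>i. kern c d (\<eta> i)) \<Longrightarrow> kern c d (\<lambda>z. \<Sum>i\<in>I. \<eta> i z)"
  by (auto simp: kern_def intro!: continuous_intros sum.neutral)

lemma compact_scaled_cball: "compact ((\<lambda>z::real^'n. x + t *\<^sub>R z) ` cball c d)"
  by (intro compact_continuous_image continuous_intros) auto

lemma test_fun_scaled:
  assumes "smooth \<eta>" "kern c d \<eta>" "t > 0" "(\<lambda>z. x + t *\<^sub>R z) ` cball c d \<subseteq> \<Omega>"
  shows "test_fun \<Omega> (\<lambda>y. \<eta> ((1/t) *\<^sub>R (y - x)))"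
proof -
  let ?K = "(\<lambda>z. x + t *\<^sub>R z) ` cball c d"
  have "{y. \<eta> ((1/t) *\<^sub>R (y - x)) \<noteq> 0} \<subseteq> ?K"
  proof
    fix y assume "y \<in> {y. \<eta> ((1/t) *\<^sub>R (y - x)) \<noteq> 0}"
    then have "(1/t) *\<^sub>R (y - x) \<in> cball c d" using kernD(2)[OF assms(2)] by auto
    moreover have "y = x + t *\<^sub>R ((1/t) *\<^sub>R (y - x))" using assms(3) by simp
    ultimately show "y \<in> ?K" by blast
  qed
  then have sub: "closure {y. \<eta> ((1/t) *\<^sub>R (y - x)) \<noteq> 0} \<subseteq> ?K"
    by (intro closure_minimal compact_imp_closed compact_scaled_cball)
  then have "compact (closure {y. \<eta> ((1/t) *\<^sub>R (y - x)) \<noteq> 0})"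
    by (metis inf.absorb_iff1 closed_closure compact_scaled_cball closed_Int_compact)
  moreover have "smooth (\<lambda>y. \<eta> ((1/t) *\<^sub>R (y - x)))"
    using assms(1) Ck_compose_affine unfolding smooth_def by blast
  ultimately show ?thesis unfolding test_fun_def using sub assms(4) by auto
qed

lemma wderD:
  assumes "wder \<Omega> u i g"
  shows "u \<in> borel_measurable borel" "g \<in> borel_measurable borel"
    "compact K \<Longrightarrow> K \<subseteq> \<Omega> \<Longrightarrow> set_integrable lborel K u"
    "compact K \<Longrightarrow> K \<subseteq> \<Omega> \<Longrightarrow> set_integrable lborel K g"
    "test_fun \<Omega> \<phi> \<Longrightarrow> (\<integral>x. u x * partial i \<phi> x \<partial>lborel) = - (\<integral>x. g x * \<phi> x \<partial>lborel)"
  using assms unfolding wder_def by auto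

text \<open>The weak derivative is tested with y -> \<eta>((y - x) / t); the inner derivative 1/t is
  the origin of the factor t.\<close>

lemma wder_moll:
  assumes w: "wder \<Omega> u i g" and \<eta>: "smooth \<eta>" "kern c d \<eta>" and t: "t > 0"
    and sub: "(\<lambda>z. x + t *\<^sub>R z) ` cball c d \<subseteq> \<Omega>"
  shows "moll (partial i \<eta>) t u x = - t * moll \<eta> t g x"
proof -
  have [measurable]: "\<eta> \<in> borel_measurable borel" "partial i \<eta> \<in> borel_measurable borel"
     "u \<in> borel_measurable borel" "g \<in> borel_measurable borel"
    using wderD(1,2)[OF w] kernD(3)[OF \<eta>(2)] kernD(3)[OF kern_smooth_partial[OF \<eta>]] by auto
  have "(\<integral>y. u y * partial i (\<lambda>y. \<eta> ((1/t) *\<^sub>R (y - x))) y \<partial>lborel) = - (\<integral>y. g y * \<eta> ((1/t) *\<^sub>R (y - x)) \<partial>lborel)"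
    by (rule wderD(5)[OF w test_fun_scaled[OF \<eta> t sub]])
  then have "(1/t) * (\<integral>y. u y * partial i \<eta> ((1/t) *\<^sub>R (y - x)) \<partial>lborel) = - (\<integral>y. g y * \<eta> ((1/t) *\<^sub>R (y - x)) \<partial>lborel)"
    unfolding partial_scaled[OF \<eta>(1)] by (subst integral_mult_right_zero[symmetric]) (simp add: ac_simps)
  then have "(\<integral>y. u y * partial i \<eta> ((1/t) *\<^sub>R (y - x)) \<partial>lborel) = - t * (\<integral>y. g y * \<eta> ((1/t) *\<^sub>R (y - x)) \<partial>lborel)"
    using t by (simp add: field_simps)
  then show ?thesis using t by (simp add: moll_eq)
qed

text \<open>A kernel sees f only on x + t * support. Cutting f off outside a set K that contains it
  turns local integrability into global integrability, the form in which the estimates for averages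
  are stated.\<close>

lemma moll_cong_indicator:
  assumes "kern c d \<eta>" "(\<lambda>z. x + t *\<^sub>R z) ` cball c d \<subseteq> K"
  shows "f (x + t *\<^sub>R z) * \<eta> z = (indicator K (x + t *\<^sub>R z) * f (x + t *\<^sub>R z)) * \<eta> z"
    and "moll \<eta> t f x = moll \<eta> t (\<lambda>y. indicator K y * f y) x"
proof -
  show *: "f (x + t *\<^sub>R z) * \<eta> z = (indicator K (x + t *\<^sub>R z) * f (x + t *\<^sub>R z)) * \<eta> z" for z
  proof (cases "z \<in> cball c d")
    case True
    then have "x + t *\<^sub>R z \<in> K" using assms(2) by blast
    then show ?thesis by simp
  qed (simp add: kernD(2)[OF assms(1)])
  show "moll \<eta> t f x = moll \<eta> t (\<lambda>y. indicator K y * f y) x"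
    unfolding moll_def by (subst *) (rule refl)
qed

lemma moll_integrand_integrable_local:
  assumes "set_integrable lborel K f" "kern c d \<eta>" "(\<lambda>z. x + t *\<^sub>R z) ` cball c d \<subseteq> K" "t > 0"
  shows "integrable lborel (\<lambda>z. f (x + t *\<^sub>R z) * \<eta> z)"
  unfolding moll_cong_indicator(1)[OF assms(2,3)]
  by (rule moll_integrand_integrable[OF _ assms(2,4)]) (use assms(1) in \<open>simp add: set_integrable_def\<close>)

text \<open>All kernels \<open>\<psi> s\<close> with s near \<open>s0\<close> are supported in one
  compact set K, so B |u| restricted to K dominates; integrability of u on K is enough.\<close>

lemma deriv_kernel_integral:
  fixes u :: "'a::euclidean_space \<Rightarrow> real"
  assumes d: "d > 0" and K: "compact K" and u: "set_integrable lborel K u" and [measurable]: "u \<in> borel_measurable borel"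
    and der: "\<And>s y. \<bar>s - s0\<bar> < d \<Longrightarrow> ((\<lambda>s. \<psi> s y) has_real_derivative \<psi>' s y) (at s)"
    and meas[measurable]: "\<And>s. \<psi> s \<in> borel_measurable borel" "\<And>s. \<psi>' s \<in> borel_measurable borel"
    and supp: "\<And>s y. \<bar>s - s0\<bar> < d \<Longrightarrow> y \<notin> K \<Longrightarrow> \<psi> s y = 0" "\<And>s y. \<bar>s - s0\<bar> < d \<Longrightarrow> y \<notin> K \<Longrightarrow> \<psi>' s y = 0"
    and bd: "\<And>s y. \<bar>s - s0\<bar> < d \<Longrightarrow> \<bar>\<psi> s y\<bar> \<le> B" "\<And>s y. \<bar>s - s0\<bar> < d \<Longrightarrow> \<bar>\<psi>' s y\<bar> \<le> B"
  shows "((\<lambda>s. \<integral>y. u y * \<psi> s y \<partial>lborel) has_real_derivative (\<integral>y. u y * \<psi>' s0 y \<partial>lborel)) (at s0)"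
proof -
  define w where "w y = B * \<bar>indicator K y * u y\<bar>" for y
  have w: "integrable lborel w" using u unfolding w_def set_integrable_def by simp
  have le: "\<bar>u y * \<psi> s y\<bar> \<le> w y" "\<bar>u y * \<psi>' s y\<bar> \<le> w y" if "\<bar>s - s0\<bar> < d" for s y
    using supp[OF that, of y] bd[OF that, of y]
    by (auto simp: w_def indicator_def abs_mult mult.commute[of B] intro!: mult_left_mono)
  show ?thesis
  proof (rule has_derivative_under_integral[OF d _ _ _ _ w])
    show "((\<lambda>s. u y * \<psi> s y) has_real_derivative u y * \<psi>' s y) (at s)" if "\<bar>s - s0\<bar> < d" for s y
      using der[OF that, of y] by (rule DERIV_cmult)
    show "integrable lborel (\<lambda>y. u y * \<psi> s y)" if "\<bar>s - s0\<bar> < d" for s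
      by (rule Bochner_Integration.integrable_bound[OF w])
        (use le(1)[OF that] in \<open>auto intro: order_trans abs_ge_self\<close>)
  qed (use le in auto)
qed

section \<open>Derivatives of averages in position and in scale\<close>

lemma smooth_line_derivative:
  assumes "smooth \<phi>" "(l has_vector_derivative v) (at s)"
  shows "((\<lambda>s. \<phi> (l s)) has_real_derivative (\<Sum>i\<in>UNIV. v $ i * partial i \<phi> (l s))) (at s)"
proof -
  have "((\<lambda>s. \<phi> (l s)) has_derivative (\<lambda>h. \<Sum>i\<in>UNIV. (h *\<^sub>R v) $ i * partial i \<phi> (l s))) (at s)"
    by (rule has_derivative_compose[OF assms(2)[unfolded has_vector_derivative_def] smooth_partial(1)[OF assms(1)]])
  moreover have "(\<lambda>h. \<Sum>i\<in>UNIV. (h *\<^sub>R v) $ i * partial i \<phi> (l s)) = (*) (\<Sum>i\<in>UNIV. v $ i * partial i \<phi> (l s))"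
    by (auto simp: fun_eq_iff sum_distrib_left sum_distrib_right ac_simps)
  ultimately show ?thesis unfolding has_field_derivative_def by simp
qed

text \<open>The Minkowski sum of S with a closed ball. It is compact for compact S and so can hold
  the supports of all kernels whose parameters vary a little.\<close>

definition fatten :: "'a::real_normed_vector set \<Rightarrow> real \<Rightarrow> 'a set" where
  "fatten S r = (\<lambda>(y,h). y + h) ` (S \<times> cball 0 r)"

lemma compact_fatten: "compact S \<Longrightarrow> compact (fatten S r :: 'a::euclidean_space set)"
  unfolding fatten_def
  by (intro compact_continuous_image compact_Times compact_cball) (auto simp: case_prod_beta intro!: continuous_intros)

lemma fattenI: "y \<in> S \<Longrightarrow> norm h \<le> r \<Longrightarrow> y + h \<in> fatten S r"
  unfolding fatten_def by (force simp: dist_norm)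

lemma fatten_open_obtain:
  fixes S :: "'a::euclidean_space set"
  assumes "compact S" "open \<Omega>" "S \<subseteq> \<Omega>"
  obtains r where "r > 0" "fatten S r \<subseteq> \<Omega>"
proof -
  obtain r where r: "r > 0" "(\<Union>x\<in>S. cball x r) \<subseteq> \<Omega>"
    using compact_subset_open_imp_cball_epsilon_subset[OF assms] by blast
  have "fatten S r \<subseteq> \<Omega>"
    using r(2) unfolding fatten_def by (fastforce simp: dist_norm subset_iff)
  with r that show ?thesis by blast
qed

text \<open>Moving x moves the kernel, so the derivative falls on \<phi>, and
  \<open>wder_moll\<close> shifts it to u: averaging commutes with the weak derivative.\<close>

lemma moll_dx:
  fixes u :: "'n::finite fn"
  assumes w: "wder \<Omega> u i g" and \<Omega>: "open \<Omega>" and \<phi>: "smooth \<phi>" "kern c d \<phi>" and t: "t > 0"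
    and sub: "(\<lambda>z. x + t *\<^sub>R z) ` cball c d \<subseteq> \<Omega>"
  shows "((\<lambda>s. moll \<phi> t u (x + s *\<^sub>R axis i 1)) has_real_derivative moll \<phi> t g x) (at 0)"
proof -
  let ?S = "(\<lambda>z. x + t *\<^sub>R z) ` cball c d"
  let ?e = "axis i 1 :: real^'n"
  obtain r where r: "r > 0" "fatten ?S r \<subseteq> \<Omega>" using fatten_open_obtain[OF compact_scaled_cball \<Omega> sub] by blast
  let ?K = "fatten ?S r"
  have K: "compact ?K" by (intro compact_fatten compact_scaled_cball)
  have [measurable]: "\<phi> \<in> borel_measurable borel" "partial j \<phi> \<in> borel_measurable borel"
     "u \<in> borel_measurable borel" "g \<in> borel_measurable borel" for j
    using wderD(1,2)[OF w] kernD(3)[OF \<phi>(2)] kernD(3)[OF kern_smooth_partial[OF \<phi>]] by auto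
  obtain B1 where B1: "\<And>z. \<bar>\<phi> z\<bar> \<le> B1" using kern_bounded[OF \<phi>(2)] by metis
  obtain B2 where B2: "\<And>z. \<bar>partial i \<phi> z\<bar> \<le> B2" using kern_bounded[OF kern_smooth_partial[OF \<phi>]] by metis
  define \<psi> where "\<psi> s y = \<phi> ((1/t) *\<^sub>R (y - (x + s *\<^sub>R ?e)))" for s y
  define \<psi>' where "\<psi>' s y = - (1/t) * partial i \<phi> ((1/t) *\<^sub>R (y - (x + s *\<^sub>R ?e)))" for s y
  have inK: "y \<in> ?K" if "(1/t) *\<^sub>R (y - (x + s *\<^sub>R ?e)) \<in> cball c d" "\<bar>s - 0\<bar> < r" for s y
  proof -
    have "y = (x + t *\<^sub>R ((1/t) *\<^sub>R (y - (x + s *\<^sub>R ?e)))) + s *\<^sub>R ?e" using t by simp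
    also have "\<dots> \<in> ?K" using that by (intro fattenI imageI) auto
    finally show ?thesis .
  qed
  have "((\<lambda>s. \<integral>y. u y * \<psi> s y \<partial>lborel) has_real_derivative (\<integral>y. u y * \<psi>' 0 y \<partial>lborel)) (at 0)"
  proof (rule deriv_kernel_integral[OF r(1) K wderD(3)[OF w K r(2)]])
    fix s y
    have "((\<lambda>s. (1/t) *\<^sub>R (y - (x + s *\<^sub>R ?e))) has_vector_derivative (-(1/t)) *\<^sub>R ?e) (at s)"
      by (auto intro!: derivative_eq_intros)
    from smooth_line_derivative[OF \<phi>(1) this]
    show "((\<lambda>s. \<psi> s y) has_real_derivative \<psi>' s y) (at s)"
      by (simp add: \<psi>_def \<psi>'_def axis_def if_distrib if_distribR sum_negf sum_divide_distrib[symmetric] cong: if_cong)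
  next
    fix s y assume s: "\<bar>s - 0\<bar> < r"
    show "\<bar>\<psi> s y\<bar> \<le> max B1 (B2 / t)" using B1 by (auto simp: \<psi>_def intro: max.coboundedI1)
    show "\<bar>\<psi>' s y\<bar> \<le> max B1 (B2 / t)"
      using B2 t by (intro max.coboundedI2) (simp add: \<psi>'_def abs_mult divide_right_mono)
    assume "y \<notin> ?K"
    then have "(1/t) *\<^sub>R (y - (x + s *\<^sub>R ?e)) \<notin> cball c d" using inK s by blast
    then show "\<psi> s y = 0" "\<psi>' s y = 0"
      unfolding \<psi>_def \<psi>'_def using kernD(2)[OF \<phi>(2)] kernD(2)[OF kern_smooth_partial[OF \<phi>]] by auto
  qed (simp_all add: \<psi>_def[abs_def] \<psi>'_def[abs_def])
  from DERIV_cmult[OF this, of "1 / t ^ CARD('n)"]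
  have "((\<lambda>s. moll \<phi> t u (x + s *\<^sub>R ?e)) has_real_derivative (1 / t ^ CARD('n)) * (\<integral>y. u y * \<psi>' 0 y \<partial>lborel)) (at 0)"
    using t by (simp add: moll_eq \<psi>_def)
  moreover have "(1 / t ^ CARD('n)) * (\<integral>y. u y * \<psi>' 0 y \<partial>lborel) = - (1/t) * moll (partial i \<phi>) t u x"
    using t by (simp add: moll_eq \<psi>'_def)
  moreover have "- (1/t) * moll (partial i \<phi>) t u x = moll \<phi> t g x"
    using wder_moll[OF w \<phi> t sub] t by simp
  ultimately show ?thesis by simp
qed

text \<open>Writing \<open>z = (y - x) / t\<close>, the \<open>t\<close>-derivative of \<open>t\<^sup>-\<^sup>n \<phi>(z)\<close> is minus the divergence in \<open>y\<close> of
  \<open>t\<^sup>-\<^sup>n \<phi>(z) z\<close>, which is an admissible test field even when \<open>x\<close> is close to the boundary.\<close>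

lemma moll_dt:
  fixes u :: "'n::finite fn"
  assumes w: "\<And>i. wder \<Omega> u i (g i)" and \<Omega>: "open \<Omega>" and \<phi>: "smooth \<phi>" "kern c d \<phi>" and t: "t > 0"
    and sub: "(\<lambda>z. x + t *\<^sub>R z) ` cball c d \<subseteq> \<Omega>"
  shows "((\<lambda>t. moll \<phi> t u x) has_real_derivative (\<Sum>i\<in>UNIV. moll (\<lambda>z. z $ i * \<phi> z) t (g i) x)) (at t)"
proof -
  let ?S = "(\<lambda>z. x + t *\<^sub>R z) ` cball c d"
  let ?n = "CARD('n)"
  obtain r where r: "r > 0" "fatten ?S r \<subseteq> \<Omega>" using fatten_open_obtain[OF compact_scaled_cball \<Omega> sub] by blast
  let ?K = "fatten ?S r"
  have K: "compact ?K" by (intro compact_fatten compact_scaled_cball)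
  define \<eta> where "\<eta> i z = z $ i * \<phi> z" for i z
  have \<eta>s: "smooth (\<eta> i)" for i using \<phi>(1) unfolding smooth_def \<eta>_def by (auto intro!: Ck_mult Ck_nth simp del: Ck.simps)
  have \<eta>k: "kern c d (\<eta> i)" for i unfolding \<eta>_def by (rule kern_coord_mult[OF \<phi>(2)])
  have p\<eta>: "partial i (\<eta> i) z = \<phi> z + z $ i * partial i \<phi> z" for i z
  proof -
    have "(\<eta> i has_derivative (\<lambda>h. z $ i * (\<Sum>j\<in>UNIV. h $ j * partial j \<phi> z) + h $ i * \<phi> z)) (at z)"
      unfolding \<eta>_def using smooth_partial(1)[OF \<phi>(1), of z]
      by (intro has_derivative_mult bounded_linear_imp_has_derivative[OF bounded_linear_vec_nth])
    moreover have "h $ i * \<phi> z = (\<Sum>j\<in>UNIV. h $ j * (if j = i then \<phi> z else 0))" for h :: "real^'n"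
      by (simp add: if_distrib cong: if_cong)
    ultimately have "(\<eta> i has_derivative (\<lambda>h. \<Sum>j\<in>UNIV. h $ j * (z $ i * partial j \<phi> z + (if j = i then \<phi> z else 0)))) (at z)"
      by (simp only: distrib_left sum.distrib sum_distrib_left mult.left_commute)
    from partialI[OF this, of i] show ?thesis by simp
  qed
  \<comment> \<open>The divergence of the field z \<phi>(z). Up to the factor -1/t it is the kernel
    of the t-derivative: n \<phi> stems from the factor t^-n, the rest from the argument of
    \<phi>.\<close>
  define Q where "Q z = (\<Sum>i\<in>UNIV. partial i (\<eta> i) z)" for z
  have Qk: "kern c d Q" unfolding Q_def by (intro kern_sum kern_smooth_partial \<eta>s \<eta>k)
  have Qeq: "Q z = ?n * \<phi> z + (\<Sum>i\<in>UNIV. z $ i * partial i \<phi> z)" for z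
    unfolding Q_def p\<eta> by (simp add: sum.distrib)
  have [measurable]: "\<phi> \<in> borel_measurable borel" "Q \<in> borel_measurable borel"
     "u \<in> borel_measurable borel" "g j \<in> borel_measurable borel" for j
    using wderD(1,2)[OF w] kernD(3)[OF \<phi>(2)] kernD(3)[OF Qk] by auto
  obtain B1 where B1: "B1 > 0" "\<And>z. \<bar>\<phi> z\<bar> \<le> B1" using kern_bounded[OF \<phi>(2)] by metis
  obtain B2 where B2: "B2 > 0" "\<And>z. \<bar>Q z\<bar> \<le> B2" using kern_bounded[OF Qk] by metis
  define R where "R = norm c + \<bar>d\<bar> + 1"
  have R: "R > 0" unfolding R_def by (smt (verit) norm_ge_zero)
  have Rz: "norm z \<le> R" if "z \<in> cball c d" for z
  proof -
    have "norm z \<le> norm c + norm (z - c)" by (metis add.commute diff_add_cancel norm_triangle_ineq)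
    with that show ?thesis by (auto simp: R_def dist_norm norm_minus_commute)
  qed
  \<comment> \<open>\<open>t/2\<close> keeps the scale away from 0, and a change of scale by at most
    \<open>r / R\<close> moves each point of the support by at most r.\<close>
  define \<delta> where "\<delta> = min (t/2) (r / R)"
  have \<delta>: "\<delta> > 0" using t r R by (simp add: \<delta>_def)
  define \<psi> where "\<psi> s y = (1 / s ^ ?n) * \<phi> ((1/s) *\<^sub>R (y - x))" for s y
  define \<psi>' where "\<psi>' s y = - (1/s) * (1 / s ^ ?n) * Q ((1/s) *\<^sub>R (y - x))" for s y
  have inK: "y \<in> ?K" if z: "(1/s) *\<^sub>R (y - x) \<in> cball c d" and s: "\<bar>s - t\<bar> < \<delta>" for s y
  proof -
    let ?z = "(1/s) *\<^sub>R (y - x)"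
    have s0: "s > 0" using s t unfolding \<delta>_def by (simp add: abs_if split: if_splits)
    have "y = x + s *\<^sub>R ?z" using s0 by simp
    moreover have "x + s *\<^sub>R z = (x + t *\<^sub>R z) + (s - t) *\<^sub>R z" for z
      by (simp add: scaleR_left_diff_distrib)
    ultimately have "y = (x + t *\<^sub>R ?z) + (s - t) *\<^sub>R ?z" by (simp only:)
    also have "\<dots> \<in> ?K"
    proof (rule fattenI[OF imageI[OF z]])
      have "norm ((s - t) *\<^sub>R ?z) \<le> (r / R) * R"
        unfolding norm_scaleR[of "s - t"] using s Rz[OF z] R r by (intro mult_mono) (auto simp: \<delta>_def)
      then show "norm ((s - t) *\<^sub>R ?z) \<le> r" using R by simp
    qed
    finally show ?thesis .
  qed
  define B where "B = max ((2/t)^?n * B1) ((2/t) * (2/t)^?n * B2)"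
  have "((\<lambda>s. \<integral>y. u y * \<psi> s y \<partial>lborel) has_real_derivative (\<integral>y. u y * \<psi>' t y \<partial>lborel)) (at t)"
  proof (rule deriv_kernel_integral[OF \<delta> K wderD(3)[OF w K r(2)]])
    fix s y assume s: "\<bar>s - t\<bar> < \<delta>"
    then have s0: "s > 0" using t unfolding \<delta>_def by (simp add: abs_if split: if_splits)
    have st: "1/s \<le> 2/t" using s t s0 unfolding \<delta>_def by (simp add: field_simps abs_if split: if_splits)
    have stn: "1/s^?n \<le> (2/t)^?n" using power_mono[OF st, of ?n] s0 by (simp add: power_divide)
    have "((\<lambda>s. 1/s) has_real_derivative - (1/s^2)) (at s)"
      using s0 by (auto intro!: derivative_eq_intros simp: power2_eq_square field_simps)
    then have "((\<lambda>s. (1/s) *\<^sub>R (y - x)) has_vector_derivative (- (1/s^2)) *\<^sub>R (y - x)) (at s)"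
      by (rule has_vector_derivative_scaleR[OF _ has_vector_derivative_const, simplified])
    from smooth_line_derivative[OF \<phi>(1) this]
    have d1: "((\<lambda>s. \<phi> ((1/s) *\<^sub>R (y - x))) has_real_derivative
       - (1/s) * (\<Sum>i\<in>UNIV. ((1/s) *\<^sub>R (y - x)) $ i * partial i \<phi> ((1/s) *\<^sub>R (y - x)))) (at s)"
      by (elim DERIV_cong) (simp add: sum_distrib_left power2_eq_square algebra_simps)
    have d2: "((\<lambda>s. 1/s^?n) has_real_derivative - (1/s) * (1 / s^?n) * ?n) (at s)"
    proof -
      have pos: "?n > 0" by simp
      have "((\<lambda>s. 1/s^?n) has_real_derivative - (?n * s ^ (?n - 1)) / (s ^ ?n)^2) (at s)"
        using s0 by (auto intro!: derivative_eq_intros simp: power2_eq_square)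
      moreover have "s ^ ?n = s * s ^ (?n - 1)" using pos by (metis power_eq_if neq0_conv)
      ultimately show ?thesis using s0 by (elim DERIV_cong) (simp add: power2_eq_square field_simps)
    qed
    show "((\<lambda>s. \<psi> s y) has_real_derivative \<psi>' s y) (at s)"
      unfolding \<psi>_def \<psi>'_def Qeq by (rule DERIV_cong[OF DERIV_mult[OF d2 d1]]) (simp add: algebra_simps)
    show "\<bar>\<psi> s y\<bar> \<le> B"
    proof -
      have "\<bar>\<psi> s y\<bar> \<le> (2/t)^?n * B1" unfolding \<psi>_def abs_mult
        by (rule mult_mono) (use stn s0 t B1 in auto)
      then show ?thesis by (simp add: B_def)
    qed
    show "\<bar>\<psi>' s y\<bar> \<le> B"
    proof -
      have "\<bar>\<psi>' s y\<bar> \<le> (2/t) * (2/t)^?n * B2" unfolding \<psi>'_def abs_mult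
        by (intro mult_mono) (use st stn s0 t B2 in auto)
      then show ?thesis by (simp add: B_def)
    qed
    assume "y \<notin> ?K"
    then have "(1/s) *\<^sub>R (y - x) \<notin> cball c d" using inK s by blast
    then show "\<psi> s y = 0" "\<psi>' s y = 0"
      unfolding \<psi>_def \<psi>'_def using kernD(2)[OF \<phi>(2)] kernD(2)[OF Qk] by auto
  qed (simp_all add: \<psi>_def[abs_def] \<psi>'_def[abs_def])
  then have "((\<lambda>s. moll \<phi> s u x) has_real_derivative (\<integral>y. u y * \<psi>' t y \<partial>lborel)) (at t)"
  proof (rule has_field_derivative_transform_within_open[of _ _ _ "{0<..}"])
    fix s :: real assume "s \<in> {0<..}"
    then show "(\<integral>y. u y * \<psi> s y \<partial>lborel) = moll \<phi> s u x"
      by (simp add: moll_eq \<psi>_def)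
  qed (use t in auto)
  moreover have "(\<integral>y. u y * \<psi>' t y \<partial>lborel) = - (1/t) * moll Q t u x"
    using t by (simp add: moll_eq \<psi>'_def)
  moreover have "moll Q t u x = (\<Sum>i\<in>UNIV. moll (partial i (\<eta> i)) t u x)"
    unfolding moll_def Q_def sum_distrib_left
    by (intro Bochner_Integration.integral_sum
         moll_integrand_integrable_local[OF wderD(3)[OF w compact_scaled_cball sub] kern_smooth_partial[OF \<eta>s \<eta>k] order_refl t])
  moreover have "moll (partial i (\<eta> i)) t u x = - t * moll (\<eta> i) t (g i) x" for i
    by (rule wder_moll[OF w \<eta>s \<eta>k t sub])
  ultimately show ?thesis using t unfolding \<eta>_def by (simp add: sum_negf sum_distrib_left)
qed

section \<open>Chain rule for C1 functions with bounded derivative\<close>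

lemma integrable_indicator_compact: "compact S \<Longrightarrow> integrable lborel (indicator S :: 'a::euclidean_space \<Rightarrow> real)"
  by (rule integrable_real_indicator) (auto simp: borel_compact intro: emeasure_compact_finite[unfolded infinity_ennreal_def])

lemma moll_bound:
  assumes f: "integrable lborel f" and \<eta>: "kern c d \<eta>" "\<And>z. \<bar>\<eta> z\<bar> \<le> B" and t: "t > 0"
  shows "\<bar>moll \<eta> t f (x :: real^'n::finite)\<bar> \<le> B / t ^ CARD('n) * (\<integral>y. \<bar>f y\<bar> \<partial>lborel)"
proof -
  have [measurable]: "f \<in> borel_measurable borel" "\<eta> \<in> borel_measurable borel" using f kernD(3)[OF \<eta>(1)] by auto
  have "\<bar>moll \<eta> t f x\<bar> \<le> (\<integral>z. \<bar>f (x + t *\<^sub>R z) * \<eta> z\<bar> \<partial>lborel)"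
    unfolding moll_def by (rule integral_abs_bound)
  also have "\<dots> \<le> (\<integral>z. B * \<bar>f (x + t *\<^sub>R z)\<bar> \<partial>lborel)"
  proof (rule integral_mono)
    show "integrable lborel (\<lambda>z. \<bar>f (x + t *\<^sub>R z) * \<eta> z\<bar>)"
      using moll_integrand_integrable[OF f \<eta>(1) t, of x] by (rule integrable_abs)
    show "integrable lborel (\<lambda>z. B * \<bar>f (x + t *\<^sub>R z)\<bar>)"
      using integrable_lborel_affine[OF f, of t x] t by simp
    show "\<bar>f (x + t *\<^sub>R z) * \<eta> z\<bar> \<le> B * \<bar>f (x + t *\<^sub>R z)\<bar>" for z
      using mult_left_mono[OF \<eta>(2)[of z], of "\<bar>f (x + t *\<^sub>R z)\<bar>"] by (simp add: abs_mult mult.commute)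
  qed
  also have "\<dots> = B / t ^ CARD('n) * (\<integral>y. \<bar>f y\<bar> \<partial>lborel)"
    using t by (subst (2) integral_lborel_affine[of _ t x]) auto
  finally show ?thesis .
qed

text \<open>The integral of G(x + s e) does not depend on s, and its derivative at s = 0 is the
  integral of G'. This is the integration by parts behind the chain rule.\<close>

lemma integral_directional_derivative_eq_0:
  fixes G :: "'a::euclidean_space \<Rightarrow> real"
  assumes S: "compact S" and G: "G \<in> borel_measurable borel" "G' \<in> borel_measurable borel"
    and supp: "\<And>x. x \<notin> S \<Longrightarrow> G x = 0" "\<And>x. x \<notin> S \<Longrightarrow> G' x = 0"
    and der: "\<And>x. ((\<lambda>s. G (x + s *\<^sub>R e)) has_real_derivative G' x) (at 0)"
    and bd: "\<And>x. \<bar>G x\<bar> \<le> B" "\<And>x. \<bar>G' x\<bar> \<le> B"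
  shows "(\<integral>x. G' x \<partial>lborel) = 0"
proof -
  note [measurable] = G
  let ?K = "fatten S (norm e)"
  have K: "compact ?K" by (rule compact_fatten[OF S])
  then have [measurable]: "?K \<in> sets borel" by (simp add: borel_compact)
  have sup: "x + s *\<^sub>R e \<notin> S" if "x \<notin> ?K" "\<bar>s\<bar> < 1" for x s
  proof
    assume "x + s *\<^sub>R e \<in> S"
    from fattenI[OF this, of "- (s *\<^sub>R e)" "norm e"] that show False
      by (simp add: mult_left_le_one_le)
  qed
  have "((\<lambda>s. \<integral>x. 1 * G (x + s *\<^sub>R e) \<partial>lborel) has_real_derivative (\<integral>x. 1 * G' (x + 0 *\<^sub>R e) \<partial>lborel)) (at 0)"
  proof (rule deriv_kernel_integral[where \<psi>="\<lambda>s x. G (x + s *\<^sub>R e)" and \<psi>'="\<lambda>s x. G' (x + s *\<^sub>R e)" and d=1 and K="?K" and B=B])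
    show "set_integrable lborel ?K (\<lambda>y. 1::real)"
      using integrable_indicator_compact[OF K(1)] by (simp add: set_integrable_def)
    show "((\<lambda>s. G (y + s *\<^sub>R e)) has_real_derivative G' (y + s *\<^sub>R e)) (at s)" for s y
      using der[of "y + s *\<^sub>R e"] DERIV_shift[of "\<lambda>s. G (y + s *\<^sub>R e)" "G' (y + s *\<^sub>R e)" 0 s]
      by (simp add: algebra_simps)
  qed (use K sup supp bd in auto)
  moreover have "(\<integral>x. 1 * G (x + s *\<^sub>R e) \<partial>lborel) = (\<integral>x. G x \<partial>lborel)" for s
    using integral_lborel_translate[OF G(1)] by simp
  ultimately have "((\<lambda>s::real. \<integral>x. G x \<partial>lborel) has_real_derivative (\<integral>x. G' x \<partial>lborel)) (at 0)" by simp
  from DERIV_unique[OF this DERIV_const] show ?thesis .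
qed

lemma test_fun_kern:
  assumes "test_fun \<Omega> \<zeta>"
  obtains S R where "compact S" "S \<subseteq> \<Omega>" "\<And>x. x \<notin> S \<Longrightarrow> \<zeta> x = 0" "\<And>i x. x \<notin> S \<Longrightarrow> partial i \<zeta> x = 0"
    "smooth \<zeta>" "kern 0 R \<zeta>" "\<And>i. kern 0 R (partial i \<zeta>)"
proof -
  define S where "S = closure {x. \<zeta> x \<noteq> 0}"
  have S: "compact S" "S \<subseteq> \<Omega>" "smooth \<zeta>" using assms by (auto simp: test_fun_def S_def)
  have z: "\<zeta> x = 0" if "x \<notin> S" for x 
    using that closure_subset[of "{x. \<zeta> x \<noteq> 0}"] unfolding S_def by blast
  have pz: "partial i \<zeta> x = 0" if "x \<notin> S" for x i
    by (rule partial_eq_0[of "- S"]) (use that z S(1) in \<open>simp_all add: open_Compl compact_imp_closed\<close>)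
  obtain R where R: "S \<subseteq> cball 0 R" 
    using compact_imp_bounded[OF S(1)] unfolding bounded_iff subset_iff mem_cball_0 by metis
  have "continuous_on UNIV \<zeta>" using S(3) Ck_continuous[of 0 \<zeta>] by (simp add: smooth_def del: Ck.simps)
  then have "kern 0 R \<zeta>" unfolding kern_def using R z by blast
  moreover from kern_smooth_partial[OF S(3) this] have "\<And>i. kern 0 R (partial i \<zeta>)" .
  ultimately show ?thesis using S z pz by (intro that[of S R])
qed

text \<open>Averages v of u are differentiable along the axis, so F(v) \<zeta> obeys the classical
  product rule and its derivative integrates to 0; the weak identity is the limit t -> 0. The bound
  on F' gives |F(u)| linear growth in |u| and controls both limits.\<close>

lemma wder_chain:
  assumes w: "wder \<Omega> u i g" and \<Omega>: "open (\<Omega> :: (real^'n::finite) set)"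
    and F: "\<And>x. (F has_real_derivative F' x) (at x)" and F'c: "continuous_on UNIV F'"
    and F'b: "\<And>x. \<bar>F' x\<bar> \<le> M"
  shows "wder \<Omega> (\<lambda>x. F (u x)) i (\<lambda>x. F' (u x) * g x)"
proof -
  have Fc: "continuous_on UNIV F" by (rule DERIV_continuous_on) (rule has_field_derivative_at_within[OF F])
  note [measurable] = wderD(1,2)[OF w] borel_measurable_continuous_onI[OF Fc] borel_measurable_continuous_onI[OF F'c]
  have M0: "M \<ge> 0" using F'b[of 0] by linarith
  have FL: "\<bar>F a - F b\<bar> \<le> M * \<bar>a - b\<bar>" for a b
    using field_differentiable_bound[of UNIV F F' M a b] F F'b by (auto intro: has_field_derivative_at_within)
  have F0: "\<bar>F a\<bar> \<le> \<bar>F 0\<bar> + M * \<bar>a\<bar>" for a using FL[of a 0] by simp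
  have int1: "set_integrable lborel K (\<lambda>x. F (u x))" if K: "compact K" "K \<subseteq> \<Omega>" for K
  proof -
    have [measurable]: "K \<in> sets borel" using K by (simp add: borel_compact)
    have "set_integrable lborel K (\<lambda>x. \<bar>F 0\<bar>)"
      using integrable_indicator_compact[OF K(1)] by (simp add: set_integrable_def)
    then have "integrable lborel (\<lambda>x. indicator K x * \<bar>F 0\<bar> + M * \<bar>indicator K x * u x\<bar>)"
      using wderD(3)[OF w K] by (simp add: set_integrable_def)
    then show ?thesis unfolding set_integrable_def
      by (rule Bochner_Integration.integrable_bound)
        (use F0 M0 in \<open>auto simp: indicator_def intro: order_trans[OF _ abs_ge_self]\<close>)
  qed
  have int2: "set_integrable lborel K (\<lambda>x. F' (u x) * g x)" if K: "compact K" "K \<subseteq> \<Omega>" for K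
  proof -
    have [measurable]: "K \<in> sets borel" using K by (simp add: borel_compact)
    have "integrable lborel (\<lambda>x. M * (indicator K x * g x))"
      using wderD(4)[OF w K] by (simp add: set_integrable_def)
    then show ?thesis unfolding set_integrable_def
      by (rule Bochner_Integration.integrable_bound)
        (use F'b M0 in \<open>auto simp: indicator_def abs_mult intro!: mult_right_mono\<close>)
  qed
  have "(\<integral>x. F (u x) * partial i \<zeta> x \<partial>lborel) = - (\<integral>x. (F' (u x) * g x) * \<zeta> x \<partial>lborel)" if \<zeta>: "test_fun \<Omega> \<zeta>" for \<zeta>
  proof -
    obtain S R where S: "compact S" "S \<subseteq> \<Omega>" and zS: "\<And>x. x \<notin> S \<Longrightarrow> \<zeta> x = 0" "\<And>i x. x \<notin> S \<Longrightarrow> partial i \<zeta> x = 0"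
      and sm: "smooth \<zeta>" and k: "kern 0 R \<zeta>" "kern 0 R (partial i \<zeta>)" using test_fun_kern[OF \<zeta>] by metis
    note [measurable] = kernD(3)[OF k(1)] kernD(3)[OF k(2)]
    obtain B1 where B1: "B1 > 0" "\<And>x. \<bar>\<zeta> x\<bar> \<le> B1" using kern_bounded[OF k(1)] by metis
    obtain B2 where B2: "B2 > 0" "\<And>x. \<bar>partial i \<zeta> x\<bar> \<le> B2" using kern_bounded[OF k(2)] by metis
    obtain r where r: "r > 0" "fatten S r \<subseteq> \<Omega>" using fatten_open_obtain[OF S(1) \<Omega> S(2)] by blast
    \<comment> \<open>\<zeta> lives on S, but averages at points of S read u and g on a
      neighbourhood; K is a compact one inside \<Omega> that serves all scales up to r.\<close>
    define K where "K = fatten S r"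
    have K: "compact K" "K \<subseteq> \<Omega>" using r compact_fatten[OF S(1)] by (auto simp: K_def)
    have [measurable]: "K \<in> sets borel" "S \<in> sets borel" using K S by (auto simp: borel_compact)
    obtain \<phi> :: "'n fn" where bump: "bump 0 1 \<phi>" using bump_exists[of 1 0] by auto
    then have \<phi>: "smooth \<phi>" "kern 0 1 \<phi>" "\<And>z. \<phi> z \<ge> 0" "integral\<^sup>L lborel \<phi> = 1"
      using Ck_continuous[of 0 \<phi>] unfolding bump_def kern_def smooth_def by auto
    note [measurable] = kernD(3)[OF \<phi>(2)]
    obtain B0 where B0: "\<And>z. \<bar>\<phi> z\<bar> \<le> B0" using kern_bounded[OF \<phi>(2)] by metis
    define u1 where "u1 y = indicator K y * u y" for y
    define g1 where "g1 y = indicator K y * g y" for y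
    have u1: "integrable lborel u1" "integrable lborel g1"
      using wderD(3,4)[OF w K] by (simp_all add: set_integrable_def u1_def[abs_def] g1_def[abs_def])
    note [measurable] = borel_measurable_integrable[OF u1(1)] borel_measurable_integrable[OF u1(2)]
    have SK: "x \<in> K" if "x \<in> S" for x using fattenI[OF that, of 0 r] r by (simp add: K_def)
    have imK: "(\<lambda>z. x + t *\<^sub>R z) ` cball 0 1 \<subseteq> K" if "x \<in> S" "0 < t" "t \<le> r" for x t
    proof
      fix y assume "y \<in> (\<lambda>z. x + t *\<^sub>R z) ` cball 0 1"
      then show "y \<in> K"
      proof (rule imageE)
        fix z assume z: "y = x + t *\<^sub>R z" "z \<in> cball 0 1"
        have "t * norm z \<le> r * 1" using z that by (intro mult_mono) auto
        then show "y \<in> K" unfolding z K_def using that by (intro fattenI) auto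
      qed
    qed
    have ibp: "(\<integral>x. F (moll \<phi> t u1 x) * partial i \<zeta> x \<partial>lborel) + (\<integral>x. (F' (moll \<phi> t u1 x) * moll \<phi> t g1 x) * \<zeta> x \<partial>lborel) = 0"
      if t: "0 < t" "t \<le> r" for t
    proof -
      let ?v = "moll \<phi> t u1" and ?w = "moll \<phi> t g1"
      have eqv: "moll \<phi> t u x = ?v x" "moll \<phi> t g x = ?w x" if "x \<in> S" for x
        using moll_cong_indicator(2)[OF \<phi>(2) imK[OF that t]] by (simp_all add: u1_def[abs_def] g1_def[abs_def])
      define A where "A = B0 / t ^ CARD('n) * (\<integral>y. \<bar>u1 y\<bar> \<partial>lborel)"
      define A' where "A' = B0 / t ^ CARD('n) * (\<integral>y. \<bar>g1 y\<bar> \<partial>lborel)"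
      have A: "\<bar>?v x\<bar> \<le> A" "\<bar>?w x\<bar> \<le> A'" for x
        unfolding A_def A'_def
        using moll_bound[OF u1(1) \<phi>(2) B0 t(1)] moll_bound[OF u1(2) \<phi>(2) B0 t(1)] by auto
      have A0: "A \<ge> 0" "A' \<ge> 0" using A[of 0] by linarith+
      define Z where "Z = (\<bar>F 0\<bar> + M * A) * B2"
      define Z' where "Z' = M * A' * B1"
      have b1: "\<bar>F (?v x) * partial i \<zeta> x\<bar> \<le> Z" for x
        unfolding Z_def abs_mult using A0 M0 A[of x] B2
        by (intro mult_mono order_trans[OF F0]) (auto intro: mult_left_mono)
      have b2: "\<bar>(F' (?v x) * ?w x) * \<zeta> x\<bar> \<le> Z'" for x
        unfolding Z'_def abs_mult using A0 M0 A[of x] B1 F'b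
        by (intro mult_mono) auto
      \<comment> \<open>G uses the average of u itself, to which \<open>moll_dx\<close> applies.
        \<open>G1\<close> and \<open>G2\<close> use the cut-off functions, whose averages are
        bounded on the whole space and agree with those of u and g on S.\<close>
      define G where "G x = F (moll \<phi> t u x) * \<zeta> x" for x
      define G1 where "G1 x = F (?v x) * partial i \<zeta> x" for x
      define G2 where "G2 x = (F' (?v x) * ?w x) * \<zeta> x" for x
      have [measurable]: "G1 \<in> borel_measurable borel" "G2 \<in> borel_measurable borel" "G \<in> borel_measurable borel"
        by (simp_all add: G_def[abs_def] G1_def[abs_def] G2_def[abs_def])
      have "(\<integral>x. G1 x + G2 x \<partial>lborel) = 0"
      proof (rule integral_directional_derivative_eq_0[OF S(1), where G=G and e="axis i 1" and B="Z + Z' + (\<bar>F 0\<bar> + M * A) * B1"])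
        show "G x = 0" "G1 x + G2 x = 0" if "x \<notin> S" for x using zS[OF that] by (simp_all add: G_def G1_def G2_def)
        show "((\<lambda>s. G (x + s *\<^sub>R axis i 1)) has_real_derivative G1 x + G2 x) (at 0)" for x
        proof (cases "x \<in> S")
          case True
          have "((\<lambda>s. moll \<phi> t u (x + s *\<^sub>R axis i 1)) has_real_derivative moll \<phi> t g x) (at 0)"
            using imK[OF True t] K by (intro moll_dx[OF w \<Omega> \<phi>(1,2) t(1)]) auto
          then have 1: "((\<lambda>s. F (moll \<phi> t u (x + s *\<^sub>R axis i 1))) has_real_derivative F' (moll \<phi> t u x) * moll \<phi> t g x) (at 0)"
            using DERIV_chain2[of F "F' (moll \<phi> t u (x + 0 *\<^sub>R axis i 1))" "\<lambda>s. moll \<phi> t u (x + s *\<^sub>R axis i 1)" 0 _ UNIV] F by simp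
          have "((\<lambda>s. x + s *\<^sub>R axis i 1) has_vector_derivative axis i 1) (at 0)"
            by (auto intro!: derivative_eq_intros)
          from smooth_line_derivative[OF sm this]
          have 2: "((\<lambda>s. \<zeta> (x + s *\<^sub>R axis i 1)) has_real_derivative partial i \<zeta> x) (at 0)"
            by (simp add: axis_def if_distrib if_distribR cong: if_cong)
          from DERIV_mult[OF 1 2] show ?thesis
            unfolding G_def G1_def G2_def eqv[OF True, symmetric] by (elim DERIV_cong) (simp add: algebra_simps)
        next
          case False
          have "eventually (\<lambda>s. x + s *\<^sub>R axis i 1 \<in> - S) (nhds (0::real))"
          proof (rule topological_tendstoD)
            have "((\<lambda>s. x + s *\<^sub>R axis i 1) \<longlongrightarrow> x + 0 *\<^sub>R axis i 1) (nhds (0::real))"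
              by (intro tendsto_intros filterlim_ident)
            then show "((\<lambda>s. x + s *\<^sub>R axis i 1) \<longlongrightarrow> x) (nhds (0::real))" by simp
          qed (use S(1) False in \<open>auto simp: compact_imp_closed\<close>)
          then have "eventually (\<lambda>s. G (x + s *\<^sub>R axis i 1) = 0) (nhds 0)"
            by eventually_elim (simp add: G_def zS)
          then have "((\<lambda>s. G (x + s *\<^sub>R axis i 1)) has_real_derivative 0) (at 0)"
            by (subst DERIV_cong_ev[OF refl _ refl]) auto
          then show ?thesis using zS[OF False] by (simp add: G1_def G2_def)
        qed
        show "\<bar>G1 x + G2 x\<bar> \<le> Z + Z' + (\<bar>F 0\<bar> + M * A) * B1" for x
        proof -
          have "0 \<le> (\<bar>F 0\<bar> + M * A) * B1" using A0 M0 B1 by simp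
          then show ?thesis using b1[of x] b2[of x] unfolding G1_def G2_def by linarith
        qed
        show "\<bar>G x\<bar> \<le> Z + Z' + (\<bar>F 0\<bar> + M * A) * B1" for x
        proof (cases "x \<in> S")
          case True
          have "\<bar>G x\<bar> \<le> (\<bar>F 0\<bar> + M * A) * B1" unfolding G_def abs_mult eqv[OF True]
            using A0 M0 A[of x] B1 by (intro mult_mono order_trans[OF F0]) (auto intro: mult_left_mono)
          then show ?thesis using b1[of x] b2[of x] by linarith
        next
          case False
          have "0 \<le> (\<bar>F 0\<bar> + M * A) * B1" using A0 M0 B1 by simp
          then show ?thesis using False zS b1[of x] b2[of x] by (simp add: G_def)
        qed
      qed simp_all
      moreover have "integrable lborel G1" "integrable lborel G2"
      proof -
        have bS: "integrable lborel (\<lambda>x. C * indicator S x :: real)" for C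
          using integrable_indicator_compact[OF S(1)] by simp
        show "integrable lborel G1"
          by (rule Bochner_Integration.integrable_bound[OF bS[of Z]])
            (use b1 zS in \<open>auto simp: G1_def indicator_def intro: order_trans[OF _ abs_ge_self]\<close>)
        show "integrable lborel G2"
          by (rule Bochner_Integration.integrable_bound[OF bS[of Z']])
            (use b2 zS in \<open>auto simp: G2_def indicator_def intro: order_trans[OF _ abs_ge_self]\<close>)
      qed
      ultimately show ?thesis by (simp add: G1_def[abs_def] G2_def[abs_def])
    qed
    define t where "t n = r / real (n + 1)" for n
    have t: "t n > 0" "t n \<le> r" for n using r by (auto simp: t_def field_simps)
    have tl: "t \<longlonglongrightarrow> 0" unfolding t_def by (rule LIMSEQ_Suc[OF lim_const_over_n, unfolded Suc_eq_plus1])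
    have iu: "integrable lborel (moll \<phi> (t n) u1)" "integrable lborel (moll \<phi> (t n) g1)" for n
      by (rule moll_tendsto_L1(1)[OF _ \<phi>(2-4) t(1) tl], rule u1)+
    have lu: "(\<lambda>n. \<integral>x. \<bar>moll \<phi> (t n) u1 x - u1 x\<bar> \<partial>lborel) \<longlonglongrightarrow> 0"
      and lg: "(\<lambda>n. \<integral>x. \<bar>moll \<phi> (t n) g1 x - g1 x\<bar> \<partial>lborel) \<longlonglongrightarrow> 0"
      by (rule moll_tendsto_L1(2)[OF _ \<phi>(2-4) t(1) tl], rule u1)+
    \<comment> \<open>F' is only continuous, so the convergence of F'(v n) has to be pointwise;
      almost everywhere convergence of the averages is available along a subsequence.\<close>
    obtain q :: "nat \<Rightarrow> nat" where q: "strict_mono q" "AE x in lborel. (\<lambda>n. moll \<phi> (t (q n)) u1 x - u1 x) \<longlonglongrightarrow> 0"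
      using tendsto_L1_AE_subseq[of lborel "\<lambda>n x. moll \<phi> (t n) u1 x - u1 x"] iu u1 lu by auto
    define v where "v n = moll \<phi> (t (q n)) u1" for n
    define ww where "ww n = moll \<phi> (t (q n)) g1" for n
    have iv: "integrable lborel (v n)" "integrable lborel (ww n)" for n using iu by (simp_all add: v_def ww_def)
    note [measurable] = borel_measurable_integrable[OF iv(1)] borel_measurable_integrable[OF iv(2)]
    have lv: "(\<lambda>n. \<integral>x. \<bar>v n x - u1 x\<bar> \<partial>lborel) \<longlonglongrightarrow> 0" "(\<lambda>n. \<integral>x. \<bar>ww n x - g1 x\<bar> \<partial>lborel) \<longlonglongrightarrow> 0"
      using LIMSEQ_subseq_LIMSEQ[OF lu q(1)] LIMSEQ_subseq_LIMSEQ[OF lg q(1)] by (simp_all add: o_def v_def ww_def)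
    have iS: "integrable lborel (\<lambda>x. C * indicator S x :: real)" for C
      using integrable_indicator_compact[OF S(1)] by simp
    have iF: "integrable lborel (\<lambda>x. F (h x) * partial i \<zeta> x)" if h: "integrable lborel h" for h
    proof -
      note [measurable] = borel_measurable_integrable[OF h]
      have "integrable lborel (\<lambda>x. (\<bar>F 0\<bar> * B2) * indicator S x + M * B2 * \<bar>h x\<bar>)" using iS h by auto
      then show ?thesis
      proof (rule Bochner_Integration.integrable_bound)
        show "AE x in lborel. norm (F (h x) * partial i \<zeta> x) \<le> norm ((\<bar>F 0\<bar> * B2) * indicator S x + M * B2 * \<bar>h x\<bar>)"
        proof (intro AE_I2)
          fix x
          show "norm (F (h x) * partial i \<zeta> x) \<le> norm ((\<bar>F 0\<bar> * B2) * indicator S x + M * B2 * \<bar>h x\<bar>)"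
          proof (cases "x \<in> S")
            case True
            have "\<bar>F (h x)\<bar> * \<bar>partial i \<zeta> x\<bar> \<le> (\<bar>F 0\<bar> + M * \<bar>h x\<bar>) * B2"
              using F0[of "h x"] B2 M0 by (intro mult_mono) auto
            then show ?thesis using True B2 M0 by (simp add: abs_mult algebra_simps)
          qed (simp add: zS)
        qed
      qed simp
    qed
    have L1: "(\<lambda>n. \<integral>x. F (v n x) * partial i \<zeta> x \<partial>lborel) \<longlonglongrightarrow> (\<integral>x. F (u1 x) * partial i \<zeta> x \<partial>lborel)"
    proof (rule Lim_transform2[OF tendsto_const], rule Lim_null_comparison)
      show "(\<lambda>n. M * B2 * (\<integral>x. \<bar>v n x - u1 x\<bar> \<partial>lborel)) \<longlonglongrightarrow> 0"
        using tendsto_mult[OF tendsto_const[of "M * B2"] lv(1)] by simp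
      have "\<bar>(\<integral>x. F (u1 x) * partial i \<zeta> x \<partial>lborel) - (\<integral>x. F (v n x) * partial i \<zeta> x \<partial>lborel)\<bar>
          \<le> M * B2 * (\<integral>x. \<bar>v n x - u1 x\<bar> \<partial>lborel)" for n
      proof -
        have "\<bar>(\<integral>x. F (u1 x) * partial i \<zeta> x \<partial>lborel) - (\<integral>x. F (v n x) * partial i \<zeta> x \<partial>lborel)\<bar>
          \<le> (\<integral>x. \<bar>F (u1 x) * partial i \<zeta> x - F (v n x) * partial i \<zeta> x\<bar> \<partial>lborel)"
          using integral_abs_bound[of lborel "\<lambda>x. F (u1 x) * partial i \<zeta> x - F (v n x) * partial i \<zeta> x"] iF[OF u1(1)] iF[OF iv(1)]
          by simp
        also have "\<dots> \<le> (\<integral>x. M * B2 * \<bar>v n x - u1 x\<bar> \<partial>lborel)"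
        proof (rule integral_mono)
          fix x
          have "\<bar>F (u1 x) * partial i \<zeta> x - F (v n x) * partial i \<zeta> x\<bar> = \<bar>F (u1 x) - F (v n x)\<bar> * \<bar>partial i \<zeta> x\<bar>"
            by (simp add: abs_mult[symmetric] left_diff_distrib)
          also have "\<dots> \<le> (M * \<bar>u1 x - v n x\<bar>) * B2" using FL B2 M0 by (intro mult_mono) auto
          finally show "\<bar>F (u1 x) * partial i \<zeta> x - F (v n x) * partial i \<zeta> x\<bar> \<le> M * B2 * \<bar>v n x - u1 x\<bar>"
            by (simp add: abs_minus_commute mult_ac)
        qed (use iF[OF u1(1)] iF[OF iv(1)] iv u1 in auto)
        finally show ?thesis by simp
      qed
      then show "eventually (\<lambda>n. norm ((\<integral>x. F (u1 x) * partial i \<zeta> x \<partial>lborel) - (\<integral>x. F (v n x) * partial i \<zeta> x \<partial>lborel))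
         \<le> M * B2 * (\<integral>x. \<bar>v n x - u1 x\<bar> \<partial>lborel)) sequentially" by (intro always_eventually) simp
    qed
    have iF': "integrable lborel (\<lambda>x. F' (h x) * k x * \<zeta> x)" if h: "h \<in> borel_measurable borel" and k: "integrable lborel k" for h k
    proof -
      note [measurable] = borel_measurable_integrable[OF k] h
      have "integrable lborel (\<lambda>x. M * B1 * k x)" using k by simp
      then show ?thesis
      proof (rule Bochner_Integration.integrable_bound)
        have "\<bar>F' (h x)\<bar> * \<bar>k x\<bar> * \<bar>\<zeta> x\<bar> \<le> M * \<bar>k x\<bar> * B1" for x
          using F'b B1 M0 by (intro mult_mono) auto
        then show "AE x in lborel. norm (F' (h x) * k x * \<zeta> x) \<le> norm (M * B1 * k x)"
          using M0 B1 by (intro AE_I2) (simp add: abs_mult mult_ac)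
      qed simp
    qed
    have D2: "(\<lambda>n. \<integral>x. \<bar>F' (v n x) - F' (u1 x)\<bar> * \<bar>g1 x\<bar> * B1 \<partial>lborel) \<longlonglongrightarrow> (\<integral>x. 0 \<partial>(lborel :: (real^'n) measure))"
    proof (rule integral_dominated_convergence[where w="\<lambda>x. 2 * M * B1 * \<bar>g1 x\<bar>"])
      show "integrable lborel (\<lambda>x. 2 * M * B1 * \<bar>g1 x\<bar>)" using u1 by simp
      show "AE x in lborel. (\<lambda>n. \<bar>F' (v n x) - F' (u1 x)\<bar> * \<bar>g1 x\<bar> * B1) \<longlonglongrightarrow> 0"
        using q(2)
      proof eventually_elim
        case (elim x)
        then have "(\<lambda>n. v n x) \<longlonglongrightarrow> u1 x" unfolding v_def by (simp add: LIM_zero_iff)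
        then have "(\<lambda>n. F' (v n x)) \<longlonglongrightarrow> F' (u1 x)"
          using continuous_on_tendsto_compose[OF F'c] by auto
        then have "(\<lambda>n. \<bar>F' (v n x) - F' (u1 x)\<bar> * \<bar>g1 x\<bar> * B1) \<longlonglongrightarrow> \<bar>F' (u1 x) - F' (u1 x)\<bar> * \<bar>g1 x\<bar> * B1"
          by (intro tendsto_intros)
        then show ?case by simp
      qed
      show "AE x in lborel. norm (\<bar>F' (v n x) - F' (u1 x)\<bar> * \<bar>g1 x\<bar> * B1) \<le> 2 * M * B1 * \<bar>g1 x\<bar>" for n
      proof (intro AE_I2)
        fix x
        have "\<bar>F' (v n x) - F' (u1 x)\<bar> \<le> 2 * M" using F'b[of "v n x"] F'b[of "u1 x"] by linarith
        then have "\<bar>F' (v n x) - F' (u1 x)\<bar> * (\<bar>g1 x\<bar> * B1) \<le> 2 * M * (\<bar>g1 x\<bar> * B1)"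
          using B1 by (intro mult_right_mono) auto
        then show "norm (\<bar>F' (v n x) - F' (u1 x)\<bar> * \<bar>g1 x\<bar> * B1) \<le> 2 * M * B1 * \<bar>g1 x\<bar>"
          using B1 by (simp add: abs_mult mult_ac)
      qed
    qed simp_all
    have L2: "(\<lambda>n. \<integral>x. F' (v n x) * ww n x * \<zeta> x \<partial>lborel) \<longlonglongrightarrow> (\<integral>x. F' (u1 x) * g1 x * \<zeta> x \<partial>lborel)"
    proof (rule Lim_transform2[OF tendsto_const], rule Lim_null_comparison)
      show "(\<lambda>n. M * B1 * (\<integral>x. \<bar>ww n x - g1 x\<bar> \<partial>lborel) + (\<integral>x. \<bar>F' (v n x) - F' (u1 x)\<bar> * \<bar>g1 x\<bar> * B1 \<partial>lborel)) \<longlonglongrightarrow> 0"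
        using tendsto_add[OF tendsto_mult[OF tendsto_const[of "M * B1"] lv(2)] D2] by simp
      have "\<bar>(\<integral>x. F' (u1 x) * g1 x * \<zeta> x \<partial>lborel) - (\<integral>x. F' (v n x) * ww n x * \<zeta> x \<partial>lborel)\<bar>
          \<le> M * B1 * (\<integral>x. \<bar>ww n x - g1 x\<bar> \<partial>lborel) + (\<integral>x. \<bar>F' (v n x) - F' (u1 x)\<bar> * \<bar>g1 x\<bar> * B1 \<partial>lborel)" for n
      proof -
        have i3: "integrable lborel (\<lambda>x. \<bar>F' (v n x) - F' (u1 x)\<bar> * \<bar>g1 x\<bar> * B1)"
        proof (rule Bochner_Integration.integrable_bound[of _ "\<lambda>x. 2 * M * B1 * g1 x"])
          have "\<bar>F' (v n x) - F' (u1 x)\<bar> * (\<bar>g1 x\<bar> * B1) \<le> 2 * M * (\<bar>g1 x\<bar> * B1)" for x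
            using B1 F'b[of "v n x"] F'b[of "u1 x"] by (intro mult_right_mono) auto
          then show "AE x in lborel. norm (\<bar>F' (v n x) - F' (u1 x)\<bar> * \<bar>g1 x\<bar> * B1) \<le> norm (2 * M * B1 * g1 x)"
            using B1 M0 by (intro AE_I2) (simp add: abs_mult mult_ac)
        qed (use u1 in auto)
        have i1: "integrable lborel (\<lambda>x. F' (u1 x) * g1 x * \<zeta> x)" "integrable lborel (\<lambda>x. F' (v n x) * ww n x * \<zeta> x)"
          by (intro iF' u1 iv; simp)+
        have "\<bar>(\<integral>x. F' (u1 x) * g1 x * \<zeta> x \<partial>lborel) - (\<integral>x. F' (v n x) * ww n x * \<zeta> x \<partial>lborel)\<bar>
          \<le> (\<integral>x. \<bar>F' (u1 x) * g1 x * \<zeta> x - F' (v n x) * ww n x * \<zeta> x\<bar> \<partial>lborel)"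
          using integral_abs_bound[of lborel "\<lambda>x. F' (u1 x) * g1 x * \<zeta> x - F' (v n x) * ww n x * \<zeta> x"] i1 by simp
        also have "\<dots> \<le> (\<integral>x. M * B1 * \<bar>ww n x - g1 x\<bar> + \<bar>F' (v n x) - F' (u1 x)\<bar> * \<bar>g1 x\<bar> * B1 \<partial>lborel)"
        proof (rule integral_mono)
          fix x
          \<comment> \<open>The first part is small in L1 because F' is bounded; in the second the
            factor g1 is fixed, and dominated convergence applies.\<close>
          have "F' (u1 x) * g1 x * \<zeta> x - F' (v n x) * ww n x * \<zeta> x
             = F' (v n x) * (g1 x - ww n x) * \<zeta> x + (F' (u1 x) - F' (v n x)) * g1 x * \<zeta> x" by (simp add: algebra_simps)
          also have "\<bar>\<dots>\<bar> \<le> \<bar>F' (v n x)\<bar> * \<bar>g1 x - ww n x\<bar> * \<bar>\<zeta> x\<bar> + \<bar>F' (u1 x) - F' (v n x)\<bar> * \<bar>g1 x\<bar> * \<bar>\<zeta> x\<bar>"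
            by (rule order_trans[OF abs_triangle_ineq]) (simp add: abs_mult)
          also have "\<dots> \<le> M * \<bar>g1 x - ww n x\<bar> * B1 + \<bar>F' (u1 x) - F' (v n x)\<bar> * \<bar>g1 x\<bar> * B1"
            using F'b B1 M0 by (intro add_mono mult_mono) auto
          finally show "\<bar>F' (u1 x) * g1 x * \<zeta> x - F' (v n x) * ww n x * \<zeta> x\<bar> \<le> M * B1 * \<bar>ww n x - g1 x\<bar> + \<bar>F' (v n x) - F' (u1 x)\<bar> * \<bar>g1 x\<bar> * B1"
            by (simp add: abs_minus_commute mult_ac)
        qed (use i1 i3 iv u1 in auto)
        also have "\<dots> = M * B1 * (\<integral>x. \<bar>ww n x - g1 x\<bar> \<partial>lborel) + (\<integral>x. \<bar>F' (v n x) - F' (u1 x)\<bar> * \<bar>g1 x\<bar> * B1 \<partial>lborel)"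
          using i3 iv u1 by (subst Bochner_Integration.integral_add) auto
        finally show ?thesis .
      qed
      then show "eventually (\<lambda>n. norm ((\<integral>x. F' (u1 x) * g1 x * \<zeta> x \<partial>lborel) - (\<integral>x. F' (v n x) * ww n x * \<zeta> x \<partial>lborel))
          \<le> M * B1 * (\<integral>x. \<bar>ww n x - g1 x\<bar> \<partial>lborel) + (\<integral>x. \<bar>F' (v n x) - F' (u1 x)\<bar> * \<bar>g1 x\<bar> * B1 \<partial>lborel)) sequentially"
        by (intro always_eventually) simp
    qed
    have "(\<lambda>n. (\<integral>x. F (v n x) * partial i \<zeta> x \<partial>lborel) + (\<integral>x. F' (v n x) * ww n x * \<zeta> x \<partial>lborel)) \<longlonglongrightarrow>
       (\<integral>x. F (u1 x) * partial i \<zeta> x \<partial>lborel) + (\<integral>x. F' (u1 x) * g1 x * \<zeta> x \<partial>lborel)"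
      by (intro tendsto_add L1 L2)
    moreover have "(\<integral>x. F (v n x) * partial i \<zeta> x \<partial>lborel) + (\<integral>x. F' (v n x) * ww n x * \<zeta> x \<partial>lborel) = 0" for n
      using ibp[OF t(1) t(2), of "q n"] by (simp add: v_def ww_def)
    ultimately have 0: "(\<integral>x. F (u1 x) * partial i \<zeta> x \<partial>lborel) + (\<integral>x. F' (u1 x) * g1 x * \<zeta> x \<partial>lborel) = 0"
      by (simp add: LIMSEQ_const_iff)
    \<comment> \<open>On S the cut-off changes nothing, and off S the test function
      vanishes.\<close>
    have e1: "F (u1 x) * partial i \<zeta> x = F (u x) * partial i \<zeta> x" for x
      using zS(2) SK[of x] by (cases "x \<in> S") (auto simp: u1_def)
    have e2: "F' (u1 x) * g1 x * \<zeta> x = F' (u x) * g x * \<zeta> x" for x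
      using zS(1) SK[of x] by (cases "x \<in> S") (auto simp: u1_def g1_def)
    show ?thesis using 0 unfolding e1 e2 by simp
  qed
  then show ?thesis unfolding wder_def using int1 int2 by simp
qed

section \<open>Cone estimates\<close>

text \<open>Left unnormalised, the powers of the radius being tracked separately. The indicator form
  makes the integrand jointly measurable in x and y, as Tonelli's theorem requires.\<close>

definition ball_int :: "'n::finite fn \<Rightarrow> real \<Rightarrow> 'n fn" where
  "ball_int G r x = (\<integral>y. indicator (ball x r) y * G y \<partial>lborel)"

lemma indicator_ball_measurable[measurable]:
  "(\<lambda>(x, y). indicator (ball x r) y :: real) \<in> borel_measurable (borel \<Otimes>\<^sub>M (borel :: (real^'n::finite) measure))"
proof -
  have "(\<lambda>(x, y). indicator (ball x r) y :: real) = (\<lambda>p. indicator {p. dist (fst p) (snd p) < r} (p :: (real^'n) \<times> (real^'n)))"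
    by (auto simp: fun_eq_iff indicator_def)
  moreover have "{p :: (real^'n) \<times> (real^'n). dist (fst p) (snd p) < r} \<in> sets (borel \<Otimes>\<^sub>M borel)"
    unfolding borel_prod by (intro borel_open open_Collect_less continuous_intros)
  ultimately show ?thesis by simp
qed

lemma ball_int_measurable[measurable]:
  assumes [measurable]: "G \<in> borel_measurable borel"
  shows "ball_int G r \<in> borel_measurable borel"
proof -
  have [measurable]: "(\<lambda>p. indicator (ball (fst p) r) (snd p) :: real) \<in> borel_measurable (borel \<Otimes>\<^sub>M (borel :: (real^'n::finite) measure))"
    using indicator_ball_measurable[of r] by (simp add: case_prod_beta)
  have "(\<lambda>(x,y). indicator (ball x r) y * G y) \<in> borel_measurable (borel \<Otimes>\<^sub>M lborel)"
    unfolding case_prod_beta by measurable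
  from lborel.borel_measurable_lebesgue_integral[OF this] show ?thesis unfolding ball_int_def[abs_def] .
qed

lemma ball_int_integrable:
  fixes G :: "'n::finite fn"
  assumes "integrable lborel G" shows "integrable lborel (\<lambda>y. indicator (ball x r) y * G y)"
proof -
  have [measurable]: "G \<in> borel_measurable borel" using assms by auto
  show ?thesis
    by (rule Bochner_Integration.integrable_bound[OF assms]) (auto simp: indicator_def)
qed

lemma ball_int_nonneg: "(\<And>y. G y \<ge> 0) \<Longrightarrow> ball_int G r x \<ge> 0"
  unfolding ball_int_def by (rule integral_nonneg_AE) simp

lemma ball_int_mono:
  assumes "integrable lborel G" "\<And>y. G y \<ge> 0" "r \<le> s"
  shows "ball_int G r x \<le> ball_int G s x"
  unfolding ball_int_def
  by (intro integral_mono ball_int_integrable assms(1)) (use assms(2,3) in \<open>auto simp: indicator_def\<close>)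

lemma ball_int_le:
  assumes "integrable lborel G" "\<And>y. G y \<ge> 0"
  shows "ball_int G r x \<le> (\<integral>y. G y \<partial>lborel)"
  unfolding ball_int_def
  by (intro integral_mono ball_int_integrable assms(1)) (use assms in \<open>auto simp: indicator_def\<close>)

text \<open>y lies in the ball around x exactly when x lies in the ball around y, so Tonelli's
  theorem weights each y with the measure of one ball.\<close>

lemma nn_integral_ball_int:
  fixes G :: "'n::finite fn"
  assumes G: "integrable lborel G" "\<And>y. G y \<ge> 0" and r: "r \<ge> 0"
  shows "(\<integral>\<^sup>+x. ennreal (ball_int G r x) \<partial>lborel) = ennreal (measure lborel (ball (0::real^'n) r) * (\<integral>y. G y \<partial>lborel))"
proof -
  have [measurable]: "G \<in> borel_measurable borel" using G by auto
  have [measurable]: "(\<lambda>p. indicator (ball (fst p) r) (snd p) :: real) \<in> borel_measurable (borel \<Otimes>\<^sub>M (borel :: (real^'n::finite) measure))"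
    using indicator_ball_measurable[of r] by (simp add: case_prod_beta)
  have "(\<integral>\<^sup>+x. ennreal (ball_int G r x) \<partial>lborel) = (\<integral>\<^sup>+x. (\<integral>\<^sup>+y. ennreal (indicator (ball x r) y * G y) \<partial>lborel) \<partial>lborel)"
    unfolding ball_int_def
    by (intro nn_integral_cong nn_integral_eq_integral[symmetric] ball_int_integrable G) (auto simp: G)
  also have "\<dots> = (\<integral>\<^sup>+y. (\<integral>\<^sup>+x. ennreal (indicator (ball x r) y * G y) \<partial>lborel) \<partial>lborel)"
  proof (rule lborel_pair.Fubini'[where f="\<lambda>x y. ennreal (indicator (ball x r) y * G y)", symmetric])
    show "(\<lambda>(x, y). ennreal (indicator (ball x r) y * G y)) \<in> borel_measurable (lborel \<Otimes>\<^sub>M lborel)"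
      unfolding case_prod_beta by measurable
  qed
  also have "\<dots> = (\<integral>\<^sup>+y. ennreal (G y) * ennreal (measure lborel (ball (0::real^'n) r)) \<partial>lborel)"
  proof (rule nn_integral_cong)
    fix y
    have "(\<integral>\<^sup>+x. ennreal (indicator (ball x r) y * G y) \<partial>lborel) = (\<integral>\<^sup>+x. ennreal (G y) * indicator (ball y r) x \<partial>lborel)"
      by (rule nn_integral_cong) (auto simp: indicator_def dist_commute)
    also have "\<dots> = ennreal (G y) * emeasure lborel (ball y r)" by (simp add: nn_integral_cmult_indicator)
    also have "emeasure lborel (ball y r) = ennreal (measure lborel (ball y r))"
      using emeasure_lborel_ball_finite[of y r] by (subst emeasure_eq_ennreal_measure) auto
    also have "measure lborel (ball y r) = measure lborel (ball (0::real^'n) r)"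
      using content_ball_conv_unit_ball[OF r, of y] content_ball_conv_unit_ball[OF r, of "0::real^'n"] by simp
    finally show "(\<integral>\<^sup>+x. ennreal (indicator (ball x r) y * G y) \<partial>lborel) = ennreal (G y) * ennreal (measure lborel (ball (0::real^'n) r))" .
  qed
  also have "\<dots> = ennreal (\<integral>y. G y \<partial>lborel) * ennreal (measure lborel (ball (0::real^'n) r))"
    using G by (simp add: nn_integral_multc nn_integral_eq_integral)
  finally show ?thesis using G by (simp add: ennreal_mult'[symmetric] mult.commute)
qed

lemma moll_bound_ball:
  assumes f: "integrable lborel f" and \<eta>: "kern c d \<eta>" "\<And>z. \<bar>\<eta> z\<bar> \<le> B" and t: "t > 0"
    and R: "cball c d \<subseteq> ball 0 R" and G: "integrable lborel G" "\<And>y. \<bar>f y\<bar> \<le> G y" and B: "B \<ge> 0"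
  shows "\<bar>moll \<eta> t f (x :: real^'n::finite)\<bar> \<le> B / t ^ CARD('n) * ball_int G (R * t) x"
proof -
  have sub: "(\<lambda>z. x + t *\<^sub>R z) ` cball c d \<subseteq> ball x (R * t)"
  proof
    fix y assume "y \<in> (\<lambda>z. x + t *\<^sub>R z) ` cball c d"
    then show "y \<in> ball x (R * t)"
    proof (rule imageE)
      fix z assume z: "y = x + t *\<^sub>R z" "z \<in> cball c d"
      then have "norm z < R" using R by auto
      then show "y \<in> ball x (R * t)" using t z by (simp add: dist_norm mult.commute)
    qed
  qed
  let ?f = "\<lambda>y. indicator (ball x (R * t)) y * f y"
  have "\<bar>moll \<eta> t f x\<bar> \<le> B / t ^ CARD('n) * (\<integral>y. \<bar>?f y\<bar> \<partial>lborel)"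
    by (subst moll_cong_indicator(2)[OF \<eta>(1) sub]) (rule moll_bound[OF ball_int_integrable[OF f] \<eta> t])
  also have "\<dots> \<le> B / t ^ CARD('n) * ball_int G (R * t) x"
    unfolding ball_int_def using t B G(2)
    by (intro mult_left_mono integral_mono integrable_abs ball_int_integrable f G) (auto simp: indicator_def)
  finally show ?thesis .
qed

text \<open>A mean value estimate in the scale. By \<open>moll_dt\<close> the scale derivative is a
  sum of averages of the \<open>g i\<close> with kernels z_i \<phi>, each at most B s^-n times an
  integral of the gradient over a ball. For s between t/2 and t, replacing s by t costs the factor
  2^n.\<close>

lemma dyadic_step:
  fixes f :: "'n::finite fn"
  assumes w: "\<And>i. wder \<Omega> f i (g i)" and \<Omega>: "open \<Omega>" and \<phi>: "smooth \<phi>" "kern c d \<phi>"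
    and B: "\<And>i z. \<bar>z $ i * \<phi> z\<bar> \<le> B" "B \<ge> 0" and R: "cball c d \<subseteq> ball 0 R" and R0: "R \<ge> 0"
    and \<Omega>': "\<Omega>' \<in> sets borel" "\<Omega>' \<subseteq> \<Omega>"
    and cone: "\<And>t. 0 < t \<Longrightarrow> t \<le> T \<Longrightarrow> (\<lambda>z. x + t *\<^sub>R z) ` cball c d \<subseteq> \<Omega>'"
    and gi: "\<And>i. integrable lborel (\<lambda>y. indicator \<Omega>' y * g i y)"
    and G: "G = (\<lambda>y. \<Sum>i\<in>UNIV. \<bar>indicator \<Omega>' y * g i y\<bar>)"
    and t: "0 < t" "t \<le> T"
  shows "\<bar>moll \<phi> (t/2) f x - moll \<phi> t f x\<bar> \<le> real CARD('n) * B * 2 ^ CARD('n) * (t / t ^ CARD('n) * ball_int G (R * t) x)"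
proof -
  let ?n = "CARD('n)"
  let ?D = "\<lambda>s. \<Sum>i\<in>UNIV. moll (\<lambda>z. z $ i * \<phi> z) s (g i) x"
  have Gi: "integrable lborel G" unfolding G by (intro Bochner_Integration.integrable_sum integrable_abs gi)
  have G0: "G y \<ge> 0" for y unfolding G by (intro sum_nonneg) simp
  have gG: "\<bar>indicator \<Omega>' y * g i y\<bar> \<le> G y" for y i unfolding G
    by (rule member_le_sum[of i UNIV "\<lambda>i. \<bar>indicator \<Omega>' y * g i y\<bar>"]) auto
  define Z where "Z = real ?n * (B * 2 ^ ?n / t ^ ?n * ball_int G (R * t) x)"
  have I0: "ball_int G (R * t) x \<ge> 0" by (rule ball_int_nonneg[OF G0])
  have Z0: "Z \<ge> 0" unfolding Z_def using B(2) t I0 by simp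
  have bd: "\<bar>?D s\<bar> \<le> Z" if s: "t/2 \<le> s" "s \<le> t" for s
  proof -
    have s0: "s > 0" "s \<le> T" using s t by auto
    have "\<bar>moll (\<lambda>z. z $ i * \<phi> z) s (g i) x\<bar> \<le> B * 2 ^ ?n / t ^ ?n * ball_int G (R * t) x" for i
    proof -
      have "\<bar>moll (\<lambda>z. z $ i * \<phi> z) s (g i) x\<bar> \<le> B / s ^ ?n * ball_int G (R * s) x"
        by (subst moll_cong_indicator(2)[OF kern_coord_mult[OF \<phi>(2)] cone[OF s0]])
          (rule moll_bound_ball[OF gi kern_coord_mult[OF \<phi>(2)] B(1) s0(1) R Gi gG B(2)])
      also have "\<dots> \<le> B * 2 ^ ?n / t ^ ?n * ball_int G (R * t) x"
      proof (rule mult_mono)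
        have "(t/2) ^ ?n \<le> s ^ ?n" using s t by (intro power_mono) auto
        then have "B / s ^ ?n \<le> B / (t/2) ^ ?n" using t s0 B(2) by (intro divide_left_mono) auto
        then show "B / s ^ ?n \<le> B * 2 ^ ?n / t ^ ?n" by (simp add: power_divide)
        show "ball_int G (R * s) x \<le> ball_int G (R * t) x"
          using s R0 by (intro ball_int_mono Gi G0 mult_left_mono) auto
      qed (use B(2) t in \<open>auto intro: ball_int_nonneg[OF G0]\<close>)
      finally show ?thesis .
    qed
    then have "(\<Sum>i\<in>(UNIV::'n set). \<bar>moll (\<lambda>z. z $ i * \<phi> z) s (g i) x\<bar>) \<le> Z"
      unfolding Z_def by (intro sum_bounded_above) auto
    then show ?thesis using sum_abs[of "\<lambda>i. moll (\<lambda>z. z $ i * \<phi> z) s (g i) x" UNIV] by linarith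
  qed
  have "norm (moll \<phi> (t/2) f x - moll \<phi> t f x) \<le> Z * norm (t/2 - t)"
  proof (rule field_differentiable_bound[of "{t/2..t}" _ ?D])
    fix s assume s: "s \<in> {t/2..t}"
    then have s0: "s > 0" "s \<le> T" using t by auto
    show "((\<lambda>s. moll \<phi> s f x) has_field_derivative ?D s) (at s within {t / 2..t})"
      by (rule has_field_derivative_at_within[OF moll_dt[OF w \<Omega> \<phi> s0(1) order_trans[OF cone[OF s0] \<Omega>'(2)]]])
    show "norm (?D s) \<le> Z" using bd s by auto
  qed (use t in auto)
  also have "\<dots> \<le> Z * t" using Z0 t by (intro mult_left_mono) auto
  finally show ?thesis using t by (simp add: Z_def mult_ac)
qed

text \<open>Telescoping over the scales T / 2^j down to 0, where the averages tend to f almost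
  everywhere along a subsequence. The sum is kept in \<open>ennreal\<close>, so its convergence is
  left to the later estimates.\<close>

lemma cone_estimate:
  fixes f :: "'n::finite fn"
  assumes w: "\<And>i. wder \<Omega> f i (g i)" and \<Omega>: "open \<Omega>" and \<phi>: "bump c d \<phi>"
    and B: "\<And>i z. \<bar>z $ i * \<phi> z\<bar> \<le> B" "B \<ge> 0" and R: "cball c d \<subseteq> ball 0 R" and R0: "R \<ge> 0"
    and \<Omega>': "\<Omega>' \<in> sets borel" "\<Omega>' \<subseteq> \<Omega>" and A: "A \<subseteq> \<Omega>'" and T: "T > 0"
    and cone: "\<And>x t. x \<in> A \<Longrightarrow> 0 < t \<Longrightarrow> t \<le> T \<Longrightarrow> (\<lambda>z. x + t *\<^sub>R z) ` cball c d \<subseteq> \<Omega>'"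
    and fi: "integrable lborel (\<lambda>y. indicator \<Omega>' y * f y)"
    and gi: "\<And>i. integrable lborel (\<lambda>y. indicator \<Omega>' y * g i y)"
    and G: "G = (\<lambda>y. \<Sum>i\<in>UNIV. \<bar>indicator \<Omega>' y * g i y\<bar>)"
    and tj: "\<And>j. tj j = T / 2 ^ j"
    and C: "C = real CARD('n) * B * 2 ^ CARD('n)"
  shows "AE x in lborel. x \<in> A \<longrightarrow> ennreal \<bar>f x - moll \<phi> T f x\<bar> \<le>
     (\<Sum>j. ennreal (C * (tj j / tj j ^ CARD('n) * ball_int G (R * tj j) x)))"
proof -
  have \<phi>': "smooth \<phi>" "kern c d \<phi>" "\<And>z. \<phi> z \<ge> 0" "integral\<^sup>L lborel \<phi> = 1"
    using \<phi> Ck_continuous[of 0 \<phi>] unfolding bump_def kern_def smooth_def by auto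
  have t: "tj j > 0" "tj j \<le> T" for j using T by (auto simp: tj field_simps)
  have tl: "tj \<longlonglongrightarrow> 0"
  proof -
    have "(\<lambda>j. T * (1/2)^j) \<longlonglongrightarrow> T * 0" by (intro tendsto_mult tendsto_const LIMSEQ_power_zero) simp
    moreover have "tj = (\<lambda>j. T * (1/2)^j)" by (auto simp: tj power_divide)
    ultimately show ?thesis by simp
  qed
  let ?f = "\<lambda>y. indicator \<Omega>' y * f y"
  have L: "(\<lambda>n. \<integral>x. norm (moll \<phi> (tj n) ?f x - ?f x) \<partial>lborel) \<longlonglongrightarrow> 0"
    using moll_tendsto_L1(2)[OF fi \<phi>'(2-4) t(1) tl] by simp
  obtain q :: "nat \<Rightarrow> nat" where q: "strict_mono q" "AE x in lborel. (\<lambda>n. moll \<phi> (tj (q n)) ?f x - ?f x) \<longlonglongrightarrow> 0"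
    using tendsto_L1_AE_subseq[OF _ L] moll_tendsto_L1(1)[OF fi \<phi>'(2-4) t(1) tl] fi by auto
  from q(2) show ?thesis
  proof eventually_elim
    case (elim x)
    show ?case
    proof
      assume x: "x \<in> A"
      let ?a = "\<lambda>j. C * (tj j / tj j ^ CARD('n) * ball_int G (R * tj j) x)"
      let ?S = "\<Sum>j. ennreal (?a j)"
      have G0: "G y \<ge> 0" for y unfolding G by (intro sum_nonneg) simp
      have a0: "?a j \<ge> 0" for j
        using B(2) t[of j] ball_int_nonneg[of G "R * tj j" x, OF G0] by (simp add: C)
      have eqf: "moll \<phi> (tj j) f x = moll \<phi> (tj j) ?f x" for j
        by (rule moll_cong_indicator(2)[OF \<phi>'(2) cone[OF x t]])
      have step: "\<bar>moll \<phi> (tj (Suc j)) f x - moll \<phi> (tj j) f x\<bar> \<le> ?a j" for j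
      proof -
        have "tj (Suc j) = tj j / 2" by (simp add: tj)
        then show ?thesis
          using dyadic_step[OF w \<Omega> \<phi>'(1,2) B R R0 \<Omega>' cone[OF x] gi G t[of j]] by (simp only: C)
      qed
      have part: "\<bar>moll \<phi> (tj n) f x - moll \<phi> (tj 0) f x\<bar> \<le> (\<Sum>j<n. ?a j)" for n
      proof (induction n)
        case (Suc n)
        then show ?case using step[of n] by simp
      qed simp
      have "ennreal \<bar>moll \<phi> (tj n) f x - moll \<phi> (tj 0) f x\<bar> \<le> ?S" for n
      proof -
        have "ennreal \<bar>moll \<phi> (tj n) f x - moll \<phi> (tj 0) f x\<bar> \<le> ennreal (\<Sum>j<n. ?a j)"
          using part[of n] by (rule ennreal_leI)
        also have "\<dots> = (\<Sum>j<n. ennreal (?a j))" using a0 by (simp add: sum_ennreal)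
        also have "\<dots> \<le> ?S" by (rule sum_le_suminf) auto
        finally show ?thesis .
      qed
      moreover have "tj 0 = T" by (simp add: tj)
      ultimately have b: "\<forall>n\<ge>0. ennreal \<bar>moll \<phi> (tj (q n)) ?f x - moll \<phi> T f x\<bar> \<le> ?S"
        using eqf by (simp only:) simp
      have "(\<lambda>n. moll \<phi> (tj (q n)) ?f x) \<longlonglongrightarrow> ?f x" using elim by (simp add: LIM_zero_iff)
      moreover have "?f x = f x" using x A by auto
      ultimately have "(\<lambda>n. moll \<phi> (tj (q n)) ?f x) \<longlonglongrightarrow> f x" by (simp only:)
      then have "(\<lambda>n. ennreal \<bar>moll \<phi> (tj (q n)) ?f x - moll \<phi> T f x\<bar>) \<longlonglongrightarrow> ennreal \<bar>f x - moll \<phi> T f x\<bar>"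
        by (intro tendsto_intros)
      from Lim_bounded[OF this] b show "ennreal \<bar>f x - moll \<phi> T f x\<bar> \<le> ?S" by blast
    qed
  qed
qed

text \<open>Some term satisfies \<open>a j \<ge> h \<rho>\<^sup>j (1 - \<rho>)\<close>; this replaces Minkowski's inequality for the dyadic sum.\<close>

lemma suminf_powr_bound:
  fixes a :: "nat \<Rightarrow> real"
  assumes h: "h \<ge> 0" and a: "\<And>j. a j \<ge> 0" and le: "ennreal h \<le> (\<Sum>j. ennreal (a j))"
    and \<rho>: "0 < \<rho>" "\<rho> < 1" and q: "q > 0"
  shows "ennreal (h powr q) \<le> (\<Sum>j. ennreal ((a j / (\<rho> ^ j * (1 - \<rho>))) powr q))"
proof -
  have "\<exists>j. h \<le> a j / (\<rho> ^ j * (1 - \<rho>))"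
  proof (rule ccontr)
    assume "\<nexists>j. h \<le> a j / (\<rho> ^ j * (1 - \<rho>))"
    then have lt: "a j < h * (1 - \<rho>) * \<rho> ^ j" for j
      using \<rho> by (simp add: not_le divide_less_eq mult_ac)
    have s: "summable (\<lambda>j. h * (1 - \<rho>) * \<rho> ^ j)" using \<rho> by (intro summable_mult summable_geometric) auto
    have sa: "summable a" by (rule summable_comparison_test'[OF s, of 0]) (use lt a in \<open>auto simp: less_imp_le\<close>)
    have "0 < (\<Sum>j. h * (1 - \<rho>) * \<rho> ^ j - a j)" using lt by (intro suminf_pos summable_diff s sa) auto
    also have "\<dots> = (\<Sum>j. h * (1 - \<rho>) * \<rho> ^ j) - (\<Sum>j. a j)" by (rule suminf_diff[OF s sa, symmetric])
    also have "(\<Sum>j. h * (1 - \<rho>) * \<rho> ^ j) = h" using \<rho> by (simp add: suminf_mult suminf_geometric summable_geometric)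
    finally have "(\<Sum>j. a j) < h" by simp
    moreover have "(\<Sum>j. ennreal (a j)) = ennreal (\<Sum>j. a j)" by (rule suminf_ennreal2[OF a sa])
    ultimately show False using le h a sa by (simp add: suminf_nonneg)
  qed
  then obtain j where j: "h \<le> a j / (\<rho> ^ j * (1 - \<rho>))" by blast
  have "ennreal (h powr q) \<le> ennreal ((a j / (\<rho> ^ j * (1 - \<rho>))) powr q)"
    using j h q by (intro ennreal_leI powr_mono2) auto
  also have "\<dots> = (\<Sum>i\<in>{j}. ennreal ((a i / (\<rho> ^ i * (1 - \<rho>))) powr q))" by simp
  also have "\<dots> \<le> (\<Sum>j. ennreal ((a j / (\<rho> ^ j * (1 - \<rho>))) powr q))" by (rule sum_le_suminf) auto
  finally show ?thesis .
qed

section \<open>Power bounds for integrals over balls\<close>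

lemma measure_ball_eq:
  "r \<ge> 0 \<Longrightarrow> measure lborel (ball (x::real^'n::finite) r) = r ^ CARD('n) * measure lborel (ball (0::real^'n) 1)"
  using content_ball_conv_unit_ball[of r x] by simp

text \<open>Pointwise G is at most l + l^(1-b) G^b for every level l > 0. Integrating over the ball
  and choosing l well yields Jensen's inequality up to the factor 2^b.\<close>

lemma ball_int_jensen:
  fixes G :: "'n::finite fn"
  assumes G: "integrable lborel G" "\<And>y. G y \<ge> 0" and Gb: "integrable lborel (\<lambda>y. G y powr b)"
    and b: "b \<ge> 1" and r: "r > 0"
  shows "ball_int G r x powr b \<le> 2 powr b * measure lborel (ball (0::real^'n) r) powr (b - 1) * ball_int (\<lambda>y. G y powr b) r x"
proof -
  define V where "V = measure lborel (ball (0::real^'n) r)"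
  define I where "I = ball_int G r x"
  define J where "J = ball_int (\<lambda>y. G y powr b) r x"
  have V: "V > 0" using r unfolding V_def by simp
  have I0: "I \<ge> 0" unfolding I_def by (rule ball_int_nonneg[OF G(2)])
  have J0: "J \<ge> 0" unfolding J_def by (rule ball_int_nonneg) simp
  have Vx: "measure lborel (ball x r) = V" unfolding V_def using r measure_ball_eq[of r x] measure_ball_eq[of r "0::real^'n"] by simp
  have main: "I \<le> l * V + l powr (1 - b) * J" if l: "l > 0" for l
  proof -
    have pt: "G y \<le> l + l powr (1 - b) * G y powr b" for y
    proof (cases "G y \<le> l")
      case False
      have "G y = G y powr (1 - b) * G y powr b" using False l by (simp add: powr_add[symmetric])
      also have "\<dots> \<le> l powr (1 - b) * G y powr b"
        using False l b by (intro mult_right_mono powr_mono2') auto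
      finally show ?thesis using l by simp
    qed (use l in \<open>auto intro: order_trans\<close>)
    have ib: "integrable lborel (indicator (ball x r) :: _ \<Rightarrow> real)"
      using emeasure_lborel_ball_finite[of x r] by (intro integrable_real_indicator) auto
    have "I \<le> (\<integral>y. l * indicator (ball x r) y + l powr (1 - b) * (indicator (ball x r) y * G y powr b) \<partial>lborel)"
      unfolding I_def ball_int_def
    proof (rule integral_mono)
      fix y show "indicator (ball x r) y * G y \<le> l * indicator (ball x r) y + l powr (1 - b) * (indicator (ball x r) y * G y powr b)"
        using pt[of y] by (auto simp: indicator_def)
    qed (use ball_int_integrable[OF G(1)] ball_int_integrable[OF Gb] ib in auto)
    also have "\<dots> = l * V + l powr (1 - b) * J"
      using ball_int_integrable[OF Gb, of x r] ib Vx by (simp add: J_def ball_int_def)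
    finally show ?thesis .
  qed
  have "I powr b \<le> 2 powr b * V powr (b - 1) * J"
  \<comment> \<open>For J = 0 no level balances the two terms; the bound I <= l V holds for all l
    and l tends to 0.\<close>
  proof (cases "J = 0")
    case True
    have "I \<le> 0"
    proof (rule field_le_epsilon)
      fix e :: real assume "e > 0"
      then show "I \<le> 0 + e" using main[of "e / V"] V True by simp
    qed
    then show ?thesis using I0 True by simp
  next
    case False
    then have J: "J > 0" using J0 by simp
    \<comment> \<open>This level makes the two terms of \<open>main\<close> equal.\<close>
    define l where "l = (J / V) powr (1 / b)"
    have l: "l > 0" using J V by (simp add: l_def)
    have e1: "l * V = J powr (1/b) * V powr (1 - 1/b)"
      using J V by (simp add: l_def powr_divide powr_diff)
    have "l powr (1 - b) * J = (J / V) powr (1/b - 1) * J"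
      using b by (simp add: l_def powr_powr field_simps)
    also have "\<dots> = J powr (1/b) * V powr (1 - 1/b)"
      using J V by (simp add: powr_divide powr_diff)
    finally have e2: "l powr (1 - b) * J = J powr (1/b) * V powr (1 - 1/b)" .
    have "I \<le> 2 * (J powr (1/b) * V powr (1 - 1/b))" using main[OF l] e1 e2 by simp
    then have "I powr b \<le> (2 * (J powr (1/b) * V powr (1 - 1/b))) powr b"
      using I0 b by (intro powr_mono2) auto
    also have "\<dots> = 2 powr b * V powr (b - 1) * J"
      using J V b by (simp add: powr_mult powr_powr left_diff_distrib)
    finally show ?thesis .
  qed
  then show ?thesis by (simp add: I_def J_def V_def)
qed

text \<open>A substitute for Young's convolution inequality. After Jensen the integrand is a power
  q/b of \<open>?J\<close>; the surplus q/b - 1 over the first power is bounded by means of N, and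
  the integral of \<open>?J\<close> itself is known from Tonelli's theorem. The power of the volume
  produced here fixes the admissible q in \<open>estimate_Lq\<close>.\<close>

lemma nn_integral_ball_int_powr:
  fixes G :: "'n::finite fn"
  assumes G: "integrable lborel G" "\<And>y. G y \<ge> 0" and Gb: "integrable lborel (\<lambda>y. G y powr b)"
    and b: "b \<ge> 1" and r: "r > 0" and q: "q \<ge> b" and N: "N > 0" "(\<integral>y. G y powr b \<partial>lborel) \<le> N"
  shows "(\<integral>\<^sup>+x. ennreal (ball_int G r x powr q) \<partial>lborel)
     \<le> ennreal (2 powr q * measure lborel (ball (0::real^'n) r) powr ((b - 1) * q / b + 1) * N powr (q / b))"
proof -
  define V where "V = measure lborel (ball (0::real^'n) r)"
  let ?J = "ball_int (\<lambda>y. G y powr b) r"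
  have V: "V > 0" using r unfolding V_def by simp
  have [measurable]: "G \<in> borel_measurable borel" using G by auto
  have J0: "?J x \<ge> 0" for x by (rule ball_int_nonneg) simp
  have JN: "?J x \<le> N" for x using ball_int_le[OF Gb, of r x] N by simp
  have pt: "ball_int G r x powr q \<le> 2 powr q * V powr ((b - 1) * q / b) * N powr (q/b - 1) * ?J x" for x
  proof -
    have "ball_int G r x powr q = (ball_int G r x powr b) powr (q / b)"
      using b by (simp add: powr_powr)
    also have "\<dots> \<le> (2 powr b * V powr (b - 1) * ?J x) powr (q / b)"
      using ball_int_jensen[OF G Gb b r] q b by (intro powr_mono2) (auto simp: V_def)
    also have "\<dots> = 2 powr q * V powr ((b - 1) * q / b) * ?J x powr (q / b)"
      using V b J0 by (simp add: powr_mult powr_powr)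
    also have "?J x powr (q / b) \<le> N powr (q/b - 1) * ?J x"
    proof (cases "?J x = 0")
      case False
      then have "?J x powr (q / b) = ?J x powr (q/b - 1) * ?J x"
        using J0[of x] by (simp add: powr_diff)
      also have "\<dots> \<le> N powr (q/b - 1) * ?J x"
        using JN J0 q b by (intro mult_right_mono powr_mono2) auto
      finally show ?thesis .
    qed simp
    finally show ?thesis by (simp add: mult_left_mono mult.assoc)
  qed
  have "(\<integral>\<^sup>+x. ennreal (ball_int G r x powr q) \<partial>lborel) \<le> (\<integral>\<^sup>+x. ennreal (2 powr q * V powr ((b - 1) * q / b) * N powr (q/b - 1)) * ennreal (?J x) \<partial>lborel)"
    using pt by (intro nn_integral_mono) (simp add: ennreal_mult'[symmetric] ennreal_leI)
  also have "\<dots> = ennreal (2 powr q * V powr ((b - 1) * q / b) * N powr (q/b - 1)) * ennreal (V * (\<integral>y. G y powr b \<partial>lborel))"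
    using nn_integral_ball_int[OF Gb _ less_imp_le[OF r]] by (simp add: nn_integral_cmult V_def)
  also have "\<dots> = ennreal (2 powr q * V powr ((b - 1) * q / b) * N powr (q/b - 1) * (V * (\<integral>y. G y powr b \<partial>lborel)))"
    using V by (intro ennreal_mult'[symmetric]) (simp add: integral_nonneg_AE)
  also have "\<dots> \<le> ennreal (2 powr q * V powr ((b - 1) * q / b) * N powr (q/b - 1) * (V * N))"
    using V N by (intro ennreal_leI mult_left_mono) auto
  also have "2 powr q * V powr ((b - 1) * q / b) * N powr (q/b - 1) * (V * N) = 2 powr q * V powr ((b - 1) * q / b + 1) * N powr (q / b)"
    using V N by (simp add: powr_add powr_diff)
  finally show ?thesis by (simp add: V_def)
qed

text \<open>Truncated cones of height T with vertex in A stay in \<Omega>'. Weak derivatives are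
  given on \<Omega>, integrability is assumed on the smaller set \<Omega>', and the conclusions hold
  on A. Near a point of the closure, \<Omega>' and A are the traces of a larger and a smaller ball;
  for interior compactness, \<Omega>' is \<Omega> and A is a compact subset.\<close>

locale cone_domain =
  fixes \<Omega> \<Omega>' A :: "(real^'n::finite) set" and c :: "real^'n" and d :: real and \<phi> :: "'n fn" and T :: real
  assumes open_\<Omega>: "open \<Omega>" and bump: "bump c d \<phi>"
    and \<Omega>'_borel: "\<Omega>' \<in> sets borel" and \<Omega>'_sub: "\<Omega>' \<subseteq> \<Omega>" and A_sub: "A \<subseteq> \<Omega>'" and A_borel: "A \<in> sets borel"
    and T_pos: "T > 0"
    and cone: "\<And>x t. x \<in> A \<Longrightarrow> 0 < t \<Longrightarrow> t \<le> T \<Longrightarrow> (\<lambda>z. x + t *\<^sub>R z) ` cball c d \<subseteq> \<Omega>'"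
begin

lemma bumpD: "smooth \<phi>" "kern c d \<phi>" "\<phi> z \<ge> 0" "integral\<^sup>L lborel \<phi> = 1"
  using bump Ck_continuous[of 0 \<phi>] unfolding bump_def kern_def smooth_def by auto

text \<open>\<open>R\<close>, \<open>B\<close> and \<open>C\<close> depend on the kernel and its
  ball but not on T: the compactness argument chooses T after the constant of its averaging error is
  fixed.\<close>

definition R :: real where "R = norm c + \<bar>d\<bar> + 1"
definition B :: real where "B = (SOME B. B \<ge> 0 \<and> (\<forall>i z. \<bar>z $ i * \<phi> z\<bar> \<le> B))"
definition C :: real where "C = real CARD('n) * B * 2 ^ CARD('n)"
definition tj :: "nat \<Rightarrow> real" where "tj j = T / 2 ^ j"

lemma R_pos: "R > 0" and R_sub: "cball c d \<subseteq> ball 0 R"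
proof -
  show "R > 0" unfolding R_def by (smt (verit) norm_ge_zero)
  show "cball c d \<subseteq> ball 0 R"
  proof
    fix z assume "z \<in> cball c d"
    then have "norm (z - c) \<le> d" by (simp add: dist_norm norm_minus_commute)
    moreover have "norm z \<le> norm c + norm (z - c)" by (metis add.commute diff_add_cancel norm_triangle_ineq)
    ultimately show "z \<in> ball 0 R" by (simp add: R_def)
  qed
qed

lemma B_bound: "B \<ge> 0" "\<bar>z $ i * \<phi> z\<bar> \<le> B"
proof -
  have "\<forall>i. \<exists>b. \<forall>z. \<bar>z $ i * \<phi> z\<bar> \<le> b" using kern_bounded[OF kern_coord_mult[OF bumpD(2)]] by metis
  then obtain b where b: "\<And>i z. \<bar>z $ i * \<phi> z\<bar> \<le> b i" by metis
  have b0: "b i \<ge> 0" for i using b[of 0 i] by simp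
  have "\<bar>z $ i * \<phi> z\<bar> \<le> (\<Sum>i\<in>UNIV. b i)" for i z
    using b[of z i] member_le_sum[of i UNIV b] b0 by force
  then have "\<exists>B. B \<ge> 0 \<and> (\<forall>i z. \<bar>z $ i * \<phi> z\<bar> \<le> B)"
    by (intro exI[of _ "\<Sum>i\<in>UNIV. b i"]) (auto intro: sum_nonneg b0)
  from someI_ex[OF this] show "B \<ge> 0" "\<bar>z $ i * \<phi> z\<bar> \<le> B" unfolding B_def[symmetric] by auto
qed

lemma C_nonneg: "C \<ge> 0" unfolding C_def using B_bound(1) by simp

definition grad_norm :: "('n \<Rightarrow> 'n fn) \<Rightarrow> 'n fn" where
  "grad_norm g y = (\<Sum>i\<in>UNIV. \<bar>indicator \<Omega>' y * g i y\<bar>)"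

lemma grad_norm_nonneg: "grad_norm g y \<ge> 0"
  unfolding grad_norm_def by (intro sum_nonneg) simp

lemma grad_norm_integrable:
  "(\<And>i. integrable lborel (\<lambda>y. indicator \<Omega>' y * g i y)) \<Longrightarrow> integrable lborel (grad_norm g)"
  unfolding grad_norm_def[abs_def] by (intro Bochner_Integration.integrable_sum integrable_abs)

lemma estimate_AE:
  assumes "\<And>i. wder \<Omega> f i (g i)" "integrable lborel (\<lambda>y. indicator \<Omega>' y * f y)"
    "\<And>i. integrable lborel (\<lambda>y. indicator \<Omega>' y * g i y)"
  shows "AE x in lborel. x \<in> A \<longrightarrow> ennreal \<bar>f x - moll \<phi> T f x\<bar> \<le>
     (\<Sum>j. ennreal (C * (tj j / tj j ^ CARD('n) * ball_int (grad_norm g) (R * tj j) x)))"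
  by (rule cone_estimate[OF assms(1) open_\<Omega> bump B_bound(2,1) R_sub less_imp_le[OF R_pos] \<Omega>'_borel \<Omega>'_sub A_sub T_pos cone assms(2,3)])
    (simp_all add: grad_norm_def[abs_def] tj_def C_def)

lemma tj_pos: "tj j > 0" using T_pos by (simp add: tj_def)

text \<open>At scale t the weight t^(1-n) meets a ball of volume proportional to t^n, so each term
  is of order t and the dyadic sum of order T. The averaging error is thus small uniformly over
  gradients bounded in L1, which is the input for compactness.\<close>

lemma estimate_L1:
  assumes w: "\<And>i. wder \<Omega> f i (g i)" and fi: "integrable lborel (\<lambda>y. indicator \<Omega>' y * f y)"
    and gi: "\<And>i. integrable lborel (\<lambda>y. indicator \<Omega>' y * g i y)"
  shows "(\<integral>\<^sup>+x. indicator A x * ennreal \<bar>f x - moll \<phi> T f x\<bar> \<partial>lborel) \<le>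
     ennreal (2 * C * R ^ CARD('n) * measure lborel (ball (0::real^'n) 1) * T * (\<integral>y. grad_norm g y \<partial>lborel))"
proof -
  let ?V = "measure lborel (ball (0::real^'n) 1)"
  note Gi = grad_norm_integrable[OF gi]
  note [measurable] = borel_measurable_integrable[OF Gi, unfolded measurable_lborel1] A_borel
  define K where "K = C * R ^ CARD('n) * ?V * T * (\<integral>y. grad_norm g y \<partial>lborel)"
  have K0: "K \<ge> 0" unfolding K_def using C_nonneg R_pos T_pos grad_norm_nonneg[of g] by (simp add: integral_nonneg_AE)
  have "(\<integral>\<^sup>+x. indicator A x * ennreal \<bar>f x - moll \<phi> T f x\<bar> \<partial>lborel) \<le>
     (\<integral>\<^sup>+x. (\<Sum>j. ennreal (C * (tj j / tj j ^ CARD('n) * ball_int (grad_norm g) (R * tj j) x))) \<partial>lborel)"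
    using estimate_AE[OF w fi gi] by (intro nn_integral_mono_AE) (auto simp: indicator_def elim: eventually_mono)
  also have "\<dots> = (\<Sum>j. \<integral>\<^sup>+x. ennreal (C * (tj j / tj j ^ CARD('n) * ball_int (grad_norm g) (R * tj j) x)) \<partial>lborel)"
    by (rule nn_integral_suminf) simp
  also have "\<dots> = (\<Sum>j. ennreal (K * (1/2) ^ j))"
  proof (rule suminf_cong)
    fix j
    have c0: "C * (tj j / tj j ^ CARD('n)) \<ge> 0" using C_nonneg tj_pos[of j] by simp
    have "(\<integral>\<^sup>+x. ennreal (C * (tj j / tj j ^ CARD('n) * ball_int (grad_norm g) (R * tj j) x)) \<partial>lborel)
      = ennreal (C * (tj j / tj j ^ CARD('n))) * (\<integral>\<^sup>+x. ennreal (ball_int (grad_norm g) (R * tj j) x) \<partial>lborel)"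
      using c0 by (subst nn_integral_cmult[symmetric]) (auto simp: ennreal_mult'[symmetric] mult.assoc)
    also have "\<dots> = ennreal (C * (tj j / tj j ^ CARD('n)) * (measure lborel (ball (0::real^'n) (R * tj j)) * (\<integral>y. grad_norm g y \<partial>lborel)))"
      using R_pos tj_pos[of j] c0
      by (subst nn_integral_ball_int[OF Gi grad_norm_nonneg]) (auto simp: ennreal_mult'[symmetric])
    also have "C * (tj j / tj j ^ CARD('n)) * (measure lborel (ball (0::real^'n) (R * tj j)) * (\<integral>y. grad_norm g y \<partial>lborel)) = K * (1/2)^j"
      using R_pos tj_pos[of j] measure_ball_eq[of "R * tj j" "0::real^'n"]
      by (simp add: K_def power_mult_distrib) (simp add: tj_def power_divide)
    finally show "(\<integral>\<^sup>+x. ennreal (C * (tj j / tj j ^ CARD('n) * ball_int (grad_norm g) (R * tj j) x)) \<partial>lborel) = ennreal (K * (1/2)^j)" .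
  qed
  also have "\<dots> = ennreal (\<Sum>j. K * (1/2) ^ j)"
    using K0 by (intro suminf_ennreal2) (auto intro!: summable_mult summable_geometric)
  also have "(\<Sum>j. K * (1/2) ^ j) = 2 * K" by (simp add: suminf_mult suminf_geometric summable_geometric)
  finally show ?thesis by (simp add: K_def mult_ac)
qed

text \<open>The q-th power of term j has an integral of order t^\<kappa> with t = T / 2^j, where
  \<kappa> = q (1 - (n/b - n/q)) is positive by subcriticality. N is fixed beforehand, so that K
  serves all functions whose gradient obeys this bound.\<close>

lemma estimate_Lq:
  assumes b: "b \<ge> 1" and q: "q \<ge> b" and sub: "real CARD('n) / b - real CARD('n) / q < 1" and N: "N > 0"
  obtains K where "\<And>f g. (\<And>i. wder \<Omega> f i (g i)) \<Longrightarrow> integrable lborel (\<lambda>y. indicator \<Omega>' y * f y) \<Longrightarrow>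
    (\<And>i. integrable lborel (\<lambda>y. indicator \<Omega>' y * g i y)) \<Longrightarrow> integrable lborel (\<lambda>y. grad_norm g y powr b) \<Longrightarrow>
    (\<integral>y. grad_norm g y powr b \<partial>lborel) \<le> N \<Longrightarrow>
    (\<integral>\<^sup>+x. indicator A x * ennreal (\<bar>f x - moll \<phi> T f x\<bar> powr q) \<partial>lborel) \<le> ennreal K"
proof -
  let ?V = "measure lborel (ball (0::real^'n) 1)"
  let ?n = "real CARD('n)"
  define \<kappa> where "\<kappa> = q - ?n * q / b + ?n"
  have q0: "q > 0" using b q by simp
  have \<kappa>: "\<kappa> > 0"
  proof -
    have "\<kappa> = q * (1 - (?n / b - ?n / q))" using q0 by (simp add: \<kappa>_def field_simps)
    then show ?thesis using sub q0 by simp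
  qed
  define e where "e = (b - 1) * q / b + 1"
  \<comment> \<open>The weights \<rho>^j from \<open>suminf_powr_bound\<close> cost 2^(j
    \<kappa>/2), half of the decay 2^(-j \<kappa>) of the terms; the remaining ratio is
    \<sigma>.\<close>
  define \<rho> where "\<rho> = 2 powr (- \<kappa> / (2 * q))"
  have \<rho>: "0 < \<rho>" "\<rho> < 1" using \<kappa> q0 by (auto simp: \<rho>_def powr_less_one)
  define \<sigma> where "\<sigma> = 2 powr (- \<kappa> / 2)"
  have \<sigma>: "0 < \<sigma>" "\<sigma> < 1" using \<kappa> by (auto simp: \<sigma>_def powr_less_one)
  define K where "K = (C / (1 - \<rho>)) powr q * (2 powr q * (R ^ CARD('n) * ?V) powr e * N powr (q / b)) * T powr \<kappa>"
  have V: "?V > 0" by simp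
  show ?thesis
  proof (rule that[of "K / (1 - \<sigma>)"])
    fix f g
    assume w: "\<And>i. wder \<Omega> f i (g i)" and fi: "integrable lborel (\<lambda>y. indicator \<Omega>' y * f y)"
      and gi: "\<And>i. integrable lborel (\<lambda>y. indicator \<Omega>' y * g i y)" and Gb: "integrable lborel (\<lambda>y. grad_norm g y powr b)"
      and GN: "(\<integral>y. grad_norm g y powr b \<partial>lborel) \<le> N"
    note Gi = grad_norm_integrable[OF gi]
    note [measurable] = borel_measurable_integrable[OF Gi, unfolded measurable_lborel1] A_borel
    let ?a = "\<lambda>j x. C * (tj j / tj j ^ CARD('n) * ball_int (grad_norm g) (R * tj j) x)"
    have I0: "ball_int (grad_norm g) r x \<ge> 0" for r x by (rule ball_int_nonneg[OF grad_norm_nonneg])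
    have a0: "?a j x \<ge> 0" for j x using C_nonneg tj_pos[of j] I0 by simp
    have "AE x in lborel. indicator A x * ennreal (\<bar>f x - moll \<phi> T f x\<bar> powr q) \<le> (\<Sum>j. ennreal ((?a j x / (\<rho> ^ j * (1 - \<rho>))) powr q))"
      using estimate_AE[OF w fi gi]
    proof eventually_elim
      case (elim x)
      show ?case
      proof (cases "x \<in> A")
        case True
        with elim have "ennreal \<bar>f x - moll \<phi> T f x\<bar> \<le> (\<Sum>j. ennreal (?a j x))" by simp
        from suminf_powr_bound[OF abs_ge_zero a0 this \<rho> q0] True show ?thesis by simp
      qed simp
    qed
    then have "(\<integral>\<^sup>+x. indicator A x * ennreal (\<bar>f x - moll \<phi> T f x\<bar> powr q) \<partial>lborel)
      \<le> (\<integral>\<^sup>+x. (\<Sum>j. ennreal ((?a j x / (\<rho> ^ j * (1 - \<rho>))) powr q)) \<partial>lborel)"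
      by (rule nn_integral_mono_AE)
    also have "\<dots> = (\<Sum>j. \<integral>\<^sup>+x. ennreal ((?a j x / (\<rho> ^ j * (1 - \<rho>))) powr q) \<partial>lborel)"
      by (rule nn_integral_suminf) simp
    also have "\<dots> \<le> (\<Sum>j. ennreal (K * \<sigma> ^ j))"
    proof (rule suminf_le)
      fix j
      let ?t = "tj j"
      have t: "?t > 0" by (rule tj_pos)
      define D where "D = (C * (?t / ?t ^ CARD('n)) / (\<rho> ^ j * (1 - \<rho>))) powr q"
      have eq: "(?a j x / (\<rho> ^ j * (1 - \<rho>))) powr q = D * ball_int (grad_norm g) (R * ?t) x powr q" for x
      proof -
        have "?a j x / (\<rho> ^ j * (1 - \<rho>)) = C * (?t / ?t ^ CARD('n)) / (\<rho> ^ j * (1 - \<rho>)) * ball_int (grad_norm g) (R * ?t) x" by simp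
        then show ?thesis unfolding D_def using C_nonneg t \<rho> I0 by (simp only:) (intro powr_mult; simp)
      qed
      have "(\<integral>\<^sup>+x. ennreal ((?a j x / (\<rho> ^ j * (1 - \<rho>))) powr q) \<partial>lborel)
        = ennreal D * (\<integral>\<^sup>+x. ennreal (ball_int (grad_norm g) (R * ?t) x powr q) \<partial>lborel)"
        unfolding eq by (subst nn_integral_cmult[symmetric]) (auto simp: ennreal_mult'[symmetric] D_def)
      also have "\<dots> \<le> ennreal D * ennreal (2 powr q * measure lborel (ball (0::real^'n) (R * ?t)) powr e * N powr (q / b))"
        unfolding e_def using R_pos t
        by (intro mult_left_mono nn_integral_ball_int_powr[OF Gi grad_norm_nonneg Gb b _ q N GN]) auto
      also have "\<dots> = ennreal (D * (2 powr q * measure lborel (ball (0::real^'n) (R * ?t)) powr e * N powr (q / b)))"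
        by (simp add: ennreal_mult'[symmetric] D_def)
      also have "D * (2 powr q * measure lborel (ball (0::real^'n) (R * ?t)) powr e * N powr (q / b)) = K * \<sigma> ^ j"
      proof -
        have tT: "?t = T * 2 powr (- real j)" by (simp add: tj_def powr_minus powr_realpow divide_inverse)
        have tn: "?t ^ CARD('n) = ?t powr ?n" using t by (simp add: powr_realpow)
        have D: "D = (C / (1 - \<rho>)) powr q * ?t powr ((1 - ?n) * q) * (1 / \<rho> ^ j) powr q"
        proof -
          have "C * (?t / ?t ^ CARD('n)) / (\<rho> ^ j * (1 - \<rho>)) = (C / (1 - \<rho>)) * (?t powr (1 - ?n)) * (1 / \<rho> ^ j)"
            using t by (simp add: tn powr_diff)
          moreover have "((C / (1 - \<rho>)) * (?t powr (1 - ?n)) * (1 / \<rho> ^ j)) powr q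
             = (C / (1 - \<rho>)) powr q * (?t powr (1 - ?n)) powr q * (1 / \<rho> ^ j) powr q"
            by (simp only: powr_mult)
          ultimately show ?thesis unfolding D_def by (simp only: powr_powr)
        qed
        have M: "measure lborel (ball (0::real^'n) (R * ?t)) powr e = (R ^ CARD('n) * ?V) powr e * ?t powr (?n * e)"
        proof -
          have "measure lborel (ball (0::real^'n) (R * ?t)) = (R ^ CARD('n) * ?V) * ?t powr ?n"
            using R_pos t measure_ball_eq[of "R * ?t" "0::real^'n"] by (simp add: power_mult_distrib tn)
          then show ?thesis using R_pos V by (simp only:) (simp add: powr_mult powr_powr)
        qed
        \<comment> \<open>The exponent of t: (1 - n) q from the scale factor of a term, n e from the
          volume of the ball.\<close>
        have ex: "(1 - ?n) * q + ?n * e = \<kappa>" using b unfolding e_def \<kappa>_def by (simp add: field_simps)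
        have tk: "?t powr ((1 - ?n) * q) * ?t powr (?n * e) = T powr \<kappa> * 2 powr (- real j * \<kappa>)"
          unfolding powr_add[symmetric] ex tT using T_pos by (simp add: powr_mult powr_powr)
        have "(1 / \<rho> ^ j) powr q = 2 powr (real j * \<kappa> / 2)"
          using q0 by (simp add: \<rho>_def powr_powr powr_realpow[symmetric] powr_divide powr_minus[symmetric] powr_minus_divide[symmetric] mult.commute)
        moreover have "2 powr (- real j * \<kappa>) * 2 powr (real j * \<kappa> / 2) = \<sigma> ^ j"
          by (simp add: \<sigma>_def powr_realpow[symmetric] powr_powr powr_add[symmetric])
        ultimately have rr: "2 powr (- real j * \<kappa>) * (1 / \<rho> ^ j) powr q = \<sigma> ^ j" by simp
        have "D * (2 powr q * measure lborel (ball (0::real^'n) (R * ?t)) powr e * N powr (q / b))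
          = (C / (1 - \<rho>)) powr q * (2 powr q * (R ^ CARD('n) * ?V) powr e * N powr (q / b)) * (?t powr ((1 - ?n) * q) * ?t powr (?n * e)) * (1 / \<rho> ^ j) powr q"
          unfolding D M by (simp only: mult_ac)
        also have "\<dots> = K * (2 powr (- real j * \<kappa>) * (1 / \<rho> ^ j) powr q)"
          unfolding tk K_def by (simp only: mult_ac)
        finally show ?thesis unfolding rr .
      qed
      finally show "(\<integral>\<^sup>+x. ennreal ((?a j x / (\<rho> ^ j * (1 - \<rho>))) powr q) \<partial>lborel) \<le> ennreal (K * \<sigma> ^ j)" .
    qed auto
    also have "\<dots> = ennreal (\<Sum>j. K * \<sigma> ^ j)"
      using \<sigma> by (intro suminf_ennreal2) (auto intro!: summable_mult summable_geometric simp: K_def)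
    also have "(\<Sum>j. K * \<sigma> ^ j) = K / (1 - \<sigma>)" using \<sigma> by (simp add: suminf_mult suminf_geometric summable_geometric)
    finally show "(\<integral>\<^sup>+x. indicator A x * ennreal (\<bar>f x - moll \<phi> T f x\<bar> powr q) \<partial>lborel) \<le> ennreal (K / (1 - \<sigma>))" .
  qed
qed

end

section \<open>Truncated powers\<close>

lemma continuous_antiderivative:
  fixes f :: "real \<Rightarrow> real"
  assumes "continuous_on UNIV f"
  obtains F where "F 0 = 0" "\<And>x. (F has_real_derivative f x) (at x)"
proof -
  have "isCont f x" for x using assms by (simp add: continuous_on_eq_continuous_at)
  then obtain F where F: "\<And>x. (F has_vector_derivative f x) (at x)"
    using einterval_antiderivative[of "-\<infinity>" \<infinity> f] by auto
  have "((\<lambda>x. F x - F 0) has_real_derivative f x) (at x)" for x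
    using F[of x] unfolding has_real_derivative_iff_has_vector_derivative[symmetric]
    by (auto intro!: derivative_eq_intros)
  then show ?thesis using that[of "\<lambda>x. F x - F 0"] by simp
qed

text \<open>Vanishing on \<open>\<bar>x\<bar> < 1\<close> makes \<open>trunc_pow s M u \<le> \<bar>u\<bar> powr (\<gamma> / \<beta>)\<close> hold for every \<open>s \<le> \<gamma> / \<beta>\<close>,
  so that the variable exponent can be frozen on small balls; the cap \<open>M\<close> keeps the chain rule applicable.\<close>

definition trunc_pow :: "real \<Rightarrow> real \<Rightarrow> real \<Rightarrow> real" where
  "trunc_pow s M x = min M (max 0 (\<bar>x\<bar> powr s - 1))"

lemma trunc_pow_cont: "s > 0 \<Longrightarrow> continuous_on UNIV (trunc_pow s M)"
  unfolding trunc_pow_def[abs_def] 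
  by (intro continuous_on_min continuous_on_max continuous_on_const continuous_on_diff continuous_on_powr'
      continuous_on_rabs continuous_on_id) auto

lemma trunc_pow_bounds:
  assumes "M \<ge> 0" "s > 0"
  shows "0 \<le> trunc_pow s M x" "trunc_pow s M x \<le> M" "trunc_pow s M x \<le> \<bar>x\<bar> powr s" "\<bar>x\<bar> < 1 \<Longrightarrow> trunc_pow s M x = 0"
proof -
  show "0 \<le> trunc_pow s M x" "trunc_pow s M x \<le> M" "trunc_pow s M x \<le> \<bar>x\<bar> powr s"
    using assms by (auto simp: trunc_pow_def min_le_iff_disj)
  show "trunc_pow s M x = 0" if "\<bar>x\<bar> < 1"
    using powr_mono2[of s "\<bar>x\<bar>" 1] that assms by (simp add: trunc_pow_def)
qed

lemma trunc_pow_integral_upper: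
  assumes s: "s > 0" "M \<ge> 0" and F: "F 0 = 0" "\<And>x. (F has_real_derivative trunc_pow s M x) (at x)"
  shows "\<bar>F t\<bar> \<le> \<bar>t\<bar> powr (s + 1)"
proof -
  have "norm (F t - F 0) \<le> \<bar>t\<bar> powr s * norm (t - 0)"
  proof (rule field_differentiable_bound[of "closed_segment 0 t" F "trunc_pow s M"])
    show "(F has_field_derivative trunc_pow s M z) (at z within closed_segment 0 t)" for z
      by (rule has_field_derivative_at_within[OF F(2)])
    fix z assume "z \<in> closed_segment 0 t"
    then have "\<bar>z\<bar> \<le> \<bar>t\<bar>" by (auto simp: closed_segment_eq_real_ivl split: if_splits)
    then have "\<bar>z\<bar> powr s \<le> \<bar>t\<bar> powr s" using s by (intro powr_mono2) auto
    then show "norm (trunc_pow s M z) \<le> \<bar>t\<bar> powr s" using trunc_pow_bounds[OF s(2,1), of z] by simp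
  qed auto
  then show ?thesis using F(1) by (cases "t = 0") (simp_all add: powr_add)
qed

text \<open>The mean value theorem between t/2 and t, where the integrand is at least half of
  (t/2)^s. The threshold for t says exactly that (t/2)^s is at least 2, so subtracting 1 loses at
  most half; the second assumption keeps the cap M out of the way.\<close>

lemma trunc_pow_integral_lower_pos:
  assumes s: "s > 0" "M \<ge> 0" and F: "F 0 = 0" "\<And>x. (F has_real_derivative trunc_pow s M x) (at x)"
    and t: "t \<ge> 2 * 2 powr (1/s)" "t powr s \<le> M"
  shows "t powr (s + 1) \<le> 2 powr (s + 2) * F t"
proof -
  have t0: "t > 0" using t(1) by (rule less_le_trans[rotated]) simp
  have mono: "F a \<le> F b" if "a \<le> b" for a b
    by (rule DERIV_nonneg_imp_nondecreasing[OF that]) (use F(2) trunc_pow_bounds(1)[OF s(2,1)] in blast)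
  have "\<exists>z>t/2. z < t \<and> F t - F (t/2) = (t - t/2) * trunc_pow s M z"
    by (rule MVT2) (use t0 F in auto)
  then obtain z where z: "t/2 < z" "z < t" "F t - F (t/2) = (t - t/2) * trunc_pow s M z" by blast
  have h: "(t/2) powr s \<le> z powr s" "z powr s \<le> t powr s" using z t0 s by (intro powr_mono2; simp)+
  have "(2 powr (1/s)) powr s \<le> (t/2) powr s" using t s by (intro powr_mono2) auto
  then have two: "2 \<le> (t/2) powr s" using s by (simp add: powr_powr)
  have "trunc_pow s M z \<ge> (t/2) powr s / 2"
    unfolding trunc_pow_def using h two t(2) z t0 by (simp add: min_def max_def)
  then have "(t/2) * ((t/2) powr s / 2) \<le> F t - F (t/2)" unfolding z(3) using t0 by (intro mult_mono) auto
  also have "\<dots> \<le> F t" using mono[of 0 "t/2"] t0 F(1) by simp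
  finally have "(t/2) * ((t/2) powr s / 2) \<le> F t" .
  moreover have "(t/2) * ((t/2) powr s / 2) = t powr (s + 1) / 2 powr (s + 2)"
    using t0 by (simp add: powr_divide powr_add mult.commute)
  ultimately show ?thesis by (simp add: divide_le_eq mult.commute)
qed

text \<open>The summand 1 absorbs all t below the threshold of
  \<open>trunc_pow_integral_lower_pos\<close>. The factor depends on s but not on M, so the cap can
  be removed in the end.\<close>

lemma trunc_pow_integral_lower:
  assumes s: "s > 0" "M \<ge> 0" and F: "F 0 = 0" "\<And>x. (F has_real_derivative trunc_pow s M x) (at x)"
    and t: "\<bar>t\<bar> powr s \<le> M"
  shows "\<bar>t\<bar> powr (s + 1) \<le> ((2 * 2 powr (1/s)) powr (s + 1) + 2 powr (s + 2)) * (1 + \<bar>F t\<bar>)"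
proof (cases "\<bar>t\<bar> \<ge> 2 * 2 powr (1/s)")
  case True
  have "\<bar>t\<bar> powr (s + 1) \<le> 2 powr (s + 2) * \<bar>F t\<bar>"
  proof (cases "t \<ge> 0")
    case t0: True
    have "t powr (s + 1) \<le> 2 powr (s + 2) * F t"
      using trunc_pow_integral_lower_pos[OF s F] True t t0 by simp
    also have "\<dots> \<le> 2 powr (s + 2) * \<bar>F t\<bar>" by (intro mult_left_mono) auto
    finally show ?thesis using t0 by simp
  next
    case False
    \<comment> \<open>\<open>trunc_pow\<close> is even, so the reflected function is again its
      antiderivative vanishing at 0, and the positive case applies.\<close>
    have d: "((\<lambda>x. - F (- x)) has_real_derivative trunc_pow s M x) (at x)" for x
    proof -
      have "((\<lambda>x. F (- x)) has_real_derivative trunc_pow s M (- x) * (-1)) (at x)"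
        by (rule DERIV_chain2[OF F(2)]) (auto intro!: derivative_eq_intros)
      from DERIV_minus[OF this] show ?thesis by (simp add: trunc_pow_def)
    qed
    have "(- t) powr (s + 1) \<le> 2 powr (s + 2) * (- F t)"
      using trunc_pow_integral_lower_pos[OF s _ d, of "- t"] True t False F(1) by simp
    also have "\<dots> \<le> 2 powr (s + 2) * \<bar>F t\<bar>" by (intro mult_left_mono) auto
    finally show ?thesis using False by simp
  qed
  also have "\<dots> \<le> ((2 * 2 powr (1/s)) powr (s + 1) + 2 powr (s + 2)) * (1 + \<bar>F t\<bar>)"
    by (intro mult_mono) auto
  finally show ?thesis .
next
  case False
  then have "\<bar>t\<bar> powr (s + 1) \<le> (2 * 2 powr (1/s)) powr (s + 1)" using s by (intro powr_mono2) auto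
  also have "\<dots> \<le> ((2 * 2 powr (1/s)) powr (s + 1) + 2 powr (s + 2)) * 1" by simp
  also have "\<dots> \<le> ((2 * 2 powr (1/s)) powr (s + 1) + 2 powr (s + 2)) * (1 + \<bar>F t\<bar>)"
    by (intro mult_left_mono) auto
  finally show ?thesis .
qed

section \<open>Elementary inequalities for powers\<close>

lemma powr_sum_le:
  fixes a b q :: real
  assumes "a \<ge> 0" "b \<ge> 0" "q \<ge> 0"
  shows "(a + b) powr q \<le> 2 powr q * (a powr q + b powr q)"
proof -
  have "(a + b) powr q \<le> (2 * max a b) powr q" using assms by (intro powr_mono2) auto
  also have "\<dots> = 2 powr q * max a b powr q" by (rule powr_mult)
  also have "\<dots> \<le> 2 powr q * (a powr q + b powr q)"
    by (intro mult_left_mono) (auto simp: max_def)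
  finally show ?thesis .
qed

lemma sum_powr_le:
  fixes a :: "'i \<Rightarrow> real"
  assumes "finite I" "\<And>i. i \<in> I \<Longrightarrow> a i \<ge> 0" "q \<ge> 0"
  shows "(\<Sum>i\<in>I. a i) powr q \<le> real (card I) powr q * (\<Sum>i\<in>I. a i powr q)"
proof (cases "I = {}")
  case False
  define m where "m = Max (a ` I)"
  have "m \<in> a ` I" unfolding m_def using assms(1) False by (intro Max_in) auto
  then obtain k where k: "k \<in> I" "m = a k" by auto
  have "(\<Sum>i\<in>I. a i) \<le> real (card I) * m"
    using sum_bounded_above[of I a m] assms(1) by (simp add: m_def)
  then have "(\<Sum>i\<in>I. a i) powr q \<le> (real (card I) * m) powr q"
    using assms by (intro powr_mono2) (auto intro: sum_nonneg)
  also have "\<dots> = real (card I) powr q * a k powr q" unfolding k(2) by (rule powr_mult)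
  also have "\<dots> \<le> real (card I) powr q * (\<Sum>i\<in>I. a i powr q)"
    using assms k by (intro mult_left_mono member_le_sum[of k I "\<lambda>i. a i powr q"]) auto
  finally show ?thesis .
qed simp

lemma le_one_plus_powr: "x \<ge> 0 \<Longrightarrow> a \<ge> 1 \<Longrightarrow> x \<le> 1 + x powr a" for x a :: real
proof (cases "x \<le> 1")
  case False
  assume "a \<ge> 1"
  then have "x powr 1 \<le> x powr a" using False by (intro powr_mono) auto
  then show ?thesis using False by simp
qed (smt (verit) powr_ge_zero)

section \<open>Higher integrability on one piece with constant exponents\<close>

context cone_domain
begin

text \<open>The Sobolev estimate is applied to f = F(u) with F' = \<open>trunc_pow s m\<close>. The
  gradient of f is at most |u|^s times that of u and vanishes where |u| < 1. Conversely |f| controls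
  |u|^(s+1) only below the cap, hence the restriction |u|^s <= m in the conclusion. K is found
  before m and survives m tending to infinity.\<close>

lemma truncated_piece:
  assumes s: "s > 0" and b: "b \<ge> 1" and q: "q \<ge> b" and sub: "real CARD('n) / b - real CARD('n) / q < 1"
    and N: "N > 0" and fin: "emeasure lborel \<Omega>' < \<infinity>"
  obtains K where "\<And>u g m. (\<And>i. wder \<Omega> u i (g i)) \<Longrightarrow> m \<ge> (0::real) \<Longrightarrow>
     (\<integral>\<^sup>+x. indicator \<Omega>' x * ennreal (\<bar>u x\<bar> powr (s + 1)) \<partial>lborel) \<le> ennreal N \<Longrightarrow>
     (\<And>i. (\<integral>\<^sup>+x. indicator \<Omega>' x * ennreal (if \<bar>u x\<bar> < 1 then 0 else (\<bar>u x\<bar> powr s * \<bar>g i x\<bar>) powr b) \<partial>lborel) \<le> ennreal N) \<Longrightarrow>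
     (\<integral>\<^sup>+x. indicator A x * ennreal (if \<bar>u x\<bar> powr s \<le> m then \<bar>u x\<bar> powr ((s + 1) * q) else 0) \<partial>lborel) \<le> ennreal K"
proof -
  let ?n = "real CARD('n)"
  have q0: "q > 0" "q \<ge> 0" using b q by auto
  note [measurable] = \<Omega>'_borel A_borel
  define N' where "N' = ?n powr b * (?n * N)"
  have N': "N' > 0" using N by (simp add: N'_def)
  obtain K1 where K1: "\<And>f g. (\<And>i. wder \<Omega> f i (g i)) \<Longrightarrow> integrable lborel (\<lambda>y. indicator \<Omega>' y * f y) \<Longrightarrow>
    (\<And>i. integrable lborel (\<lambda>y. indicator \<Omega>' y * g i y)) \<Longrightarrow> integrable lborel (\<lambda>y. grad_norm g y powr b) \<Longrightarrow>
    (\<integral>y. grad_norm g y powr b \<partial>lborel) \<le> N' \<Longrightarrow>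
    (\<integral>\<^sup>+x. indicator A x * ennreal (\<bar>f x - moll \<phi> T f x\<bar> powr q) \<partial>lborel) \<le> ennreal K1"
    using estimate_Lq[OF b q sub N'] by blast
  obtain B0 where B0: "B0 > 0" "\<And>z. \<bar>\<phi> z\<bar> \<le> B0" using kern_bounded[OF bumpD(2)] by metis
  \<comment> \<open>Bound for the average of f at the top scale T, by the L1 norm of f on
    \<Omega>'.\<close>
  define K2 where "K2 = B0 / T ^ CARD('n) * N"
  have K2: "K2 \<ge> 0" using B0 T_pos N by (simp add: K2_def)
  define Ks where "Ks = (2 * 2 powr (1/s)) powr (s + 1) + 2 powr (s + 2)"
  have Ks: "Ks \<ge> 0" by (simp add: Ks_def)
  define C1 where "C1 = Ks powr q * 2 powr q"
  define C2 where "C2 = C1 * (1 + 2 powr q * K2 powr q)"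
  define C3 where "C3 = C1 * 2 powr q"
  have C0: "C1 \<ge> 0" "C2 \<ge> 0" "C3 \<ge> 0" by (auto simp: C1_def C2_def C3_def)
  define mA where "mA = measure lborel A"
  have eA: "emeasure lborel A = ennreal mA"
  proof -
    have "emeasure lborel A \<le> emeasure lborel \<Omega>'" by (rule emeasure_mono[OF A_sub]) simp
    then show ?thesis unfolding mA_def using fin by (intro emeasure_eq_ennreal_measure) auto
  qed
  show ?thesis
  proof (rule that[of "C2 * mA + C3 * \<bar>K1\<bar>"])
    fix u :: "'n fn" and g and m :: real
    assume w: "\<And>i. wder \<Omega> u i (g i)" and m: "m \<ge> 0"
      and uN: "(\<integral>\<^sup>+x. indicator \<Omega>' x * ennreal (\<bar>u x\<bar> powr (s + 1)) \<partial>lborel) \<le> ennreal N"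
      and gN: "\<And>i. (\<integral>\<^sup>+x. indicator \<Omega>' x * ennreal (if \<bar>u x\<bar> < 1 then 0 else (\<bar>u x\<bar> powr s * \<bar>g i x\<bar>) powr b) \<partial>lborel) \<le> ennreal N"
    note [measurable] = wderD(1,2)[OF w]
    obtain F where F: "F 0 = 0" "\<And>x. (F has_real_derivative trunc_pow s m x) (at x)"
      using continuous_antiderivative[OF trunc_pow_cont[OF s]] by metis
    note tp = trunc_pow_bounds[OF m s]
    define f where "f x = F (u x)" for x
    define h where "h i x = trunc_pow s m (u x) * g i x" for i x
    have wf: "wder \<Omega> f i (h i)" for i
      unfolding f_def[abs_def] h_def[abs_def]
      by (rule wder_chain[OF w open_\<Omega> F(2) trunc_pow_cont[OF s], of m]) (simp add: tp(1,2))
    note [measurable] = wderD(1,2)[OF wf]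
    have fu: "\<bar>f x\<bar> \<le> \<bar>u x\<bar> powr (s + 1)" for x unfolding f_def by (rule trunc_pow_integral_upper[OF s m F])
    have hg: "\<bar>h i x\<bar> powr b \<le> (if \<bar>u x\<bar> < 1 then 0 else (\<bar>u x\<bar> powr s * \<bar>g i x\<bar>) powr b)" for i x
    proof (cases "\<bar>u x\<bar> < 1")
      case False
      have "\<bar>h i x\<bar> \<le> \<bar>u x\<bar> powr s * \<bar>g i x\<bar>" unfolding h_def abs_mult
        using tp[of "u x"] by (intro mult_right_mono) auto
      then show ?thesis using False b by (auto intro!: powr_mono2)
    qed (simp add: h_def tp(4))
    have fN: "(\<integral>\<^sup>+x. ennreal \<bar>indicator \<Omega>' x * f x\<bar> \<partial>lborel) \<le> ennreal N"
    proof -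
      have "(\<integral>\<^sup>+x. ennreal \<bar>indicator \<Omega>' x * f x\<bar> \<partial>lborel) \<le> (\<integral>\<^sup>+x. indicator \<Omega>' x * ennreal (\<bar>u x\<bar> powr (s + 1)) \<partial>lborel)"
        by (intro nn_integral_mono) (auto simp: indicator_def fu ennreal_leI)
      with uN show ?thesis by (rule order_trans[rotated])
    qed
    have fi: "integrable lborel (\<lambda>x. indicator \<Omega>' x * f x)"
      by (rule integrableI_bounded) (use le_less_trans[OF fN ennreal_less_top] in simp_all)
    have fI: "(\<integral>x. \<bar>indicator \<Omega>' x * f x\<bar> \<partial>lborel) \<le> N"
    proof -
      have "(\<integral>\<^sup>+x. ennreal \<bar>indicator \<Omega>' x * f x\<bar> \<partial>lborel) = ennreal (\<integral>x. \<bar>indicator \<Omega>' x * f x\<bar> \<partial>lborel)"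
        by (rule nn_integral_eq_integral) (use fi in auto)
      with fN N show ?thesis by simp
    qed
    have hb: "(\<integral>\<^sup>+x. ennreal (\<bar>indicator \<Omega>' x * h i x\<bar> powr b) \<partial>lborel) \<le> ennreal N" for i
    proof -
      have "(\<integral>\<^sup>+x. ennreal (\<bar>indicator \<Omega>' x * h i x\<bar> powr b) \<partial>lborel)
        \<le> (\<integral>\<^sup>+x. indicator \<Omega>' x * ennreal (if \<bar>u x\<bar> < 1 then 0 else (\<bar>u x\<bar> powr s * \<bar>g i x\<bar>) powr b) \<partial>lborel)"
      proof (rule nn_integral_mono)
        fix x show "ennreal (\<bar>indicator \<Omega>' x * h i x\<bar> powr b) \<le> indicator \<Omega>' x * ennreal (if \<bar>u x\<bar> < 1 then 0 else (\<bar>u x\<bar> powr s * \<bar>g i x\<bar>) powr b)"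
          using hg[of i x] by (cases "x \<in> \<Omega>'") (auto intro: ennreal_leI)
      qed
      with gN show ?thesis by (rule order_trans[rotated])
    qed
    have hbi: "integrable lborel (\<lambda>x. \<bar>indicator \<Omega>' x * h i x\<bar> powr b)" for i
      by (rule integrableI_bounded) (use le_less_trans[OF hb ennreal_less_top] in simp_all)
    have hbI: "(\<integral>x. \<bar>indicator \<Omega>' x * h i x\<bar> powr b \<partial>lborel) \<le> N" for i
    proof -
      have "(\<integral>\<^sup>+x. ennreal (\<bar>indicator \<Omega>' x * h i x\<bar> powr b) \<partial>lborel) = ennreal (\<integral>x. \<bar>indicator \<Omega>' x * h i x\<bar> powr b \<partial>lborel)"
        by (rule nn_integral_eq_integral) (use hbi in auto)
      with hb[of i] N show ?thesis by simp
    qed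
    have i\<Omega>: "integrable lborel (indicator \<Omega>' :: _ \<Rightarrow> real)" using fin by (intro integrable_real_indicator) auto
    \<comment> \<open>Integrability of the gradient itself follows from that of its b-th power
      because \<Omega>' has finite measure.\<close>
    have hi: "integrable lborel (\<lambda>x. indicator \<Omega>' x * h i x)" for i
    proof (rule Bochner_Integration.integrable_bound)
      show "integrable lborel (\<lambda>x. indicator \<Omega>' x + \<bar>indicator \<Omega>' x * h i x\<bar> powr b)" using i\<Omega> hbi by simp
      show "AE x in lborel. norm (indicator \<Omega>' x * h i x) \<le> norm (indicator \<Omega>' x + \<bar>indicator \<Omega>' x * h i x\<bar> powr b)"
      proof (intro AE_I2)
        fix x show "norm (indicator \<Omega>' x * h i x) \<le> norm (indicator \<Omega>' x + \<bar>indicator \<Omega>' x * h i x\<bar> powr b)"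
          using le_one_plus_powr[of "\<bar>h i x\<bar>" b] b by (cases "x \<in> \<Omega>'") auto
      qed
    qed simp
    have gnb: "grad_norm h x powr b \<le> ?n powr b * (\<Sum>i\<in>UNIV. \<bar>indicator \<Omega>' x * h i x\<bar> powr b)" for x
      unfolding grad_norm_def using sum_powr_le[of "UNIV::'n set" "\<lambda>i. \<bar>indicator \<Omega>' x * h i x\<bar>" b] b by simp
    have Si: "integrable lborel (\<lambda>x. ?n powr b * (\<Sum>i\<in>UNIV. \<bar>indicator \<Omega>' x * h i x\<bar> powr b))" using hbi by simp
    have [measurable]: "grad_norm h \<in> borel_measurable borel" unfolding grad_norm_def[abs_def] by measurable
    have Gb: "integrable lborel (\<lambda>x. grad_norm h x powr b)"
      by (rule Bochner_Integration.integrable_bound[OF Si]) (use gnb in \<open>auto intro: order_trans[OF _ abs_ge_self]\<close>)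
    have GN: "(\<integral>x. grad_norm h x powr b \<partial>lborel) \<le> N'"
    proof -
      have "(\<integral>x. grad_norm h x powr b \<partial>lborel) \<le> (\<integral>x. ?n powr b * (\<Sum>i\<in>UNIV. \<bar>indicator \<Omega>' x * h i x\<bar> powr b) \<partial>lborel)"
        by (rule integral_mono[OF Gb Si gnb])
      also have "\<dots> = ?n powr b * (\<Sum>i\<in>UNIV. \<integral>x. \<bar>indicator \<Omega>' x * h i x\<bar> powr b \<partial>lborel)" using hbi by simp
      also have "\<dots> \<le> ?n powr b * (?n * N)"
        using sum_bounded_above[of "UNIV::'n set" "\<lambda>i. \<integral>x. \<bar>indicator \<Omega>' x * h i x\<bar> powr b \<partial>lborel" N] hbI
        by (intro mult_left_mono) auto
      finally show ?thesis by (simp add: N'_def)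
    qed
    have est: "(\<integral>\<^sup>+x. indicator A x * ennreal (\<bar>f x - moll \<phi> T f x\<bar> powr q) \<partial>lborel) \<le> ennreal \<bar>K1\<bar>"
      by (rule order_trans[OF K1[OF wf fi hi Gb GN]]) (simp add: ennreal_leI)
    have mollb: "\<bar>moll \<phi> T f x\<bar> \<le> K2" if "x \<in> A" for x
    proof -
      have "\<bar>moll \<phi> T f x\<bar> \<le> B0 / T ^ CARD('n) * (\<integral>x. \<bar>indicator \<Omega>' x * f x\<bar> \<partial>lborel)"
        by (subst moll_cong_indicator(2)[OF bumpD(2) cone[OF that T_pos order_refl]])
          (rule moll_bound[OF fi bumpD(2) B0(2) T_pos])
      also have "\<dots> \<le> K2" unfolding K2_def using fI B0 T_pos by (intro mult_left_mono) auto
      finally show ?thesis .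
    qed
    have pt: "\<bar>u x\<bar> powr ((s + 1) * q) \<le> C2 + C3 * \<bar>f x - moll \<phi> T f x\<bar> powr q" if x: "x \<in> A" and um: "\<bar>u x\<bar> powr s \<le> m" for x
    proof -
      have "\<bar>u x\<bar> powr (s + 1) \<le> Ks * (1 + \<bar>f x\<bar>)"
        unfolding Ks_def f_def by (rule trunc_pow_integral_lower[OF s m F um])
      then have "(\<bar>u x\<bar> powr (s + 1)) powr q \<le> (Ks * (1 + \<bar>f x\<bar>)) powr q" using q0 by (intro powr_mono2) auto
      also have "\<dots> = Ks powr q * (1 + \<bar>f x\<bar>) powr q" by (rule powr_mult)
      also have "\<dots> \<le> Ks powr q * (2 powr q * (1 powr q + \<bar>f x\<bar> powr q))"
        using q0 by (intro mult_left_mono powr_sum_le) auto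
      also have "\<dots> = C1 * (1 + \<bar>f x\<bar> powr q)" by (simp add: C1_def)
      also have "\<dots> \<le> C1 * (1 + 2 powr q * (\<bar>f x - moll \<phi> T f x\<bar> powr q + K2 powr q))"
      proof (intro mult_left_mono add_left_mono)
        have "\<bar>f x\<bar> powr q \<le> (\<bar>f x - moll \<phi> T f x\<bar> + K2) powr q"
          using mollb[OF x] q0 by (intro powr_mono2) auto
        also have "\<dots> \<le> 2 powr q * (\<bar>f x - moll \<phi> T f x\<bar> powr q + K2 powr q)"
          using K2 q0 by (intro powr_sum_le) auto
        finally show "\<bar>f x\<bar> powr q \<le> 2 powr q * (\<bar>f x - moll \<phi> T f x\<bar> powr q + K2 powr q)" .
      qed (rule C0)
      also have "\<dots> = C2 + C3 * \<bar>f x - moll \<phi> T f x\<bar> powr q" by (simp add: C2_def C3_def algebra_simps)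
      finally show ?thesis by (simp add: powr_powr)
    qed
    have "(\<integral>\<^sup>+x. indicator A x * ennreal (if \<bar>u x\<bar> powr s \<le> m then \<bar>u x\<bar> powr ((s + 1) * q) else 0) \<partial>lborel)
      \<le> (\<integral>\<^sup>+x. ennreal C2 * indicator A x + ennreal C3 * (indicator A x * ennreal (\<bar>f x - moll \<phi> T f x\<bar> powr q)) \<partial>lborel)"
    proof (rule nn_integral_mono)
      fix x
      show "indicator A x * ennreal (if \<bar>u x\<bar> powr s \<le> m then \<bar>u x\<bar> powr ((s + 1) * q) else 0)
        \<le> ennreal C2 * indicator A x + ennreal C3 * (indicator A x * ennreal (\<bar>f x - moll \<phi> T f x\<bar> powr q))"
        using pt[of x] C0
        by (cases "x \<in> A"; cases "\<bar>u x\<bar> powr s \<le> m")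
          (auto simp: ennreal_mult'[symmetric] ennreal_plus[symmetric] simp del: ennreal_plus intro!: ennreal_leI)
    qed
    also have "\<dots> = ennreal C2 * ennreal mA + ennreal C3 * (\<integral>\<^sup>+x. indicator A x * ennreal (\<bar>f x - moll \<phi> T f x\<bar> powr q) \<partial>lborel)"
    proof -
      have [measurable]: "moll \<phi> T f \<in> borel_measurable borel" using kernD(3)[OF bumpD(2)] by measurable
      show ?thesis by (subst nn_integral_add) (simp_all add: nn_integral_cmult eA)
    qed
    also have "\<dots> \<le> ennreal C2 * ennreal mA + ennreal C3 * ennreal \<bar>K1\<bar>" by (intro add_left_mono mult_left_mono est) simp
    also have "\<dots> = ennreal (C2 * mA + C3 * \<bar>K1\<bar>)"
      using C0 by (simp add: ennreal_mult' ennreal_plus mA_def)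
    finally show "(\<integral>\<^sup>+x. indicator A x * ennreal (if \<bar>u x\<bar> powr s \<le> m then \<bar>u x\<bar> powr ((s + 1) * q) else 0) \<partial>lborel)
      \<le> ennreal (C2 * mA + C3 * \<bar>K1\<bar>)" .
  qed
qed

text \<open>Monotone convergence in the cap m removes the truncation, since the bound of
  \<open>truncated_piece\<close> is uniform in m.\<close>

lemma piece_bound:
  assumes s: "s > 0" and b: "b \<ge> 1" and q: "q \<ge> b" and sub: "real CARD('n) / b - real CARD('n) / q < 1"
    and N: "N > 0" and fin: "emeasure lborel \<Omega>' < \<infinity>"
  shows "\<exists>K. \<forall>u g. (\<forall>i. wder \<Omega> u i (g i)) \<longrightarrow>
     (\<integral>\<^sup>+x. indicator \<Omega>' x * ennreal (\<bar>u x\<bar> powr (s + 1)) \<partial>lborel) \<le> ennreal N \<longrightarrow>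
     (\<forall>i. (\<integral>\<^sup>+x. indicator \<Omega>' x * ennreal (if \<bar>u x\<bar> < 1 then 0 else (\<bar>u x\<bar> powr s * \<bar>g i x\<bar>) powr b) \<partial>lborel) \<le> ennreal N) \<longrightarrow>
     (\<integral>\<^sup>+x. indicator A x * ennreal (\<bar>u x\<bar> powr ((s + 1) * q)) \<partial>lborel) \<le> ennreal K"
proof -
  obtain K where K: "\<And>u g m. (\<And>i. wder \<Omega> u i (g i)) \<Longrightarrow> m \<ge> (0::real) \<Longrightarrow>
     (\<integral>\<^sup>+x. indicator \<Omega>' x * ennreal (\<bar>u x\<bar> powr (s + 1)) \<partial>lborel) \<le> ennreal N \<Longrightarrow>
     (\<And>i. (\<integral>\<^sup>+x. indicator \<Omega>' x * ennreal (if \<bar>u x\<bar> < 1 then 0 else (\<bar>u x\<bar> powr s * \<bar>g i x\<bar>) powr b) \<partial>lborel) \<le> ennreal N) \<Longrightarrow>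
     (\<integral>\<^sup>+x. indicator A x * ennreal (if \<bar>u x\<bar> powr s \<le> m then \<bar>u x\<bar> powr ((s + 1) * q) else 0) \<partial>lborel) \<le> ennreal K"
    using truncated_piece[OF assms] by blast
  show ?thesis
  proof (intro exI[of _ K] allI impI)
    fix u g
    assume w': "\<forall>i. wder \<Omega> u i (g i)"
      and h': "(\<integral>\<^sup>+x. indicator \<Omega>' x * ennreal (\<bar>u x\<bar> powr (s + 1)) \<partial>lborel) \<le> ennreal N"
        "\<forall>i. (\<integral>\<^sup>+x. indicator \<Omega>' x * ennreal (if \<bar>u x\<bar> < 1 then 0 else (\<bar>u x\<bar> powr s * \<bar>g i x\<bar>) powr b) \<partial>lborel) \<le> ennreal N"
    note w = w'[rule_format] and h = h'(1) h'(2)[rule_format]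
    note [measurable] = wderD(1,2)[OF w] A_borel
    define X where "X m x = (indicator A x * ennreal (if \<bar>u x\<bar> powr s \<le> real m then \<bar>u x\<bar> powr ((s + 1) * q) else 0) :: ennreal)" for m :: nat and x
    have [measurable]: "X m \<in> borel_measurable borel" for m unfolding X_def[abs_def] by measurable
    have inc: "incseq X"
      by (rule incseq_SucI) (auto simp: X_def le_fun_def indicator_def)
    have sup: "(SUP m. X m x) = indicator A x * ennreal (\<bar>u x\<bar> powr ((s + 1) * q))" for x
    proof (rule antisym)
      show "(SUP m. X m x) \<le> indicator A x * ennreal (\<bar>u x\<bar> powr ((s + 1) * q))"
        by (rule SUP_least) (auto simp: X_def indicator_def)
      obtain m :: nat where "\<bar>u x\<bar> powr s \<le> real m" using real_arch_simple by blast
      then have "X m x = indicator A x * ennreal (\<bar>u x\<bar> powr ((s + 1) * q))" by (simp add: X_def)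
      then show "indicator A x * ennreal (\<bar>u x\<bar> powr ((s + 1) * q)) \<le> (SUP m. X m x)" by (metis SUP_upper UNIV_I)
    qed
    have "(\<integral>\<^sup>+x. indicator A x * ennreal (\<bar>u x\<bar> powr ((s + 1) * q)) \<partial>lborel) = (SUP m. integral\<^sup>N lborel (X m))"
      unfolding sup[symmetric] by (rule nn_integral_monotone_convergence_SUP[OF inc]) simp
    also have "\<dots> \<le> ennreal K"
      unfolding X_def by (rule SUP_least) (rule K[OF w _ h], simp)
    finally show "(\<integral>\<^sup>+x. indicator A x * ennreal (\<bar>u x\<bar> powr ((s + 1) * q)) \<partial>lborel) \<le> ennreal K" .
  qed
qed

end

section \<open>Rellich compactness\<close>

lemma smooth_kern_lipschitz:
  assumes "smooth \<phi>" "kern c d \<phi>"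
  obtains L where "L > 0" "\<And>a b :: real^'n::finite. \<bar>\<phi> a - \<phi> b\<bar> \<le> L * norm (a - b)"
proof -
  have "\<forall>i. \<exists>b. \<forall>z. \<bar>partial i \<phi> z\<bar> \<le> b" using kern_bounded[OF kern_smooth_partial[OF assms]] by metis
  then obtain b where b: "\<And>i z. \<bar>partial i \<phi> z\<bar> \<le> b i" by metis
  define L where "L = (\<Sum>i\<in>UNIV. b i) + 1"
  have b0: "b i \<ge> 0" for i using b[of i 0] by linarith
  have L: "L > 0" unfolding L_def using sum_nonneg[of UNIV b] b0 by (simp add: add_nonneg_pos)
  have "norm (\<phi> a - \<phi> b') \<le> L * norm (a - b')" for a b' :: "real^'n"
  proof (rule differentiable_bound[OF convex_UNIV])
    fix x :: "real^'n"
    show "(\<phi> has_derivative (\<lambda>h. \<Sum>i\<in>UNIV. h $ i * partial i \<phi> x)) (at x within UNIV)"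
      using smooth_partial(1)[OF assms(1)] by simp
    show "onorm (\<lambda>h. \<Sum>i\<in>UNIV. h $ i * partial i \<phi> x) \<le> L"
    proof (rule onorm_le)
      fix h :: "real^'n"
      have "norm (\<Sum>i\<in>UNIV. h $ i * partial i \<phi> x) \<le> (\<Sum>i\<in>UNIV. norm h * b i)"
      proof (rule order_trans[OF norm_sum sum_mono])
        fix i
        show "norm (h $ i * partial i \<phi> x) \<le> norm h * b i"
          unfolding norm_mult using component_le_norm_cart[of h i] b[of i x] by (intro mult_mono) auto
      qed
      also have "\<dots> \<le> L * norm h" unfolding L_def sum_distrib_left[symmetric] by (simp add: algebra_simps)
      finally show "norm (\<Sum>i\<in>UNIV. h $ i * partial i \<phi> x) \<le> L * norm h" .
    qed
  qed auto
  with L that show ?thesis by auto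
qed

text \<open>The Lipschitz constant depends on f only through its L1 norm: at a fixed scale, the
  averages of a family bounded in L1 are equicontinuous.\<close>

lemma moll_lipschitz:
  fixes f :: "'n::finite fn"
  assumes f: "integrable lborel f" and \<phi>: "kern c d \<phi>" and L: "\<And>a b. \<bar>\<phi> a - \<phi> b\<bar> \<le> L * norm (a - b)" and t: "t > 0"
  shows "\<bar>moll \<phi> t f x - moll \<phi> t f y\<bar> \<le> L / t ^ Suc CARD('n) * (\<integral>z. \<bar>f z\<bar> \<partial>lborel) * norm (x - y)"
proof -
  have [measurable]: "f \<in> borel_measurable borel" "\<phi> \<in> borel_measurable borel" using f kernD(3)[OF \<phi>] by auto
  obtain B where B: "B > 0" "\<And>z. \<bar>\<phi> z\<bar> \<le> B" using kern_bounded[OF \<phi>] by metis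
  let ?K = "\<lambda>x z. f z * \<phi> ((1/t) *\<^sub>R (z - x))"
  have i: "integrable lborel (?K x)" for x
  proof (rule Bochner_Integration.integrable_bound)
    show "integrable lborel (\<lambda>z. B * f z)" using f by simp
    show "AE z in lborel. norm (?K x z) \<le> norm (B * f z)"
      using B by (intro AE_I2) (simp add: abs_mult mult.commute[of B] mult_left_mono)
  qed simp
  have "\<bar>moll \<phi> t f x - moll \<phi> t f y\<bar> = (1 / t ^ CARD('n)) * \<bar>\<integral>z. ?K x z - ?K y z \<partial>lborel\<bar>"
    unfolding Bochner_Integration.integral_diff[OF i i]
    using t by (simp add: moll_eq diff_divide_distrib[symmetric])
  also have "\<dots> \<le> (1 / t ^ CARD('n)) * (\<integral>z. \<bar>?K x z - ?K y z\<bar> \<partial>lborel)"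
    using t by (intro mult_left_mono integral_abs_bound) auto
  also have "\<dots> \<le> (1 / t ^ CARD('n)) * (\<integral>z. (L / t * norm (x - y)) * \<bar>f z\<bar> \<partial>lborel)"
  proof (intro mult_left_mono integral_mono)
    fix z
    have e: "(1/t) *\<^sub>R (z - x) - (1/t) *\<^sub>R (z - y) = (1/t) *\<^sub>R (y - x)" by (simp add: algebra_simps)
    have "\<bar>\<phi> ((1/t) *\<^sub>R (z - x)) - \<phi> ((1/t) *\<^sub>R (z - y))\<bar> \<le> L / t * norm (x - y)"
      using L[of "(1/t) *\<^sub>R (z - x)" "(1/t) *\<^sub>R (z - y)"] t unfolding e by (simp add: norm_minus_commute)
    from mult_left_mono[OF this, of "\<bar>f z\<bar>"]
    show "\<bar>?K x z - ?K y z\<bar> \<le> (L / t * norm (x - y)) * \<bar>f z\<bar>"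
      by (simp add: abs_mult[symmetric] right_diff_distrib[symmetric] mult.commute)
  qed (use i f t in auto)
  also have "\<dots> = L / t ^ Suc CARD('n) * (\<integral>z. \<bar>f z\<bar> \<partial>lborel) * norm (x - y)" by (simp add: field_simps)
  finally show ?thesis .
qed

text \<open>Replacing each f k by its average at scale T costs at most Z T in L1 on K, uniformly in
  k. At that fixed T the averages are bounded and equicontinuous, so the Arzela-Ascoli theorem
  applies. A subsequence for one accuracy e is all that a diagonal argument needs.\<close>

lemma rellich_total_bound:
  fixes f :: "nat \<Rightarrow> 'n::finite fn"
  assumes \<Omega>: "open \<Omega>" and w: "\<And>k i. wder \<Omega> (f k) i (g k i)"
    and fN: "\<And>k. (\<integral>\<^sup>+x. ennreal \<bar>indicator \<Omega> x * f k x\<bar> \<partial>lborel) \<le> ennreal N"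
    and gN: "\<And>k i. (\<integral>\<^sup>+x. ennreal \<bar>indicator \<Omega> x * g k i x\<bar> \<partial>lborel) \<le> ennreal N"
    and N: "N \<ge> 0" and K: "compact K" "K \<subseteq> \<Omega>" and e: "e > 0"
  shows "\<exists>r::nat\<Rightarrow>nat. strict_mono r \<and> (\<forall>i j. (\<integral>\<^sup>+x. indicator K x * ennreal \<bar>f (r i) x - f (r j) x\<bar> \<partial>lborel) \<le> ennreal e)"
proof -
  note [measurable] = wderD(1,2)[OF w]
  have [measurable]: "\<Omega> \<in> sets borel" "K \<in> sets borel" using \<Omega> K by (auto simp: borel_compact)
  obtain \<phi> :: "'n fn" where bump: "bump 0 1 \<phi>" using bump_exists[of 1 0] by auto
  have \<phi>: "smooth \<phi>" "kern 0 1 \<phi>"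
    using bump Ck_continuous[of 0 \<phi>] unfolding bump_def kern_def smooth_def by auto
  note [measurable] = kernD(3)[OF \<phi>(2)]
  obtain \<rho> where \<rho>: "\<rho> > 0" "fatten K \<rho> \<subseteq> \<Omega>" using fatten_open_obtain[OF K(1) \<Omega> K(2)] by blast
  obtain L where L: "L > 0" "\<And>a b. \<bar>\<phi> a - \<phi> b\<bar> \<le> L * norm (a - b)" using smooth_kern_lipschitz[OF \<phi>] by metis
  obtain B0 where B0: "B0 > 0" "\<And>z. \<bar>\<phi> z\<bar> \<le> B0" using kern_bounded[OF \<phi>(2)] by metis
  have dom: "cone_domain \<Omega> \<Omega> K 0 1 \<phi> T" if T: "0 < T" "T \<le> \<rho>" for T
  proof (unfold_locales)
    fix x t assume x: "x \<in> K" and t: "0 < t" "t \<le> T"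
    show "(\<lambda>z. x + t *\<^sub>R z) ` cball 0 1 \<subseteq> \<Omega>"
    proof
      fix y assume "y \<in> (\<lambda>z. x + t *\<^sub>R z) ` cball 0 1"
      then show "y \<in> \<Omega>"
      proof (rule imageE)
        fix z assume z: "y = x + t *\<^sub>R z" "z \<in> cball 0 1"
        have "t * norm z \<le> \<rho> * 1" using z t T by (intro mult_mono) auto
        then have "y \<in> fatten K \<rho>" unfolding z using x t by (intro fattenI) auto
        then show "y \<in> \<Omega>" using \<rho> by blast
      qed
    qed
  qed (use \<Omega> bump K T in auto)
  let ?f = "\<lambda>k x. indicator \<Omega> x * f k x" and ?g = "\<lambda>k i x. indicator \<Omega> x * g k i x"
  have fi: "integrable lborel (?f k)" for k
    by (rule integrableI_bounded) (use le_less_trans[OF fN ennreal_less_top] in simp_all)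
  have gi: "integrable lborel (?g k i)" for k i
    by (rule integrableI_bounded) (use le_less_trans[OF gN ennreal_less_top] in simp_all)
  have fI: "(\<integral>x. \<bar>?f k x\<bar> \<partial>lborel) \<le> N" for k
  proof -
    have "(\<integral>\<^sup>+x. ennreal \<bar>?f k x\<bar> \<partial>lborel) = ennreal (\<integral>x. \<bar>?f k x\<bar> \<partial>lborel)"
      by (rule nn_integral_eq_integral) (use fi in auto)
    with fN[of k] N show ?thesis by simp
  qed
  have gI: "(\<integral>x. \<bar>?g k i x\<bar> \<partial>lborel) \<le> N" for k i
  proof -
    have "(\<integral>\<^sup>+x. ennreal \<bar>?g k i x\<bar> \<partial>lborel) = ennreal (\<integral>x. \<bar>?g k i x\<bar> \<partial>lborel)"
      by (rule nn_integral_eq_integral) (use gi in auto)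
    with gN[of k i] N show ?thesis by simp
  qed
  define Z where "Z = 2 * cone_domain.C \<phi> * cone_domain.R (0::real^'n) 1 ^ CARD('n) * measure lborel (ball (0::real^'n) 1) * (real CARD('n) * N)"
  have est: "(\<integral>\<^sup>+x. indicator K x * ennreal \<bar>f k x - moll \<phi> T (f k) x\<bar> \<partial>lborel) \<le> ennreal (Z * T)"
    and Z0: "Z \<ge> 0" if T: "0 < T" "T \<le> \<rho>" for k T
  proof -
    interpret cd: cone_domain \<Omega> \<Omega> K 0 1 \<phi> T by (rule dom[OF T])
    have "(\<integral>y. cd.grad_norm (g k) y \<partial>lborel) = (\<Sum>i\<in>UNIV. \<integral>y. \<bar>?g k i y\<bar> \<partial>lborel)"
      unfolding cd.grad_norm_def using gi by simp
    also have "\<dots> \<le> real CARD('n) * N"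
      using sum_bounded_above[of "UNIV::'n set" "\<lambda>i. \<integral>y. \<bar>?g k i y\<bar> \<partial>lborel" N] gI by auto
    finally have G: "(\<integral>y. cd.grad_norm (g k) y \<partial>lborel) \<le> real CARD('n) * N" .
    show "Z \<ge> 0" unfolding Z_def using cd.C_nonneg cd.R_pos N by simp
    have "(\<integral>\<^sup>+x. indicator K x * ennreal \<bar>f k x - moll \<phi> T (f k) x\<bar> \<partial>lborel)
      \<le> ennreal (2 * cd.C * cd.R ^ CARD('n) * measure lborel (ball (0::real^'n) 1) * T * (\<integral>y. cd.grad_norm (g k) y \<partial>lborel))"
      by (rule cd.estimate_L1[OF w fi gi])
    also have "\<dots> \<le> ennreal (2 * cd.C * cd.R ^ CARD('n) * measure lborel (ball (0::real^'n) 1) * T * (real CARD('n) * N))"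
      using cd.C_nonneg cd.R_pos T G by (intro ennreal_leI mult_left_mono) auto
    finally show "(\<integral>\<^sup>+x. indicator K x * ennreal \<bar>f k x - moll \<phi> T (f k) x\<bar> \<partial>lborel) \<le> ennreal (Z * T)"
      by (simp add: Z_def mult_ac)
  qed
  have Z0': "Z \<ge> 0" using Z0[OF \<rho>(1) order_refl] .
  \<comment> \<open>Two averaging errors and two uniform errors enter at the end; each is held to
    e/4 after integration over K.\<close>
  define T where "T = min \<rho> (e / (4 * (Z + 1)))"
  have T: "0 < T" "T \<le> \<rho>" using \<rho> e Z0' by (auto simp: T_def)
  have ZT: "Z * T \<le> e / 4"
  proof -
    have "Z * T \<le> (Z + 1) * (e / (4 * (Z + 1)))" using Z0' T e by (intro mult_mono) (auto simp: T_def)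
    also have "\<dots> = e / 4" using Z0' by (simp add: field_simps)
    finally show ?thesis .
  qed
  have eqm: "moll \<phi> T (f k) x = moll \<phi> T (?f k) x" if "x \<in> K" for k x
    using that T by (intro moll_cong_indicator(2)[OF \<phi>(2)] cone_domain.cone[OF dom[OF T]]) auto
  define M where "M k x = moll \<phi> T (?f k) x" for k x
  have Mb: "norm (M k x) \<le> B0 / T ^ CARD('n) * N" for k x
  proof -
    have "\<bar>M k x\<bar> \<le> B0 / T ^ CARD('n) * (\<integral>x. \<bar>?f k x\<bar> \<partial>lborel)"
      unfolding M_def by (rule moll_bound[OF fi \<phi>(2) B0(2) T(1)])
    also have "\<dots> \<le> B0 / T ^ CARD('n) * N" using fI B0 T by (intro mult_left_mono) auto
    finally show ?thesis by simp
  qed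
  define Lm where "Lm = L / T ^ Suc CARD('n) * N"
  have Lm0: "Lm \<ge> 0" using L T N by (simp add: Lm_def)
  have Mlip: "\<bar>M k x - M k y\<bar> \<le> Lm * norm (x - y)" for k x y
  proof -
    have "\<bar>M k x - M k y\<bar> \<le> L / T ^ Suc CARD('n) * (\<integral>z. \<bar>?f k z\<bar> \<partial>lborel) * norm (x - y)"
      unfolding M_def by (rule moll_lipschitz[OF fi \<phi>(2) L(2) T(1)])
    also have "\<dots> \<le> Lm * norm (x - y)" unfolding Lm_def using fI L T by (intro mult_right_mono mult_left_mono) auto
    finally show ?thesis .
  qed
  obtain G and r :: "nat \<Rightarrow> nat" where r: "strict_mono r" and cv: "\<And>e. 0 < e \<Longrightarrow> \<exists>N. \<forall>n x. n \<ge> N \<and> x \<in> K \<longrightarrow> norm (M (r n) x - G x) < e"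
  proof (rule Arzela_Ascoli[OF K(1), of M "B0 / T ^ CARD('n) * N"])
    show "norm (M n x) \<le> B0 / T ^ CARD('n) * N" for n x by (rule Mb)
    fix x :: "real^'n" and e :: real assume "0 < e"
    show "\<exists>d. 0 < d \<and> (\<forall>n y. y \<in> K \<and> norm (x - y) < d \<longrightarrow> norm (M n x - M n y) < e)"
    proof (intro exI conjI allI impI)
      show "0 < e / (Lm + 1)" using \<open>0 < e\<close> Lm0 by simp
      fix n y assume "y \<in> K \<and> norm (x - y) < e / (Lm + 1)"
      then have "(Lm + 1) * norm (x - y) < e" using Lm0 by (simp add: pos_less_divide_eq mult.commute)
      moreover have "Lm * norm (x - y) \<le> (Lm + 1) * norm (x - y)" by (simp add: algebra_simps)
      ultimately show "norm (M n x - M n y) < e" using Mlip[of n x y] by simp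
    qed
  qed blast
  define mK where "mK = measure lborel K"
  have eK: "emeasure lborel K = ennreal mK" unfolding mK_def
    using emeasure_compact_finite[OF K(1)] by (intro emeasure_eq_ennreal_measure) auto
  define e1 where "e1 = e / (4 * (mK + 1))"
  have e1: "e1 > 0" using e by (simp add: e1_def mK_def add_nonneg_pos)
  have e1K: "e1 * mK \<le> e / 4"
  proof -
    have m0: "mK \<ge> 0" by (simp add: mK_def)
    then have "e1 * mK \<le> e1 * (mK + 1)" using e1 by simp
    also have "\<dots> = e / 4" using m0 by (simp add: e1_def field_simps)
    finally show ?thesis .
  qed
  obtain n0 where n0: "\<And>n x. n \<ge> n0 \<Longrightarrow> x \<in> K \<Longrightarrow> norm (M (r n) x - G x) < e1" using cv[OF e1] by blast
  show ?thesis
  \<comment> \<open>Dropping the initial terms makes the estimate hold for all pairs of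
    indices.\<close>
  proof (intro exI[of _ "\<lambda>n. r (n + n0)"] conjI allI)
    show "strict_mono (\<lambda>n. r (n + n0))" using r by (simp add: strict_mono_def)
    fix i j
    let ?a = "r (i + n0)" and ?b = "r (j + n0)"
    let ?E = "\<lambda>k x. indicator K x * ennreal \<bar>f k x - moll \<phi> T (f k) x\<bar>"
    have "(\<integral>\<^sup>+x. indicator K x * ennreal \<bar>f ?a x - f ?b x\<bar> \<partial>lborel)
      \<le> (\<integral>\<^sup>+x. ?E ?a x + (?E ?b x + ennreal (2 * e1) * indicator K x) \<partial>lborel)"
    proof (rule nn_integral_mono)
      fix x
      show "indicator K x * ennreal \<bar>f ?a x - f ?b x\<bar> \<le> ?E ?a x + (?E ?b x + ennreal (2 * e1) * indicator K x)"
      proof (cases "x \<in> K")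
        case True
        have "\<bar>f ?a x - f ?b x\<bar> \<le> \<bar>f ?a x - moll \<phi> T (f ?a) x\<bar> + (\<bar>f ?b x - moll \<phi> T (f ?b) x\<bar> + 2 * e1)"
          using n0[of "i + n0" x] n0[of "j + n0" x] True eqm[OF True] by (simp add: M_def)
        from ennreal_leI[OF this] show ?thesis using True e1 by (simp add: ennreal_plus)
      qed simp
    qed
    also have "\<dots> = integral\<^sup>N lborel (?E ?a) + (integral\<^sup>N lborel (?E ?b) + ennreal (2 * e1) * ennreal mK)"
      by (subst nn_integral_add, simp, simp)+ (simp add: eK nn_integral_cmult_indicator)
    also have "\<dots> \<le> ennreal (Z * T) + (ennreal (Z * T) + ennreal (2 * e1) * ennreal mK)"
      by (intro add_mono est[OF T] order_refl)
    also have "\<dots> = ennreal (Z * T + (Z * T + 2 * e1 * mK))"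
    proof -
      have "Z * T \<ge> 0" "2 * e1 * mK \<ge> 0" using Z0' T e1 by (auto simp: mK_def)
      moreover have "ennreal (2 * e1) * ennreal mK = ennreal (2 * e1 * mK)"
        using e1 by (simp add: ennreal_mult'[symmetric] mK_def)
      ultimately show ?thesis by (simp only: ennreal_plus add_nonneg_nonneg)
    qed
    also have "\<dots> \<le> ennreal e"
    proof (rule ennreal_leI)
      have "2 * e1 * mK = 2 * (e1 * mK)" by simp
      with ZT e1K show "Z * T + (Z * T + 2 * e1 * mK) \<le> e" by linarith
    qed
    finally show "(\<integral>\<^sup>+x. indicator K x * ennreal \<bar>f ?a x - f ?b x\<bar> \<partial>lborel) \<le> ennreal e" .
  qed
qed

lemma summable_diff_imp_convergent:
  fixes a :: "nat \<Rightarrow> real"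
  assumes "summable (\<lambda>n. a (Suc n) - a n)"
  shows "convergent a"
proof -
  have "(\<lambda>n. \<Sum>i<n. a (Suc i) - a i) \<longlonglongrightarrow> (\<Sum>n. a (Suc n) - a n)" using assms by (rule summable_LIMSEQ)
  then have "(\<lambda>n. a n - a 0) \<longlonglongrightarrow> (\<Sum>n. a (Suc n) - a n)" by (simp add: sum_lessThan_telescope)
  from tendsto_add[OF this tendsto_const[of "a 0"]] show ?thesis by (auto simp: convergent_def)
qed

text \<open>A diagonal sequence over a compact exhaustion, with accuracy 2^-n on the n-th set. On
  each set of the exhaustion the consecutive differences are eventually summable in L1, so their
  absolute values have a finite sum almost everywhere.\<close>

lemma rellich_AE:
  fixes f :: "nat \<Rightarrow> 'n::finite fn"
  assumes \<Omega>: "open \<Omega>" and w: "\<And>k i. wder \<Omega> (f k) i (g k i)"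
    and fN: "\<And>k. (\<integral>\<^sup>+x. ennreal \<bar>indicator \<Omega> x * f k x\<bar> \<partial>lborel) \<le> ennreal N"
    and gN: "\<And>k i. (\<integral>\<^sup>+x. ennreal \<bar>indicator \<Omega> x * g k i x\<bar> \<partial>lborel) \<le> ennreal N"
    and N: "N \<ge> 0"
  shows "\<exists>r::nat\<Rightarrow>nat. strict_mono r \<and> (AE x in lborel. x \<in> \<Omega> \<longrightarrow> convergent (\<lambda>k. f (r k) x))"
proof -
  note [measurable] = wderD(1,2)[OF w]
  obtain K where K: "\<And>n. compact (K n)" "\<And>n. K n \<subseteq> \<Omega>" "\<And>n. K n \<subseteq> interior (K (Suc n))" "\<Union>(range K) = \<Omega>"
    using open_Union_compact_subsets[OF \<Omega>] by metis
  have [measurable]: "K n \<in> sets borel" for n using K by (auto simp: borel_compact)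
  have "K n \<subseteq> K (Suc n)" for n by (rule order_trans[OF K(3) interior_subset])
  then have Kmono: "K m \<subseteq> K n" if "m \<le> n" for m n using lift_Suc_mono_le[of K m n] that by blast
  define P where "P n s \<longleftrightarrow> (\<forall>i j. (\<integral>\<^sup>+x. indicator (K n) x * ennreal \<bar>f (s i) x - f (s j) x\<bar> \<partial>lborel) \<le> ennreal ((1/2)^n))" for n and s :: "nat \<Rightarrow> nat"
  interpret subseqs P
  proof
    fix n and s :: "nat \<Rightarrow> nat" assume "strict_mono s"
    have "\<exists>r::nat\<Rightarrow>nat. strict_mono r \<and> (\<forall>i j. (\<integral>\<^sup>+x. indicator (K n) x * ennreal \<bar>f (s (r i)) x - f (s (r j)) x\<bar> \<partial>lborel) \<le> ennreal ((1/2)^n))"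
      by (rule rellich_total_bound[OF \<Omega> w fN gN N K(1,2)]) simp
    then show "\<exists>r'. strict_mono r' \<and> P n (s \<circ> r')" by (simp add: P_def)
  qed
  have hold: "P k (diagseq \<circ> ((+) (Suc k)))" for k
    by (rule diagseq_holds) (simp add: P_def)
  \<comment> \<open>\<open>diagseq\<close> meets requirement n from index n + 1 on, hence the
    shift.\<close>
  define d where "d n = diagseq (Suc n)" for n
  have dm: "strict_mono d" using subseq_diagseq by (simp add: strict_mono_def d_def)
  have fast: "(\<integral>\<^sup>+x. indicator (K m) x * ennreal \<bar>f (d (Suc n)) x - f (d n) x\<bar> \<partial>lborel) \<le> ennreal ((1/2)^n)" if "m \<le> n" for m n
  proof -
    have "(\<integral>\<^sup>+x. indicator (K m) x * ennreal \<bar>f (d (Suc n)) x - f (d n) x\<bar> \<partial>lborel)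
      \<le> (\<integral>\<^sup>+x. indicator (K n) x * ennreal \<bar>f (d (Suc n)) x - f (d n) x\<bar> \<partial>lborel)"
      using Kmono[OF that] by (intro nn_integral_mono mult_right_mono) (auto simp: indicator_def)
    also have "\<dots> \<le> ennreal ((1/2)^n)"
      using iffD1[OF P_def hold[of n], rule_format, of 1 0] by (simp add: d_def)
    finally show ?thesis .
  qed
  have "AE x in lborel. x \<in> K m \<longrightarrow> convergent (\<lambda>k. f (d k) x)" for m
  proof -
    \<comment> \<open>\<open>fast\<close> is available on K m for indices from m on; the series
      starts there.\<close>
    let ?X = "\<lambda>n x. indicator (K m) x * ennreal \<bar>f (d (Suc (n + m))) x - f (d (n + m)) x\<bar>"
    have "(\<integral>\<^sup>+x. (\<Sum>n. ?X n x) \<partial>lborel) = (\<Sum>n. \<integral>\<^sup>+x. ?X n x \<partial>lborel)" by (rule nn_integral_suminf) simp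
    also have "\<dots> \<le> (\<Sum>n. ennreal ((1/2)^n))"
    proof (rule suminf_le)
      fix n
      have "(\<integral>\<^sup>+x. ?X n x \<partial>lborel) \<le> ennreal ((1/2)^(n+m))" by (rule fast) simp
      also have "\<dots> \<le> ennreal ((1/2)^n)" by (intro ennreal_leI power_decreasing) auto
      finally show "(\<integral>\<^sup>+x. ?X n x \<partial>lborel) \<le> ennreal ((1/2)^n)" .
    qed auto
    also have "\<dots> = ennreal (\<Sum>n. (1/2)^n)" by (rule suminf_ennreal2) (auto intro: summable_geometric)
    finally have "(\<integral>\<^sup>+x. (\<Sum>n. ?X n x) \<partial>lborel) \<noteq> \<infinity>" by (metis ennreal_neq_top infinity_ennreal_def neq_top_trans)
    then have "AE x in lborel. (\<Sum>n. ?X n x) \<noteq> \<infinity>" by (intro nn_integral_noteq_infinite) auto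
    then show ?thesis
    proof eventually_elim
      case (elim x)
      show ?case
      proof
        assume "x \<in> K m"
        with elim have "(\<Sum>n. ennreal \<bar>f (d (Suc (n + m))) x - f (d (n + m)) x\<bar>) \<noteq> top" by simp
        then have "summable (\<lambda>n. \<bar>f (d (Suc (n + m))) x - f (d (n + m)) x\<bar>)"
          by (intro summable_suminf_not_top) auto
        then have "summable (\<lambda>n. f (d (Suc n + m)) x - f (d (n + m)) x)"
          unfolding add_Suc by (rule summable_rabs_cancel)
        then have "convergent (\<lambda>n. f (d (n + m)) x)" by (rule summable_diff_imp_convergent)
        then show "convergent (\<lambda>k. f (d k) x)" 
          using convergent_ignore_initial_segment[where f="\<lambda>k. f (d k) x" and m=m] by simp
      qed
    qed
  qed
  then have "AE x in lborel. \<forall>m. x \<in> K m \<longrightarrow> convergent (\<lambda>k. f (d k) x)" unfolding AE_all_countable by blast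
  then have "AE x in lborel. x \<in> \<Omega> \<longrightarrow> convergent (\<lambda>k. f (d k) x)"
    by eventually_elim (use K(4) in blast)
  with dm show ?thesis by blast
qed

section \<open>Lipschitz cones and local exponents\<close>

text \<open>Descending by t along e lowers the height by t. A sideways error of at most d t gives
  back at most d t of height, and the graph drops by at most L d t. With d + L d = 1/2 a margin of
  t/2 remains, so the point stays below the graph. At interior points a ball takes the place of the
  cone.\<close>

lemma lipschitz_cone:
  fixes \<Omega> :: "(real^'n::finite) set"
  assumes dom: "bounded_lipschitz_domain \<Omega>" and x0: "x0 \<in> closure \<Omega>" and \<rho>: "\<rho> > 0"
  shows "\<exists>r c d T. r > 0 \<and> r \<le> \<rho> \<and> d > 0 \<and> T > 0 \<and>
    (\<forall>x t. x \<in> \<Omega> \<inter> ball x0 r \<longrightarrow> 0 < t \<longrightarrow> t \<le> T \<longrightarrow> (\<lambda>z. x + t *\<^sub>R z) ` cball c d \<subseteq> \<Omega> \<inter> ball x0 \<rho>)"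
proof (cases "x0 \<in> \<Omega>")
  case True
  have "open \<Omega>" using dom by (simp add: bounded_lipschitz_domain_def)
  then obtain r0 where r0: "r0 > 0" "ball x0 r0 \<subseteq> \<Omega>" using True open_contains_ball by blast
  define R where "R = min r0 \<rho>"
  have R: "R > 0" "R \<le> r0" "R \<le> \<rho>" using r0 \<rho> by (auto simp: R_def)
  show ?thesis
  \<comment> \<open>At an interior point the support is the full unit ball around 0.\<close>
  proof (rule exI[of _ "R/2"], rule exI[of _ 0], rule exI[of _ 1], rule exI[of _ "R/2"], intro conjI allI impI)
    fix x t assume x: "x \<in> \<Omega> \<inter> ball x0 (R/2)" and t: "0 < t" "t \<le> R/2"
    show "(\<lambda>z. x + t *\<^sub>R z) ` cball 0 1 \<subseteq> \<Omega> \<inter> ball x0 \<rho>"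
    proof
      fix y assume "y \<in> (\<lambda>z. x + t *\<^sub>R z) ` cball 0 1"
      then show "y \<in> \<Omega> \<inter> ball x0 \<rho>"
      proof (rule imageE)
        fix z assume z: "y = x + t *\<^sub>R z" "z \<in> cball 0 1"
        have "t * norm z \<le> R/2 * 1" using z t by (intro mult_mono) auto
        then have "dist x y \<le> R/2" using z t by (simp add: dist_norm)
        then have "dist x0 y < R" using x dist_triangle[of x0 y x] by auto
        then show "y \<in> \<Omega> \<inter> ball x0 \<rho>" using subsetD[OF r0(2), of y] R by simp
      qed
    qed
  qed (use R in auto)
next
  case False
  have "open \<Omega>" using dom by (simp add: bounded_lipschitz_domain_def)
  then have "x0 \<in> frontier \<Omega>" using False x0 by (simp add: frontier_def interior_open)
  moreover have "lipschitz_boundary \<Omega>" using dom by (simp add: bounded_lipschitz_domain_def)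
  ultimately have "\<exists>r>0. \<exists>e::real^'n. \<exists>g::'n fn. \<exists>L.
        norm e = 1 \<and> L-lipschitz_on UNIV g \<and> (\<forall>y t. g (y + t *\<^sub>R e) = g y) \<and>
        \<Omega> \<inter> ball x0 r = {x \<in> ball x0 r. x \<bullet> e < g x}"
    unfolding lipschitz_boundary_def by (rule bspec[rotated])
  then obtain r0 and e :: "real^'n" and g :: "'n fn" and L where r0: "r0 > 0" and e: "norm e = 1" and L: "L-lipschitz_on UNIV g"
    and inv: "\<forall>y t. g (y + t *\<^sub>R e) = g y" and eq: "\<Omega> \<inter> ball x0 r0 = {x \<in> ball x0 r0. x \<bullet> e < g x}"
    by (elim exE conjE) (rule that)
  have L0: "L \<ge> 0" using L by (rule lipschitz_on_nonneg)
  define R where "R = min r0 \<rho>"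
  have R: "R > 0" "R \<le> r0" "R \<le> \<rho>" using r0 \<rho> by (auto simp: R_def)
  define d where "d = 1 / (2 * (1 + L))"
  have "d + L * d = (1 + L) * d" by (simp add: distrib_right)
  also have "\<dots> = 1/2" using L0 unfolding d_def by simp
  finally have d: "d > 0" "d \<le> 1" "d + L * d = 1/2" using L0 by (simp_all add: d_def)
  show ?thesis
  \<comment> \<open>Points of the support have norm at most 2, so scales up to R/8 move x by at most
    R/4 and the result stays in the ball of radius R.\<close>
  proof (rule exI[of _ "R/2"], rule exI[of _ "- e"], rule exI[of _ d], rule exI[of _ "R/8"], intro conjI allI impI)
    fix x t assume x: "x \<in> \<Omega> \<inter> ball x0 (R/2)" and t: "0 < t" "t \<le> R/8"
    show "(\<lambda>z. x + t *\<^sub>R z) ` cball (- e) d \<subseteq> \<Omega> \<inter> ball x0 \<rho>"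
    proof
      fix y assume "y \<in> (\<lambda>z. x + t *\<^sub>R z) ` cball (- e) d"
      then show "y \<in> \<Omega> \<inter> ball x0 \<rho>"
      proof (rule imageE)
        fix z assume z: "y = x + t *\<^sub>R z" "z \<in> cball (- e) d"
        define w where "w = z + e"
        have "- e - z = - w" by (simp add: w_def)
        then have w: "norm w \<le> d" using z(2) by (simp add: dist_norm)
        have zw: "z = w - e" by (simp add: w_def)
        have "norm z \<le> 2" using norm_triangle_ineq4[of w e] w e d unfolding zw by linarith
        then have "t * norm z \<le> R/8 * 2" using t by (intro mult_mono) auto
        then have "dist x y \<le> R/4" using z t by (simp add: dist_norm)
        then have y: "dist x0 y < R" using x dist_triangle[of x0 y x] R by auto
        have "x \<in> \<Omega> \<inter> ball x0 r0" using x R by simp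
        then have xg: "x \<bullet> e < g x" unfolding eq by simp
        have "y \<bullet> e = x \<bullet> e + t * (w \<bullet> e) - t"
          using e by (simp add: z(1) zw inner_add_left inner_diff_left dot_square_norm algebra_simps)
        moreover have "w \<bullet> e \<le> d" using norm_cauchy_schwarz[of w e] w e by simp
        ultimately have ye: "y \<bullet> e \<le> x \<bullet> e + t * d - t" using t by (simp add: mult_left_mono)
        \<comment> \<open>g is invariant along e, so the descent drops out and only the sideways
          error w enters the Lipschitz estimate.\<close>
        have "g y = g ((x + t *\<^sub>R w) + (- t) *\<^sub>R e)" by (simp add: z(1) zw algebra_simps)
        then have "g y = g (x + t *\<^sub>R w)" by (simp only: inv[rule_format])
        moreover have "dist (g (x + t *\<^sub>R w)) (g x) \<le> L * dist (x + t *\<^sub>R w) x"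
          using L by (rule lipschitz_onD) auto
        moreover have "L * dist (x + t *\<^sub>R w) x \<le> L * (t * d)"
          using L0 w t by (intro mult_left_mono) (simp_all add: dist_norm mult_left_mono)
        ultimately have gy: "g y \<ge> g x - L * (t * d)" by (simp add: dist_real_def abs_le_iff)
        have "t * d + L * (t * d) = t * (d + L * d)" by (simp add: algebra_simps)
        then have "t * d + L * (t * d) = t / 2" unfolding d(3) by simp
        then have "y \<bullet> e < g y" using ye gy xg t by linarith
        then have "y \<in> \<Omega> \<inter> ball x0 r0" unfolding eq using y R by simp
        then show "y \<in> \<Omega> \<inter> ball x0 \<rho>" using y R by simp
      qed
    qed
  qed (use R d in auto)
qed

text \<open>At x0 itself, with b = \<beta> and s = \<gamma>/\<beta>, any q slightly below the
  Sobolev exponent of b satisfies all requirements strictly; continuity then allows lowering b and s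
  a little so that they bound the variable exponents from below near x0. The guard with P is there
  because p is bounded only almost everywhere.\<close>

lemma local_exponents:
  fixes \<Omega> :: "(real^'n::finite) set" and \<gamma> \<beta> p :: "'n fn" and P \<epsilon> :: real
  assumes gamma: "continuous_on (closure \<Omega>) \<gamma>" "\<forall>x\<in>\<Omega>. 1 \<le> \<gamma> x"
    and beta: "continuous_on (closure \<Omega>) \<beta>" "\<forall>x\<in>\<Omega>. 1 \<le> \<beta> x \<and> \<beta> x < real CARD('n)"
    and eps: "\<epsilon> > 0"
    and pcrit: "\<forall>x\<in>\<Omega>. p x + \<epsilon> < real CARD('n) * (\<gamma> x + \<beta> x) / (real CARD('n) - \<beta> x)"
    and x0: "x0 \<in> closure \<Omega>"
  obtains \<rho> s b q where "\<rho> > 0" "s > 0" "b \<ge> 1" "q \<ge> b" "real CARD('n) / b - real CARD('n) / q < 1"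
    "\<And>x. x \<in> \<Omega> \<inter> ball x0 \<rho> \<Longrightarrow> s \<le> \<gamma> x / \<beta> x \<and> b \<le> \<beta> x \<and> (p x \<le> P \<longrightarrow> p x + \<epsilon>/2 \<le> (s + 1) * q)"
proof -
  let ?n = "real CARD('n)"
  have g0: "1 \<le> \<gamma> x0" by (rule continuous_ge_on_closure[OF gamma(1) x0]) (use gamma(2) in auto)
  have b0: "1 \<le> \<beta> x0" by (rule continuous_ge_on_closure[OF beta(1) x0]) (use beta(2) in auto)
  have bn: "\<beta> x0 \<le> ?n" by (rule continuous_le_on_closure[OF beta(1) x0]) (use beta(2) in \<open>auto intro: less_imp_le\<close>)
  have tg: "(\<gamma> \<longlongrightarrow> \<gamma> x0) (at x0 within \<Omega>)" and tb: "(\<beta> \<longlongrightarrow> \<beta> x0) (at x0 within \<Omega>)"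
    by (rule tendsto_within_subset[OF _ closure_subset], use gamma(1) beta(1) x0 in \<open>simp add: continuous_on_def\<close>)+
  define a0 where "a0 = \<gamma> x0 / \<beta> x0"
  have a0: "a0 > 0" using g0 b0 by (simp add: a0_def)
  \<comment> \<open>Limits at x0 leave out x0 itself, which may belong to \<Omega>; the point is
    added here.\<close>
  have ev_self: "eventually Q (at x0 within \<Omega>) \<Longrightarrow> (x0 \<in> \<Omega> \<Longrightarrow> Q x0) \<Longrightarrow> \<exists>\<rho>>0. \<forall>x\<in>\<Omega> \<inter> ball x0 \<rho>. Q x" for Q
  proof -
    assume "eventually Q (at x0 within \<Omega>)" and Q0: "x0 \<in> \<Omega> \<Longrightarrow> Q x0"
    then obtain \<rho> where \<rho>: "\<rho> > 0" "\<forall>x\<in>\<Omega>. x \<noteq> x0 \<and> dist x x0 < \<rho> \<longrightarrow> Q x" unfolding eventually_at by blast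
    then have "Q x" if "x \<in> \<Omega> \<inter> ball x0 \<rho>" for x
      using that Q0 by (cases "x = x0") (auto simp: dist_commute)
    with \<rho>(1) show ?thesis by blast
  qed
  have "\<exists>q m. q \<ge> \<beta> x0 \<and> ?n / \<beta> x0 - ?n / q < 1 \<and> (a0 + 1) * q > m \<and>
      (\<exists>\<rho>>0. \<forall>x\<in>\<Omega> \<inter> ball x0 \<rho>. p x \<le> P \<longrightarrow> p x + \<epsilon>/2 \<le> m)"
  proof (cases "\<beta> x0 < ?n")
    case True
    define qs where "qs = ?n * \<beta> x0 / (?n - \<beta> x0)"
    define crit where "crit x = ?n * (\<gamma> x + \<beta> x) / (?n - \<beta> x)" for x
    have c0: "crit x0 = (a0 + 1) * qs" using b0 True by (simp add: crit_def qs_def a0_def field_simps)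
    \<comment> \<open>Just below the Sobolev exponent \<open>qs\<close>: the loss multiplied by a0 +
      1 is at most \<epsilon>/8. The maximum keeps q at least \<beta> x0.\<close>
    define q where "q = max (\<beta> x0) (qs - \<epsilon> / (8 * (a0 + 1)))"
    have qsb: "qs > \<beta> x0" using b0 True by (simp add: qs_def pos_less_divide_eq)
    have q: "q \<ge> \<beta> x0" "q < qs" "q > 0" using qsb eps a0 b0 by (auto simp: q_def)
    have "?n / qs < ?n / q" using q by (intro divide_strict_left_mono) auto
    moreover have "?n / qs = ?n / \<beta> x0 - 1" using b0 True by (simp add: qs_def field_simps)
    ultimately have sub: "?n / \<beta> x0 - ?n / q < 1" by simp
    have "(a0 + 1) * q \<ge> (a0 + 1) * (qs - \<epsilon> / (8 * (a0 + 1)))" using a0 by (intro mult_left_mono) (auto simp: q_def)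
    also have "(a0 + 1) * (qs - \<epsilon> / (8 * (a0 + 1))) = crit x0 - \<epsilon>/8" unfolding c0 using a0 by (simp add: field_simps)
    finally have m: "(a0 + 1) * q > crit x0 - \<epsilon>/4" using eps by simp
    have "(crit \<longlongrightarrow> crit x0) (at x0 within \<Omega>)" unfolding crit_def
      by (intro tendsto_intros tg tb) (use True in auto)
    then have "eventually (\<lambda>x. crit x < crit x0 + \<epsilon>/4) (at x0 within \<Omega>)"
      by (rule order_tendstoD) (use eps in simp)
    then obtain \<rho> where \<rho>: "\<rho> > 0" "\<forall>x\<in>\<Omega> \<inter> ball x0 \<rho>. crit x < crit x0 + \<epsilon>/4"
      using ev_self[of "\<lambda>x. crit x < crit x0 + \<epsilon>/4"] eps by auto
    have "p x + \<epsilon>/2 \<le> crit x0 - \<epsilon>/4" if "x \<in> \<Omega> \<inter> ball x0 \<rho>" for x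
      using \<rho>(2)[rule_format, OF that] pcrit that by (auto simp: crit_def)
    then have "\<exists>\<rho>>0. \<forall>x\<in>\<Omega> \<inter> ball x0 \<rho>. p x \<le> P \<longrightarrow> p x + \<epsilon>/2 \<le> crit x0 - \<epsilon>/4" using \<rho>(1) by blast
    then show ?thesis using q(1) sub m
      by - (rule exI[of _ q], rule exI[of _ "crit x0 - \<epsilon>/4"], intro conjI)
  next
    case False
    then have bn': "\<beta> x0 = ?n" using bn by simp
    \<comment> \<open>The limiting case \<beta> x0 = n: subcriticality reads 1 - n/q < 1 and holds
      for every q, so q is taken large in terms of P.\<close>
    define q where "q = max ?n (P + \<epsilon>) + 1"
    have q: "q \<ge> ?n" "q > P + \<epsilon>" "q > 0" by (auto simp: q_def)
    have "q \<le> (a0 + 1) * q" using a0 q by (simp add: algebra_simps)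
    then have "(a0 + 1) * q > P + \<epsilon>/2" using q eps by linarith
    moreover have "?n / \<beta> x0 - ?n / q < 1" using q unfolding bn' by simp
    moreover have "\<exists>\<rho>>0. \<forall>x\<in>\<Omega> \<inter> ball x0 \<rho>. p x \<le> P \<longrightarrow> p x + \<epsilon>/2 \<le> P + \<epsilon>/2"
      by (rule exI[of _ 1]) simp
    moreover have "q \<ge> \<beta> x0" using q bn' by simp
    ultimately show ?thesis by - (rule exI[of _ q], rule exI[of _ "P + \<epsilon>/2"], intro conjI)
  qed
  then obtain q m \<rho>1 where q: "q \<ge> \<beta> x0" "?n / \<beta> x0 - ?n / q < 1" "(a0 + 1) * q > m"
    and \<rho>1: "\<rho>1 > 0" "\<forall>x\<in>\<Omega> \<inter> ball x0 \<rho>1. p x \<le> P \<longrightarrow> p x + \<epsilon>/2 \<le> m"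
    by (elim exE conjE) (rule that)
  \<comment> \<open>The inequalities are strict at \<delta> = 0, so they persist when both exponents
    are lowered by a small \<delta> > 0; the maximum with 1 keeps b at least 1.\<close>
  have t1: "((\<lambda>\<delta>. ?n / max 1 (\<beta> x0 - \<delta>) - ?n / q) \<longlongrightarrow> ?n / max 1 (\<beta> x0 - 0) - ?n / q) (at_right 0)"
    by (intro tendsto_intros) auto
  have t2: "((\<lambda>\<delta>. (a0 - \<delta> + 1) * q) \<longlongrightarrow> (a0 - 0 + 1) * q) (at_right 0)" by (intro tendsto_intros)
  have t3: "((\<lambda>\<delta>. a0 - \<delta>) \<longlongrightarrow> a0 - 0) (at_right 0)" by (intro tendsto_intros)
  have "eventually (\<lambda>\<delta>. ?n / max 1 (\<beta> x0 - \<delta>) - ?n / q < 1) (at_right 0)"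
    by (rule order_tendstoD(2)[OF t1]) (use q(2) b0 in \<open>simp add: max_def\<close>)
  moreover have "eventually (\<lambda>\<delta>. (a0 - \<delta> + 1) * q > m) (at_right 0)"
    by (rule order_tendstoD(1)[OF t2]) (use q(3) in simp)
  moreover have "eventually (\<lambda>\<delta>. a0 - \<delta> > 0) (at_right 0)"
    by (rule order_tendstoD(1)[OF t3]) (use a0 in simp)
  moreover have "eventually (\<lambda>\<delta>::real. \<delta> > 0) (at_right 0)" by (simp add: eventually_at_right_less)
  ultimately have "eventually (\<lambda>\<delta>. ?n / max 1 (\<beta> x0 - \<delta>) - ?n / q < 1 \<and> (a0 - \<delta> + 1) * q > m \<and> a0 - \<delta> > 0 \<and> \<delta> > 0) (at_right 0)"
    by eventually_elim auto
  then obtain \<delta> where \<delta>: "?n / max 1 (\<beta> x0 - \<delta>) - ?n / q < 1" "(a0 - \<delta> + 1) * q > m" "a0 - \<delta> > 0" "\<delta> > 0"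
    using eventually_happens'[OF trivial_limit_at_right_real] by blast
  have "eventually (\<lambda>x. \<beta> x > \<beta> x0 - \<delta>) (at x0 within \<Omega>)" by (rule order_tendstoD(1)[OF tb]) (use \<delta> in simp)
  then obtain \<rho>2 where \<rho>2: "\<rho>2 > 0" "\<forall>x\<in>\<Omega> \<inter> ball x0 \<rho>2. \<beta> x > \<beta> x0 - \<delta>"
    using ev_self[of "\<lambda>x. \<beta> x > \<beta> x0 - \<delta>"] \<delta> by auto
  have "((\<lambda>x. \<gamma> x / \<beta> x) \<longlongrightarrow> a0) (at x0 within \<Omega>)" unfolding a0_def
    by (intro tendsto_intros tg tb) (use b0 in auto)
  then have "eventually (\<lambda>x. \<gamma> x / \<beta> x > a0 - \<delta>) (at x0 within \<Omega>)" by (rule order_tendstoD(1)) (use \<delta> in simp)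
  then obtain \<rho>3 where \<rho>3: "\<rho>3 > 0" "\<forall>x\<in>\<Omega> \<inter> ball x0 \<rho>3. \<gamma> x / \<beta> x > a0 - \<delta>"
    using ev_self[of "\<lambda>x. \<gamma> x / \<beta> x > a0 - \<delta>"] \<delta> by (auto simp: a0_def)
  show ?thesis
  proof (rule that[of "min \<rho>1 (min \<rho>2 \<rho>3)" "a0 - \<delta>" "max 1 (\<beta> x0 - \<delta>)" q])
    show "max 1 (\<beta> x0 - \<delta>) \<le> q" using q(1) b0 \<delta> by auto
    fix x assume x: "x \<in> \<Omega> \<inter> ball x0 (min \<rho>1 (min \<rho>2 \<rho>3))"
    then have "x \<in> \<Omega> \<inter> ball x0 \<rho>1" "x \<in> \<Omega> \<inter> ball x0 \<rho>2" "x \<in> \<Omega> \<inter> ball x0 \<rho>3" by auto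
    then have "p x \<le> P \<Longrightarrow> p x + \<epsilon>/2 \<le> m" "\<beta> x > \<beta> x0 - \<delta>" "\<gamma> x / \<beta> x > a0 - \<delta>" "\<beta> x \<ge> 1"
      using bspec[OF \<rho>1(2), of x] bspec[OF \<rho>2(2), of x] bspec[OF \<rho>3(2), of x] beta(2) by blast+
    then show "a0 - \<delta> \<le> \<gamma> x / \<beta> x \<and> max 1 (\<beta> x0 - \<delta>) \<le> \<beta> x \<and> (p x \<le> P \<longrightarrow> p x + \<epsilon>/2 \<le> (a0 - \<delta> + 1) * q)"
      using \<delta>(2) by linarith
  qed (use \<rho>1 \<rho>2 \<rho>3 \<delta> in auto)
qed

section \<open>Borel representatives of functions and their weak derivatives\<close>

lemma locally_integrable_measurable:
  fixes \<Omega> :: "(real^'n::finite) set"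
  assumes \<Omega>: "open \<Omega>" and g: "locally_integrable \<Omega> g"
  shows "(\<lambda>x. indicator \<Omega> x * g x) \<in> borel_measurable lebesgue"
proof -
  \<comment> \<open>g is arbitrary outside \<Omega> and integrable only on compact subsets;
    measurability comes from a pointwise limit over an exhaustion.\<close>
  obtain K where K: "\<And>n. compact (K n)" "\<And>n. K n \<subseteq> \<Omega>" "\<And>n. K n \<subseteq> interior (K (Suc n))" "\<Union>(range K) = \<Omega>"
    using open_Union_compact_subsets[OF \<Omega>] by metis
  have "K n \<subseteq> K (Suc n)" for n by (rule order_trans[OF K(3) interior_subset])
  then have Kmono: "K m \<subseteq> K n" if "m \<le> n" for m n using lift_Suc_mono_le[of K m n] that by blast
  show ?thesis
  proof (rule borel_measurable_LIMSEQ_real)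
    show "(\<lambda>x. indicator (K n) x * g x) \<in> borel_measurable lebesgue" for n
      using g K unfolding locally_integrable_def set_integrable_def by (auto dest!: borel_measurable_integrable)
    fix x :: "real^'n"
    show "(\<lambda>n. indicator (K n) x * g x) \<longlonglongrightarrow> indicator \<Omega> x * g x"
    proof (cases "x \<in> \<Omega>")
      case True
      then obtain m where "x \<in> K m" using K(4) by blast
      then have "eventually (\<lambda>n. indicator (K n) x * g x = indicator \<Omega> x * g x) sequentially"
        using Kmono True by (intro eventually_sequentiallyI[of m]) (auto simp: indicator_def)
      then show ?thesis by (rule tendsto_eventually)
    next
      case False
      then have "indicator (K n) x = (0::real)" for n
        using K(2)[of n] by (auto simp: indicator_def)
      then show ?thesis using False by simp
    qed
  qed
qed

text \<open>Local integrals and integrals against test functions are insensitive to null sets, and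
  the representatives vanish almost everywhere outside \<Omega>, so integrals over \<Omega> become
  integrals over the whole space.\<close>

lemma weak_partial_imp_wder:
  fixes \<Omega> :: "(real^'n::finite) set"
  assumes \<Omega>: "open \<Omega>" and w: "weak_partial \<Omega> u i g"
    and [measurable]: "v \<in> borel_measurable borel" "h \<in> borel_measurable borel"
    and vu: "AE x in lborel. indicator \<Omega> x * u x = v x" and hg: "AE x in lborel. indicator \<Omega> x * g x = h x"
  shows "wder \<Omega> v i h"
proof -
  have li: "locally_integrable \<Omega> u" "locally_integrable \<Omega> g" using w by (auto simp: weak_partial_def)
  note mu[measurable] = locally_integrable_measurable[OF \<Omega> li(1)] and mg[measurable] = locally_integrable_measurable[OF \<Omega> li(2)]
  have [measurable]: "\<Omega> \<in> sets borel" using \<Omega> by auto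
  have ae: "AE x in lebesgue. indicator \<Omega> x * u x = v x" "AE x in lebesgue. indicator \<Omega> x * g x = h x"
    using vu hg by (auto intro: AE_completion)
  have loc: "set_integrable lborel K b" if "locally_integrable \<Omega> a" "AE x in lebesgue. indicator \<Omega> x * a x = b x"
    and [measurable]: "b \<in> borel_measurable borel" and K: "compact K" "K \<subseteq> \<Omega>" for a b :: "'n fn" and K
  proof -
    have [measurable]: "K \<in> sets borel" using K by (simp add: borel_compact)
    have "integrable lebesgue (\<lambda>x. indicator K x *\<^sub>R a x)" using that by (auto simp: locally_integrable_def set_integrable_def)
    moreover have "AE x in lebesgue. indicator K x *\<^sub>R a x = indicator K x *\<^sub>R b x"
      using that(2) by eventually_elim (use K in \<open>auto simp: indicator_def split: if_splits\<close>)
    moreover have mb: "(\<lambda>x. indicator K x *\<^sub>R b x) \<in> borel_measurable lborel" by measurable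
    ultimately have "integrable lebesgue (\<lambda>x. indicator K x *\<^sub>R b x)"
      by (subst integrable_cong_AE[symmetric]) (auto dest: borel_measurable_integrable intro: measurable_completion)
    then show ?thesis unfolding set_integrable_def using integrable_completion[OF mb] by blast
  qed
  have tst: "(\<integral>x. v x * partial i \<zeta> x \<partial>lborel) = - (\<integral>x. h x * \<zeta> x \<partial>lborel)" if \<zeta>: "test_fun \<Omega> \<zeta>" for \<zeta>
  proof -
    obtain S R where S: "compact S" "S \<subseteq> \<Omega>" and zS: "\<And>x. x \<notin> S \<Longrightarrow> \<zeta> x = 0" "\<And>i x. x \<notin> S \<Longrightarrow> partial i \<zeta> x = 0"
      and k: "kern 0 R \<zeta>" "kern 0 R (partial i \<zeta>)" using test_fun_kern[OF \<zeta>] by metis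
    note [measurable] = kernD(3)[OF k(1)] kernD(3)[OF k(2)]
    have conv: "(LINT x:\<Omega>|lebesgue. a x * c x) = (\<integral>x. b x * c x \<partial>lborel)"
      if ab: "AE x in lebesgue. indicator \<Omega> x * a x = b x" and [measurable]: "(\<lambda>x. indicator \<Omega> x * a x) \<in> borel_measurable lebesgue"
        "b \<in> borel_measurable borel" "c \<in> borel_measurable borel" for a b c :: "'n fn"
    proof -
      have mc: "c \<in> borel_measurable lebesgue" "b \<in> borel_measurable lebesgue" by (simp_all add: measurable_completion)
      have "(LINT x:\<Omega>|lebesgue. a x * c x) = (\<integral>x. (indicator \<Omega> x * a x) * c x \<partial>lebesgue)"
        by (simp add: set_lebesgue_integral_def mult.assoc)
      also have "\<dots> = (\<integral>x. b x * c x \<partial>lebesgue)"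
        by (rule integral_cong_AE) (use ab mc that(2) in \<open>auto elim: eventually_mono\<close>)
      also have "\<dots> = (\<integral>x. b x * c x \<partial>lborel)" by (rule integral_completion) measurable
      finally show ?thesis .
    qed
    have "(LINT x:\<Omega>|lebesgue. u x * partial i \<zeta> x) = - (LINT x:\<Omega>|lebesgue. g x * \<zeta> x)"
      using w \<zeta> by (auto simp: weak_partial_def)
    then show ?thesis using conv[OF ae(1) mu, of "partial i \<zeta>"] conv[OF ae(2) mg, of \<zeta>] by simp
  qed
  show ?thesis unfolding wder_def
    using loc[OF li(1) ae(1)] loc[OF li(2) ae(2)] tst by simp
qed

text \<open>\<open>Dw\<close> is a choice, and the existence of some weak derivative makes it a
  genuine one. There are only finitely many exceptional null sets, so one null set serves u and all
  its derivatives.\<close>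

lemma borel_representative:
  fixes \<Omega> :: "(real^'n::finite) set"
  assumes \<Omega>: "open \<Omega>" and u: "has_weak_partials \<Omega> u"
  obtains v h where "\<And>i. wder \<Omega> v i (h i)"
    "AE x in lebesgue. x \<in> \<Omega> \<longrightarrow> v x = u x \<and> (\<forall>i. h i x = Dw \<Omega> i u x)"
proof -
  have D: "weak_partial \<Omega> u i (Dw \<Omega> i u)" for i
  proof -
    have "\<exists>g. weak_partial \<Omega> u i g" using u by (simp add: has_weak_partials_def)
    then show ?thesis unfolding Dw_def by (rule someI_ex)
  qed
  have li: "locally_integrable \<Omega> u" "locally_integrable \<Omega> (Dw \<Omega> i u)" for i using D by (auto simp: weak_partial_def)
  obtain v where v: "v \<in> borel_measurable lborel" "AE x in lborel. indicator \<Omega> x * u x = v x"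
    using completion_ex_borel_measurable_real[OF locally_integrable_measurable[OF \<Omega> li(1)]] by blast
  have "\<forall>i. \<exists>h\<in>borel_measurable lborel. AE x in lborel. indicator \<Omega> x * Dw \<Omega> i u x = h x"
    using completion_ex_borel_measurable_real[OF locally_integrable_measurable[OF \<Omega> li(2)]] by blast
  then obtain h where h: "\<And>i. h i \<in> borel_measurable lborel" "\<And>i. AE x in lborel. indicator \<Omega> x * Dw \<Omega> i u x = h i x"
    by metis
  have "wder \<Omega> v i (h i)" for i
    by (rule weak_partial_imp_wder[OF \<Omega> D]) (use v h in auto)
  moreover have "AE x in lborel. \<forall>i. indicator \<Omega> x * Dw \<Omega> i u x = h i x"
    using h(2) by (intro eventually_all_finite) auto
  with v(2) have "AE x in lborel. x \<in> \<Omega> \<longrightarrow> v x = u x \<and> (\<forall>i. h i x = Dw \<Omega> i u x)"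
    by eventually_elim (auto simp: indicator_def)
  ultimately show ?thesis by (intro that[of v h]) (auto intro: AE_completion)
qed

section \<open>Vitali convergence\<close>

text \<open>The surplus \<eta> in the exponent gives uniform integrability: above a level M the
  integral of |d k|^p is at most M^-\<eta> K'. Below the level dominated convergence applies, the
  measure being finite. Convergence of the modular is then converted into convergence of the
  norm.\<close>

lemma vitali_lux_norm:
  fixes \<Omega> :: "(real^'n::finite) set" and u :: "nat \<Rightarrow> 'n fn"
  assumes \<Omega>: "\<Omega> \<in> sets lebesgue" "emeasure lebesgue \<Omega> < \<infinity>" and p: "M0 \<Omega> p" and \<eta>: "\<eta> > 0" and K: "K \<ge> 0"
    and u: "\<And>k. u k \<in> borel_measurable (restrict_space lebesgue \<Omega>)"
    and bd: "\<And>k. (\<integral>\<^sup>+x\<in>\<Omega>. ennreal (\<bar>u k x\<bar> powr (p x + \<eta>)) \<partial>lebesgue) \<le> ennreal K"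
    and conv: "AE x in lebesgue. x \<in> \<Omega> \<longrightarrow> convergent (\<lambda>k. u k x)"
  shows "\<exists>v. v \<in> Lpx \<Omega> p \<and> (\<lambda>k. lux_norm \<Omega> p (\<lambda>x. u k x - v x)) \<longlonglongrightarrow> 0"
proof -
  define L where "L = restrict_space lebesgue \<Omega>"
  have \<Omega>s: "\<Omega> \<inter> space lebesgue \<in> sets lebesgue" using \<Omega> by simp
  have nnL: "(\<integral>\<^sup>+x\<in>\<Omega>. f x \<partial>lebesgue) = (\<integral>\<^sup>+x. f x \<partial>L)" for f
    unfolding L_def nn_integral_restrict_space[OF \<Omega>s] by simp
  have aeL: "(AE x in L. Q x) \<longleftrightarrow> (AE x in lebesgue. x \<in> \<Omega> \<longrightarrow> Q x)" for Q
    unfolding L_def AE_restrict_space_iff[OF \<Omega>s] by simp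
  have pm[measurable]: "p \<in> borel_measurable L" using p by (simp add: M0_def L_def)
  obtain P where P0: "AE x in L. 1 \<le> p x \<and> p x \<le> P" using p unfolding M0_def aeL by blast
  define P1 where "P1 = max P 1"
  have P: "AE x in L. 1 \<le> p x \<and> p x \<le> P1" using P0 by eventually_elim (auto simp: P1_def)
  have P1: "P1 \<ge> 1" by (simp add: P1_def)
  have [measurable]: "u k \<in> borel_measurable L" for k using u by (simp add: L_def)
  have Lfin: "emeasure L (space L) < \<infinity>"
    using \<Omega> by (simp add: L_def emeasure_restrict_space space_restrict_space)
  \<comment> \<open>\<open>lim\<close> is defined everywhere; its value matters only where the
    sequence converges, that is almost everywhere.\<close>
  define v where "v x = lim (\<lambda>k. u k x)" for x
  have [measurable]: "v \<in> borel_measurable L" unfolding v_def[abs_def] by measurable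
  have cv: "AE x in L. (\<lambda>k. u k x) \<longlonglongrightarrow> v x" unfolding aeL
    using conv by eventually_elim (simp add: v_def convergent_LIMSEQ_iff)
  have uK: "(\<integral>\<^sup>+x. ennreal (\<bar>u k x\<bar> powr (p x + \<eta>)) \<partial>L) \<le> ennreal K" for k using bd[of k] by (simp add: nnL)
  \<comment> \<open>Fatou's lemma carries the bound over to the limit.\<close>
  have vK: "(\<integral>\<^sup>+x. ennreal (\<bar>v x\<bar> powr (p x + \<eta>)) \<partial>L) \<le> ennreal K"
  proof -
    have "(\<integral>\<^sup>+x. ennreal (\<bar>v x\<bar> powr (p x + \<eta>)) \<partial>L) = (\<integral>\<^sup>+x. liminf (\<lambda>k. ennreal (\<bar>u k x\<bar> powr (p x + \<eta>))) \<partial>L)"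
    proof (rule nn_integral_cong_AE)
      show "AE x in L. ennreal (\<bar>v x\<bar> powr (p x + \<eta>)) = liminf (\<lambda>k. ennreal (\<bar>u k x\<bar> powr (p x + \<eta>)))"
        using cv P
      proof eventually_elim
        case (elim x)
        have "(\<lambda>k. \<bar>u k x\<bar> powr (p x + \<eta>)) \<longlonglongrightarrow> \<bar>v x\<bar> powr (p x + \<eta>)"
          using elim \<eta> by (intro tendsto_powr' tendsto_rabs tendsto_const) auto
        then have "(\<lambda>k. ennreal (\<bar>u k x\<bar> powr (p x + \<eta>))) \<longlonglongrightarrow> ennreal (\<bar>v x\<bar> powr (p x + \<eta>))"
          by (rule tendsto_ennrealI)
        then show ?case using lim_imp_Liminf[OF sequentially_bot] by metis
      qed
    qed
    also have "\<dots> \<le> liminf (\<lambda>k. \<integral>\<^sup>+x. ennreal (\<bar>u k x\<bar> powr (p x + \<eta>)) \<partial>L)"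
      by (rule nn_integral_liminf) simp
    also have "\<dots> \<le> liminf (\<lambda>k. ennreal K)" by (rule Liminf_mono) (simp add: uK)
    finally show ?thesis by (simp add: Liminf_const)
  qed
  define d where "d k x = u k x - v x" for k x
  have [measurable]: "d k \<in> borel_measurable L" for k unfolding d_def[abs_def] by measurable
  define K' where "K' = 2 powr (P1 + \<eta>) * (K + K)"
  have K': "K' \<ge> 0" using K by (simp add: K'_def)
  have dK: "(\<integral>\<^sup>+x. ennreal (\<bar>d k x\<bar> powr (p x + \<eta>)) \<partial>L) \<le> ennreal K'" for k
  proof -
    have "(\<integral>\<^sup>+x. ennreal (\<bar>d k x\<bar> powr (p x + \<eta>)) \<partial>L)
       \<le> (\<integral>\<^sup>+x. ennreal (2 powr (P1 + \<eta>)) * (ennreal (\<bar>u k x\<bar> powr (p x + \<eta>)) + ennreal (\<bar>v x\<bar> powr (p x + \<eta>))) \<partial>L)"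
    proof (rule nn_integral_mono_AE)
      show "AE x in L. ennreal (\<bar>d k x\<bar> powr (p x + \<eta>)) \<le>
          ennreal (2 powr (P1 + \<eta>)) * (ennreal (\<bar>u k x\<bar> powr (p x + \<eta>)) + ennreal (\<bar>v x\<bar> powr (p x + \<eta>)))"
        using P
      proof eventually_elim
        case (elim x)
        let ?e = "p x + \<eta>"
        have "\<bar>d k x\<bar> powr ?e \<le> (\<bar>u k x\<bar> + \<bar>v x\<bar>) powr ?e"
          unfolding d_def using elim \<eta> by (intro powr_mono2) auto
        also have "\<dots> \<le> 2 powr ?e * (\<bar>u k x\<bar> powr ?e + \<bar>v x\<bar> powr ?e)" using elim \<eta> by (intro powr_sum_le) auto
        also have "\<dots> \<le> 2 powr (P1 + \<eta>) * (\<bar>u k x\<bar> powr ?e + \<bar>v x\<bar> powr ?e)"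
          using elim by (intro mult_right_mono powr_mono) auto
        finally have "ennreal (\<bar>d k x\<bar> powr ?e) \<le> ennreal (2 powr (P1 + \<eta>) * (\<bar>u k x\<bar> powr ?e + \<bar>v x\<bar> powr ?e))"
          by (rule ennreal_leI)
        then show ?case by (simp add: ennreal_mult' ennreal_plus)
      qed
    qed
    also have "\<dots> = ennreal (2 powr (P1 + \<eta>)) * ((\<integral>\<^sup>+x. ennreal (\<bar>u k x\<bar> powr (p x + \<eta>)) \<partial>L) + (\<integral>\<^sup>+x. ennreal (\<bar>v x\<bar> powr (p x + \<eta>)) \<partial>L))"
      by (simp add: nn_integral_cmult nn_integral_add)
    also have "\<dots> \<le> ennreal (2 powr (P1 + \<eta>)) * (ennreal K + ennreal K)"
      by (intro mult_left_mono add_mono uK vK) simp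
    also have "\<dots> = ennreal K'"
      unfolding K'_def ennreal_plus[OF K K, symmetric] by (rule ennreal_mult'[symmetric]) simp
    finally show ?thesis .
  qed
  have small: "eventually (\<lambda>k. (\<integral>\<^sup>+x. ennreal (\<bar>d k x\<bar> powr p x) \<partial>L) \<le> ennreal \<epsilon>) sequentially" if \<epsilon>: "\<epsilon> > 0" for \<epsilon>
  proof -
    \<comment> \<open>Chosen so that the tail, at most M^-\<eta> K', stays below
      \<epsilon>/2.\<close>
    define M where "M = max 1 ((2 * (K' + 1) / \<epsilon>) powr (1/\<eta>))"
    have M: "M \<ge> 1" by (simp add: M_def)
    have MK: "M powr (- \<eta>) * K' \<le> \<epsilon>/2"
    proof -
      have "((2 * (K' + 1) / \<epsilon>) powr (1/\<eta>)) powr \<eta> \<le> M powr \<eta>" using \<eta> by (intro powr_mono2) (auto simp: M_def)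
      then have "2 * (K' + 1) / \<epsilon> \<le> M powr \<eta>" using \<eta> K' \<epsilon> by (simp add: powr_powr)
      then have "2 * (K' + 1) \<le> M powr \<eta> * \<epsilon>" using \<epsilon> by (simp add: divide_le_eq)
      with order_trans[of "2 * K'" "2 * (K' + 1)"] have "2 * K' \<le> M powr \<eta> * \<epsilon>" by simp
      then show ?thesis using M by (simp add: powr_minus field_simps)
    qed
    define m where "m k x = min \<bar>d k x\<bar> M powr p x" for k x
    have [measurable]: "m k \<in> borel_measurable L" for k unfolding m_def[abs_def] by measurable
    have "(\<lambda>k. \<integral>\<^sup>+x. ennreal (m k x) \<partial>L) \<longlonglongrightarrow> (\<integral>\<^sup>+x. 0 \<partial>L)"
    proof (rule nn_integral_dominated_convergence[where w="\<lambda>x. ennreal (M powr P1)"])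
      show "(\<integral>\<^sup>+x. ennreal (M powr P1) \<partial>L) < \<infinity>" using Lfin by (simp add: ennreal_mult_less_top)
      show "AE x in L. (\<lambda>k. ennreal (m k x)) \<longlonglongrightarrow> 0"
        using cv P
      proof eventually_elim
        case (elim x)
        have "(\<lambda>k. d k x) \<longlonglongrightarrow> 0" unfolding d_def using elim by (simp add: LIM_zero)
        then have "(\<lambda>k. m k x) \<longlonglongrightarrow> min \<bar>0\<bar> M powr p x" unfolding m_def
          using elim M by (intro tendsto_powr' tendsto_min tendsto_rabs tendsto_const) (auto simp: min_def)
        then have "(\<lambda>k. m k x) \<longlonglongrightarrow> 0" using M by simp
        then show ?case using tendsto_ennrealI[of "\<lambda>k. m k x" 0] by simp
      qed
      show "AE x in L. ennreal (m k x) \<le> ennreal (M powr P1)" for k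
        using P
      proof eventually_elim
        case (elim x)
        have "m k x \<le> M powr p x" unfolding m_def using elim M by (intro powr_mono2) auto
        also have "\<dots> \<le> M powr P1" using elim M by (intro powr_mono) auto
        finally show ?case by (rule ennreal_leI)
      qed
    qed simp_all
    then have "(\<lambda>k. \<integral>\<^sup>+x. ennreal (m k x) \<partial>L) \<longlonglongrightarrow> 0" by simp
    then have "eventually (\<lambda>k. (\<integral>\<^sup>+x. ennreal (m k x) \<partial>L) < ennreal (\<epsilon>/2)) sequentially"
      by (rule order_tendstoD) (use \<epsilon> in simp)
    then show ?thesis
    proof eventually_elim
      case (elim k)
      have "(\<integral>\<^sup>+x. ennreal (\<bar>d k x\<bar> powr p x) \<partial>L) \<le> (\<integral>\<^sup>+x. ennreal (m k x) + ennreal (M powr (- \<eta>)) * ennreal (\<bar>d k x\<bar> powr (p x + \<eta>)) \<partial>L)"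
      proof (rule nn_integral_mono)
        fix x
        have "\<bar>d k x\<bar> powr p x \<le> m k x + M powr (- \<eta>) * \<bar>d k x\<bar> powr (p x + \<eta>)"
        proof (cases "\<bar>d k x\<bar> \<le> M")
          case True
          then show ?thesis by (simp add: m_def min_def)
        next
          case False
          then have "\<bar>d k x\<bar> powr p x = \<bar>d k x\<bar> powr (- \<eta>) * \<bar>d k x\<bar> powr (p x + \<eta>)"
            using M by (simp add: powr_add[symmetric])
          also have "\<dots> \<le> M powr (- \<eta>) * \<bar>d k x\<bar> powr (p x + \<eta>)"
            using False M \<eta> by (intro mult_right_mono powr_mono2') auto
          finally show ?thesis by (simp add: m_def add_increasing)
        qed
        then have "ennreal (\<bar>d k x\<bar> powr p x) \<le> ennreal (m k x + M powr (- \<eta>) * \<bar>d k x\<bar> powr (p x + \<eta>))" by (rule ennreal_leI)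
        then show "ennreal (\<bar>d k x\<bar> powr p x) \<le> ennreal (m k x) + ennreal (M powr (- \<eta>)) * ennreal (\<bar>d k x\<bar> powr (p x + \<eta>))"
          by (simp add: ennreal_mult' ennreal_plus m_def)
      qed
      also have "\<dots> = (\<integral>\<^sup>+x. ennreal (m k x) \<partial>L) + ennreal (M powr (- \<eta>)) * (\<integral>\<^sup>+x. ennreal (\<bar>d k x\<bar> powr (p x + \<eta>)) \<partial>L)"
        by (simp add: nn_integral_add nn_integral_cmult)
      also have "\<dots> \<le> ennreal (\<epsilon>/2) + ennreal (M powr (- \<eta>)) * ennreal K'"
        using elim by (intro add_mono mult_left_mono dK) auto
      also have "\<dots> = ennreal (\<epsilon>/2 + M powr (- \<eta>) * K')" using \<epsilon> K' by (simp add: ennreal_mult' ennreal_plus)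
      also have "\<dots> \<le> ennreal \<epsilon>" using MK by (intro ennreal_leI) simp
      finally show ?case .
    qed
  qed
  \<comment> \<open>For l at most 1, dividing by l enlarges the modular by at most the factor l^-P1;
    once the modular is below l^P1, l is admissible in the infimum.\<close>
  have lux: "eventually (\<lambda>k. 0 \<le> lux_norm \<Omega> p (d k) \<and> lux_norm \<Omega> p (d k) \<le> l) sequentially" if l: "0 < l" "l \<le> 1" for l
  proof -
    have "l powr P1 > 0" using l by simp
    from small[OF this] show ?thesis
    proof eventually_elim
      case (elim k)
      have "modular \<Omega> p (\<lambda>x. d k x / l) = (\<integral>\<^sup>+x. ennreal (\<bar>d k x / l\<bar> powr p x) \<partial>L)" by (simp add: modular_def nnL)
      also have "\<dots> \<le> (\<integral>\<^sup>+x. ennreal (l powr (- P1)) * ennreal (\<bar>d k x\<bar> powr p x) \<partial>L)"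
      proof (rule nn_integral_mono_AE)
        show "AE x in L. ennreal (\<bar>d k x / l\<bar> powr p x) \<le> ennreal (l powr (- P1)) * ennreal (\<bar>d k x\<bar> powr p x)"
          using P
        proof eventually_elim
          case (elim x)
          have "\<bar>d k x / l\<bar> powr p x = l powr (- p x) * \<bar>d k x\<bar> powr p x"
            using l by (simp add: powr_divide powr_minus field_simps)
          also have "\<dots> \<le> l powr (- P1) * \<bar>d k x\<bar> powr p x"
            using elim l by (intro mult_right_mono powr_mono') auto
          finally have "ennreal (\<bar>d k x / l\<bar> powr p x) \<le> ennreal (l powr (- P1) * \<bar>d k x\<bar> powr p x)" by (rule ennreal_leI)
          then show ?case by (simp add: ennreal_mult')
        qed
      qed
      also have "\<dots> = ennreal (l powr (- P1)) * (\<integral>\<^sup>+x. ennreal (\<bar>d k x\<bar> powr p x) \<partial>L)" by (simp add: nn_integral_cmult)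
      also have "\<dots> \<le> ennreal (l powr (- P1)) * ennreal (l powr P1)" by (intro mult_left_mono elim) simp
      also have "\<dots> = 1" using l by (simp add: ennreal_mult'[symmetric] powr_add[symmetric])
      finally have "l \<in> {l. l > 0 \<and> modular \<Omega> p (\<lambda>x. d k x / l) \<le> 1}" using l by simp
      then have "0 \<le> Inf {l. l > 0 \<and> modular \<Omega> p (\<lambda>x. d k x / l) \<le> 1}"
        "Inf {l. l > 0 \<and> modular \<Omega> p (\<lambda>x. d k x / l) \<le> 1} \<le> l"
        by (intro cInf_greatest cInf_lower bdd_belowI[of _ 0]; auto)+
      then show ?case unfolding lux_norm_def by simp
    qed
  qed
  have "(\<lambda>k. lux_norm \<Omega> p (d k)) \<longlonglongrightarrow> 0"
  proof (rule LIMSEQ_I)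
    fix \<epsilon> :: real assume \<epsilon>: "\<epsilon> > 0"
    from lux[of "min 1 (\<epsilon>/2)"] \<epsilon>
    have "eventually (\<lambda>k. 0 \<le> lux_norm \<Omega> p (d k) \<and> lux_norm \<Omega> p (d k) \<le> min 1 (\<epsilon>/2)) sequentially" by simp
    then have "eventually (\<lambda>k. norm (lux_norm \<Omega> p (d k) - 0) < \<epsilon>) sequentially"
      by eventually_elim (use \<epsilon> in auto)
    then show "\<exists>no. \<forall>n\<ge>no. norm (lux_norm \<Omega> p (d n) - 0) < \<epsilon>" by (simp add: eventually_sequentially)
  qed
  moreover have "v \<in> Lpx \<Omega> p"
  proof -
    have "modular \<Omega> p v = (\<integral>\<^sup>+x. ennreal (\<bar>v x\<bar> powr p x) \<partial>L)" by (simp add: modular_def nnL)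
    also have "\<dots> \<le> (\<integral>\<^sup>+x. 1 + ennreal (\<bar>v x\<bar> powr (p x + \<eta>)) \<partial>L)"
    proof (rule nn_integral_mono_AE)
      show "AE x in L. ennreal (\<bar>v x\<bar> powr p x) \<le> 1 + ennreal (\<bar>v x\<bar> powr (p x + \<eta>))"
        using P
      proof eventually_elim
        case (elim x)
        have "\<bar>v x\<bar> powr p x \<le> 1 + \<bar>v x\<bar> powr (p x + \<eta>)"
        proof (cases "\<bar>v x\<bar> \<le> 1")
          case True
          then have "\<bar>v x\<bar> powr p x \<le> 1 powr p x" using elim by (intro powr_mono2) auto
          then show ?thesis by (simp add: add_increasing2)
        next
          case False
          then have "\<bar>v x\<bar> powr p x \<le> \<bar>v x\<bar> powr (p x + \<eta>)" using \<eta> by (intro powr_mono) auto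
          then show ?thesis by simp
        qed
        then have "ennreal (\<bar>v x\<bar> powr p x) \<le> ennreal (1 + \<bar>v x\<bar> powr (p x + \<eta>))" by (rule ennreal_leI)
        then show ?case by (simp add: ennreal_plus)
      qed
    qed
    also have "\<dots> = emeasure L (space L) + (\<integral>\<^sup>+x. ennreal (\<bar>v x\<bar> powr (p x + \<eta>)) \<partial>L)" by (simp add: nn_integral_add)
    also have "\<dots> < \<infinity>" using Lfin le_less_trans[OF vK ennreal_less_top] by simp
    finally have fin: "modular \<Omega> p v < \<infinity>" .
    have "v \<in> borel_measurable (restrict_space lebesgue \<Omega>)" unfolding L_def[symmetric] by measurable
    with fin show ?thesis by (simp add: Lpx_def)
  qed
  ultimately show ?thesis by (auto simp: d_def[abs_def])
qed

text \<open>For every \<open>0 < a \<le> G\<close> the derivative \<open>min (\<bar>x\<bar> powr G) 1\<close> is at most \<open>\<bar>x\<bar> powr a\<close>, both for small and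
  for large \<open>x\<close>: composing with \<open>F\<close> therefore yields functions bounded in \<open>W\<^sup>1\<^sup>,\<^sup>1\<close>.\<close>

lemma slow_antiderivative_bounds:
  fixes F :: "real \<Rightarrow> real"
  assumes G: "G > 0" and F: "F 0 = 0" "\<And>x. (F has_real_derivative min (\<bar>x\<bar> powr G) 1) (at x)"
  shows "\<bar>F t\<bar> \<le> \<bar>t\<bar>" and "convergent (\<lambda>k. F (a k)) \<Longrightarrow> convergent (a :: nat \<Rightarrow> real)"
proof -
  have "norm (F t - F 0) \<le> 1 * norm (t - 0)" for t
    by (rule field_differentiable_bound[of UNIV F "\<lambda>x. min (\<bar>x\<bar> powr G) 1"])
      (use F in \<open>auto intro: has_field_derivative_at_within\<close>)
  then show "\<bar>F t\<bar> \<le> \<bar>t\<bar>" using F by simp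
  have mono0: "F x \<le> F y" if "x \<le> y" for x y
  proof (rule DERIV_nonneg_imp_nondecreasing[OF that])
    fix z show "\<exists>y. (F has_real_derivative y) (at z) \<and> 0 \<le> y"
      by (intro exI[of _ "min (\<bar>z\<bar> powr G) 1"] conjI F(2)) simp
  qed
  \<comment> \<open>The derivative vanishes only at 0, so F cannot be constant on an interval; the
    point z is chosen away from 0.\<close>
  have smono: "F x < F y" if xy: "x < y" for x y
  proof (rule ccontr)
    assume "\<not> F x < F y"
    then have eq: "F z = F x" if "x \<le> z" "z \<le> y" for z using mono0[of x z] mono0[of z y] that by linarith
    obtain z where z: "x < z" "z < y" "z \<noteq> 0"
    proof (cases "x < 0 \<and> 0 < y")
      case True
      then show ?thesis using that[of "y/2"] by auto
    next
      case False
      then show ?thesis using that[of "(x+y)/2"] xy by auto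
    qed
    have "((\<lambda>_. F x) has_real_derivative min (\<bar>z\<bar> powr G) 1) (at z)"
    proof (rule has_field_derivative_transform_within_open[OF F(2), of "{x<..<y}"])
      fix t assume "t \<in> {x<..<y}"
      then show "F t = F x" by (intro eq) auto
    qed (use z in auto)
    from DERIV_unique[OF this DERIV_const] show False using z by (simp add: min_def split: if_splits)
  qed
  \<comment> \<open>Beyond 1 the slope of F is 1. Together with \<open>ub\<close> this makes F
    surjective, so that the limit of F(a k) is a value of F.\<close>
  have lb: "F t \<ge> t - 1" if "t \<ge> 1" for t
  proof (cases "t = 1")
    case True then show ?thesis using mono0[of 0 1] F by simp
  next
    case False
    then have t: "1 < t" using that by simp
    have "\<exists>z>1. z < t \<and> F t - F 1 = (t - 1) * min (\<bar>z\<bar> powr G) 1" by (rule MVT2[OF t]) (rule F(2))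
    then obtain z where z: "z > 1" "F t - F 1 = (t - 1) * min (\<bar>z\<bar> powr G) 1" by blast
    have "\<bar>z\<bar> powr G \<ge> 1" using z G by (simp add: ge_one_powr_ge_zero)
    then show ?thesis using z(2) mono0[of 0 1] F(1) by (simp add: min_def split: if_splits)
  qed
  have ub: "F t \<le> t + 1" if "t \<le> -1" for t
  proof (cases "t = -1")
    case True then show ?thesis using mono0[of "-1" 0] F by simp
  next
    case False
    then have t: "t < -1" using that by simp
    have "\<exists>z>t. z < -1 \<and> F (-1) - F t = (-1 - t) * min (\<bar>z\<bar> powr G) 1" by (rule MVT2[OF t]) (rule F(2))
    then obtain z where z: "z < -1" "F (-1) - F t = (-1 - t) * min (\<bar>z\<bar> powr G) 1" by blast
    have "\<bar>z\<bar> powr G \<ge> 1" using z G by (simp add: ge_one_powr_ge_zero)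
    then show ?thesis using z(2) mono0[of "-1" 0] F(1) by (simp add: min_def split: if_splits)
  qed
  assume "convergent (\<lambda>k. F (a k))"
  then obtain l where l: "(\<lambda>k. F (a k)) \<longlonglongrightarrow> l" by (auto simp: convergent_def)
  have cont: "continuous_on {- (\<bar>l\<bar> + 1)..\<bar>l\<bar> + 1} F"
    by (rule DERIV_continuous_on) (rule has_field_derivative_at_within[OF F(2)])
  have "\<exists>x\<ge>- (\<bar>l\<bar> + 1). x \<le> \<bar>l\<bar> + 1 \<and> F x = l"
    by (rule IVT'[OF _ _ _ cont]) (use lb[of "\<bar>l\<bar> + 1"] ub[of "- (\<bar>l\<bar> + 1)"] in auto)
  then obtain x where x: "F x = l" by blast
  have "a \<longlonglongrightarrow> x"
  proof (rule LIMSEQ_I)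
    fix e :: real assume e: "e > 0"
    have "eventually (\<lambda>k. F (x - e) < F (a k)) sequentially" "eventually (\<lambda>k. F (a k) < F (x + e)) sequentially"
      using order_tendstoD[OF l] smono[of "x - e" x] smono[of x "x + e"] e unfolding x by auto
    then have "eventually (\<lambda>k. norm (a k - x) < e) sequentially"
    proof eventually_elim
      case (elim k)
      have "x - e < a k" using elim(1) mono0[of "a k" "x - e"] by force
      moreover have "a k < x + e" using elim(2) mono0[of "x + e" "a k"] by force
      ultimately show ?case by auto
    qed
    then show "\<exists>no. \<forall>n\<ge>no. norm (a n - x) < e" by (simp add: eventually_sequentially)
  qed
  then show "convergent a" by (auto simp: convergent_def)
qed

section \<open>The embedding\<close>

locale embedding_setting =
  fixes \<Omega> :: "(real^'n::finite) set" and \<gamma> \<beta> \<theta> p :: "real^'n \<Rightarrow> real" and \<epsilon>0 \<epsilon> :: real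
  assumes dom: "bounded_lipschitz_domain \<Omega>"
    and gamma: "C1_closure \<Omega> \<gamma>" "\<forall>x\<in>\<Omega>. 1 \<le> \<gamma> x"
    and beta: "C1_closure \<Omega> \<beta>" "\<forall>x\<in>\<Omega>. 1 \<le> \<beta> x \<and> \<beta> x < real CARD('n)"
    and theta: "M0 \<Omega> \<theta>" "\<epsilon>0 > 0"
      "AE x in lebesgue. x \<in> \<Omega> \<longrightarrow> \<theta> x \<ge> \<gamma> x + \<beta> x + \<epsilon>0"
    and pM: "M0 \<Omega> p"
    and eps: "\<epsilon> > 0"
    and pcrit: "\<forall>x\<in>\<Omega>. p x + \<epsilon> < real CARD('n) * (\<gamma> x + \<beta> x) / (real CARD('n) - \<beta> x)"
begin

abbreviation Leb :: "(real^'n) measure" where "Leb \<equiv> restrict_space lebesgue \<Omega>"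

lemma open_\<Omega>: "open \<Omega>" and bounded_\<Omega>: "bounded \<Omega>"
  using dom by (auto simp: bounded_lipschitz_domain_def)

lemma \<Omega>_borel[measurable]: "\<Omega> \<in> sets borel" "\<Omega> \<in> sets lebesgue" "\<Omega> \<inter> space lebesgue \<in> sets lebesgue"
  using open_\<Omega> by auto

lemma fin_\<Omega>: "emeasure lborel \<Omega> < \<infinity>" "emeasure lebesgue \<Omega> < \<infinity>"
  using emeasure_bounded_finite[OF bounded_\<Omega>] by auto

lemma nn_Leb: "(\<integral>\<^sup>+x\<in>\<Omega>. f x \<partial>lebesgue) = (\<integral>\<^sup>+x. f x \<partial>Leb)"
  by (simp add: nn_integral_restrict_space[OF \<Omega>_borel(3)])

lemma AE_Leb: "(AE x in Leb. Q x) \<longleftrightarrow> (AE x in lebesgue. x \<in> \<Omega> \<longrightarrow> Q x)"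
  using AE_restrict_space_iff[OF \<Omega>_borel(3)] by simp

lemma space_Leb: "space Leb = \<Omega>" by (simp add: space_restrict_space)

lemma emeasure_Leb: "emeasure Leb (space Leb) = emeasure lborel \<Omega>"
  by (simp add: emeasure_restrict_space space_restrict_space)

lemma cont_\<gamma>: "continuous_on (closure \<Omega>) \<gamma>" and cont_\<beta>: "continuous_on (closure \<Omega>) \<beta>"
  using gamma(1) beta(1) by (auto simp: C1_closure_def)

lemma measurable_exponents[measurable]:
  "\<gamma> \<in> borel_measurable Leb" "\<beta> \<in> borel_measurable Leb" "\<theta> \<in> borel_measurable Leb" "p \<in> borel_measurable Leb"
  using continuous_on_subset[OF cont_\<gamma> closure_subset] continuous_on_subset[OF cont_\<beta> closure_subset] theta(1) pM
  by (auto intro!: continuous_imp_measurable_on_sets_lebesgue simp: M0_def)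

lemma exponent_bound:
  obtains Q where "Q \<ge> 1" "\<And>x. x \<in> \<Omega> \<Longrightarrow> \<gamma> x + \<beta> x \<le> Q" "\<And>x. x \<in> \<Omega> \<Longrightarrow> \<gamma> x \<le> Q" "AE x in Leb. \<theta> x \<le> Q"
proof -
  have cl: "compact (closure \<Omega>)" using bounded_\<Omega> by simp
  have "bounded ((\<lambda>x. \<gamma> x + \<beta> x) ` closure \<Omega>)"
    by (intro compact_imp_bounded compact_continuous_image continuous_intros cont_\<gamma> cont_\<beta> cl)
  then obtain Q1 where Q1: "\<And>x. x \<in> closure \<Omega> \<Longrightarrow> \<bar>\<gamma> x + \<beta> x\<bar> \<le> Q1" by (auto simp: bounded_iff)
  obtain Q2 where "AE x in Leb. 1 \<le> \<theta> x \<and> \<theta> x \<le> Q2" using theta(1) unfolding M0_def AE_Leb by blast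
  then have Q2: "AE x in Leb. \<theta> x \<le> Q2" by eventually_elim simp
  show ?thesis
  proof (rule that[of "max 1 (max Q1 Q2)"])
    fix x assume x: "x \<in> \<Omega>"
    have "\<bar>\<gamma> x + \<beta> x\<bar> \<le> Q1" using x closure_subset by (intro Q1) auto
    then show 1: "\<gamma> x + \<beta> x \<le> max 1 (max Q1 Q2)" by auto
    show "\<gamma> x \<le> max 1 (max Q1 Q2)" using beta(2) x 1 by force
  next
    show "AE x in Leb. \<theta> x \<le> max 1 (max Q1 Q2)" using Q2 by eventually_elim auto
  qed auto
qed

lemma theta_ge: "AE x in Leb. x \<in> \<Omega> \<and> \<theta> x \<ge> \<gamma> x + \<beta> x \<and> \<theta> x \<ge> 1"
proof -
  have "AE x in Leb. x \<in> \<Omega>" unfolding AE_Leb by simp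
  moreover have "AE x in Leb. \<theta> x \<ge> \<gamma> x + \<beta> x + \<epsilon>0" unfolding AE_Leb by (rule theta(3))
  ultimately show ?thesis
    by eventually_elim (use gamma(2) beta(2) theta(2) in force)
qed

section \<open>Modulars and the pseudo-norm\<close>

definition energy :: "'n \<Rightarrow> 'n fn \<Rightarrow> ennreal" where
  "energy i u = (\<integral>\<^sup>+x. ennreal (\<bar>u x\<bar> powr \<gamma> x * \<bar>Dw \<Omega> i u x\<bar> powr \<beta> x) \<partial>Leb)"

definition mass :: "'n fn \<Rightarrow> ennreal" where
  "mass u = (\<integral>\<^sup>+x. ennreal (\<bar>u x\<bar> powr \<theta> x) \<partial>Leb)"

lemma S_space_iff: "u \<in> S_space \<Omega> \<gamma> \<beta> \<theta> \<longleftrightarrow> set_integrable lebesgue \<Omega> u \<and> has_weak_partials \<Omega> u \<and>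
    mass u + (\<Sum>i\<in>UNIV. energy i u) < \<infinity>"
  by (simp add: S_space_def modular_def mass_def energy_def nn_Leb)

lemma S_measurable:
  assumes "u \<in> S_space \<Omega> \<gamma> \<beta> \<theta>"
  shows "u \<in> borel_measurable Leb" "Dw \<Omega> i u \<in> borel_measurable Leb"
proof -
  have "(\<lambda>x. indicator \<Omega> x *\<^sub>R u x) \<in> borel_measurable lebesgue"
    using assms by (auto simp: S_space_def set_integrable_def dest: borel_measurable_integrable)
  then show "u \<in> borel_measurable Leb" by (simp add: borel_measurable_restrict_space_iff[OF \<Omega>_borel(3)])
  have "weak_partial \<Omega> u i (Dw \<Omega> i u)"
  proof -
    have "\<exists>g. weak_partial \<Omega> u i g" using assms by (simp add: S_space_iff has_weak_partials_def)
    then show ?thesis unfolding Dw_def by (rule someI_ex)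
  qed
  then have "(\<lambda>x. indicator \<Omega> x * Dw \<Omega> i u x) \<in> borel_measurable lebesgue"
    by (intro locally_integrable_measurable open_\<Omega>) (auto simp: weak_partial_def)
  then show "Dw \<Omega> i u \<in> borel_measurable Leb" by (simp add: borel_measurable_restrict_space_iff[OF \<Omega>_borel(3)])
qed

text \<open>Boundedness expressed by integrals. The later estimates start from it, so the infimum in
  the pseudo-norm is opened only once, in \<open>S_pnorm_bdd_by\<close>.\<close>

definition bdd_by :: "real \<Rightarrow> 'n fn \<Rightarrow> bool" where
  "bdd_by \<Lambda> u \<longleftrightarrow> u \<in> S_space \<Omega> \<gamma> \<beta> \<theta> \<and> mass u \<le> ennreal \<Lambda> \<and> (\<forall>i. energy i u \<le> ennreal \<Lambda>)"

lemma S_bdd_by: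
  assumes "u \<in> S_space \<Omega> \<gamma> \<beta> \<theta>" obtains \<Lambda> where "\<Lambda> > 0" "bdd_by \<Lambda> u"
proof -
  define s where "s = mass u + (\<Sum>i\<in>UNIV. energy i u)"
  have s: "s < \<infinity>" using assms by (simp add: S_space_iff s_def)
  define \<Lambda> where "\<Lambda> = enn2real s + 1"
  have "s \<le> ennreal \<Lambda>" using s unfolding \<Lambda>_def by (simp add: ennreal_plus ennreal_enn2real)
  moreover have "mass u \<le> s" "energy i u \<le> s" for i
  proof -
    show "mass u \<le> s" by (simp add: s_def)
    have "energy i u \<le> (\<Sum>i\<in>UNIV. energy i u)" by (rule member_le_sum) auto
    then show "energy i u \<le> s" by (simp add: s_def add_increasing)
  qed
  ultimately have "bdd_by \<Lambda> u" using assms unfolding bdd_by_def by (meson order_trans)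
  then show ?thesis by (intro that[of \<Lambda>]) (simp_all add: \<Lambda>_def add_nonneg_pos)
qed

definition scaled :: "real \<Rightarrow> 'n fn \<Rightarrow> ennreal" where
  "scaled l u = modular \<Omega> \<theta> (\<lambda>x. u x / l)
     + (\<Sum>i\<in>UNIV. \<integral>\<^sup>+ x \<in> \<Omega>. ennreal (\<bar>\<bar>u x\<bar> powr (\<gamma> x / \<beta> x) * Dw \<Omega> i u x
            / l powr (\<gamma> x / \<beta> x + 1)\<bar> powr \<beta> x) \<partial>lebesgue)"

text \<open>The power of l in the pseudo-norm is designed to leave the \<beta>-th power as
  l^-(\<gamma> + \<beta>), which is the homogeneity of the energy in u.\<close>

lemma scaled_eq:
  assumes l: "l > 0"
  shows "scaled l u = (\<integral>\<^sup>+x. ennreal (l powr (- \<theta> x) * \<bar>u x\<bar> powr \<theta> x) \<partial>Leb)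
    + (\<Sum>i\<in>UNIV. \<integral>\<^sup>+x. ennreal (l powr (- (\<gamma> x + \<beta> x)) * (\<bar>u x\<bar> powr \<gamma> x * \<bar>Dw \<Omega> i u x\<bar> powr \<beta> x)) \<partial>Leb)"
proof -
  have 1: "\<bar>u x / l\<bar> powr \<theta> x = l powr (- \<theta> x) * \<bar>u x\<bar> powr \<theta> x" for x
    using l by (simp add: powr_divide powr_minus field_simps)
  have 2: "\<bar>\<bar>u x\<bar> powr (\<gamma> x / \<beta> x) * Dw \<Omega> i u x / l powr (\<gamma> x / \<beta> x + 1)\<bar> powr \<beta> x
     = l powr (- (\<gamma> x + \<beta> x)) * (\<bar>u x\<bar> powr \<gamma> x * \<bar>Dw \<Omega> i u x\<bar> powr \<beta> x)" if "x \<in> \<Omega>" for x i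
  proof -
    have b: "\<beta> x > 0" using beta(2) that by force
    then have "(\<gamma> x / \<beta> x + 1) * \<beta> x = \<gamma> x + \<beta> x" by (simp add: distrib_right)
    then have "(l powr (\<gamma> x / \<beta> x + 1)) powr \<beta> x = l powr (\<gamma> x + \<beta> x)" by (simp only: powr_powr)
    moreover have "(\<bar>u x\<bar> powr (\<gamma> x / \<beta> x)) powr \<beta> x = \<bar>u x\<bar> powr \<gamma> x" using b by (simp add: powr_powr)
    moreover have "\<bar>\<bar>u x\<bar> powr (\<gamma> x / \<beta> x) * Dw \<Omega> i u x / l powr (\<gamma> x / \<beta> x + 1)\<bar>
       = \<bar>u x\<bar> powr (\<gamma> x / \<beta> x) * \<bar>Dw \<Omega> i u x\<bar> / l powr (\<gamma> x / \<beta> x + 1)" by (simp add: abs_mult)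
    ultimately show ?thesis
      by (simp only: powr_divide powr_mult powr_minus_divide) simp
  qed
  have "(\<integral>\<^sup>+ x. ennreal (\<bar>\<bar>u x\<bar> powr (\<gamma> x / \<beta> x) * Dw \<Omega> i u x / l powr (\<gamma> x / \<beta> x + 1)\<bar> powr \<beta> x) \<partial>Leb)
    = (\<integral>\<^sup>+x. ennreal (l powr (- (\<gamma> x + \<beta> x)) * (\<bar>u x\<bar> powr \<gamma> x * \<bar>Dw \<Omega> i u x\<bar> powr \<beta> x)) \<partial>Leb)" for i
    by (rule nn_integral_cong) (simp only: space_Leb 2)
  then show ?thesis unfolding scaled_def modular_def nn_Leb 1 by (simp only:)
qed

text \<open>An infimum is informative only over a nonempty set: for u in the space a large scaling
  is admissible, because all exponents are at least 1. Some admissible scaling k is then below C +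
  1, and undoing it costs at most \<mu>^Q.\<close>

lemma S_pnorm_bdd_by:
  "\<exists>\<Lambda>>0. \<forall>u. u \<in> S_space \<Omega> \<gamma> \<beta> \<theta> \<longrightarrow> S_pnorm \<Omega> \<gamma> \<beta> \<theta> u \<le> C \<longrightarrow> bdd_by \<Lambda> u"
proof -
  obtain Q where Q: "Q \<ge> 1" "\<And>x. x \<in> \<Omega> \<Longrightarrow> \<gamma> x + \<beta> x \<le> Q" "AE x in Leb. \<theta> x \<le> Q" using exponent_bound by metis
  \<comment> \<open>C + 1 leaves room because the infimum need not be attained; the maximum with 1
    makes powers of \<mu> increase with the exponent.\<close>
  define \<mu> where "\<mu> = max 1 (C + 1)"
  have \<mu>: "\<mu> \<ge> 1" by (simp add: \<mu>_def)
  show ?thesis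
  proof (intro exI[of _ "\<mu> powr Q"] conjI allI impI)
    show "\<mu> powr Q > 0" using \<mu> by simp
    fix u assume u: "u \<in> S_space \<Omega> \<gamma> \<beta> \<theta>" and C: "S_pnorm \<Omega> \<gamma> \<beta> \<theta> u \<le> C"
    note [measurable] = S_measurable[OF u]
    define X where "X = {l. l > 0 \<and> scaled l u \<le> 1}"
    have pn: "S_pnorm \<Omega> \<gamma> \<beta> \<theta> u = Inf X" unfolding S_pnorm_def X_def scaled_def by simp
    define s where "s = mass u + (\<Sum>i\<in>UNIV. energy i u)"
    have s: "s < \<infinity>" using u by (simp add: S_space_iff s_def)
    \<comment> \<open>Scaling by l >= 1 divides every integral by at least l, and l is large enough
      to bring the total s down to 1.\<close>
    define l where "l = max 1 (enn2real s)"
    have l: "l \<ge> 1" by (simp add: l_def)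
    have sl: "s \<le> ennreal l"
    proof -
      have "s = ennreal (enn2real s)" using s by simp
      also have "\<dots> \<le> ennreal l" by (intro ennreal_leI) (simp add: l_def)
      finally show ?thesis .
    qed
    have dec: "l powr (- e) \<le> 1 / l" if "e \<ge> 1" for e
      using powr_mono[of "- e" "- 1" l] that l by (simp add: powr_minus_divide)
    have "scaled l u \<le> ennreal (1/l) * mass u + (\<Sum>i\<in>UNIV. ennreal (1/l) * energy i u)"
    proof -
      have "(\<integral>\<^sup>+x. ennreal (l powr (- \<theta> x) * \<bar>u x\<bar> powr \<theta> x) \<partial>Leb) \<le> (\<integral>\<^sup>+x. ennreal (1/l) * ennreal (\<bar>u x\<bar> powr \<theta> x) \<partial>Leb)"
      proof (rule nn_integral_mono_AE)
        show "AE x in Leb. ennreal (l powr (- \<theta> x) * \<bar>u x\<bar> powr \<theta> x) \<le> ennreal (1/l) * ennreal (\<bar>u x\<bar> powr \<theta> x)"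
          using theta_ge
        proof eventually_elim
          case (elim x)
          have "l powr (- \<theta> x) * \<bar>u x\<bar> powr \<theta> x \<le> (1/l) * \<bar>u x\<bar> powr \<theta> x"
            using elim by (intro mult_right_mono dec) auto
          from ennreal_leI[OF this] show ?case using l by (subst ennreal_mult'[symmetric]) auto
        qed
      qed
      also have "\<dots> = ennreal (1/l) * mass u" unfolding mass_def by (rule nn_integral_cmult) measurable
      finally have 1: "(\<integral>\<^sup>+x. ennreal (l powr (- \<theta> x) * \<bar>u x\<bar> powr \<theta> x) \<partial>Leb) \<le> ennreal (1/l) * mass u" .
      have 2: "(\<integral>\<^sup>+x. ennreal (l powr (- (\<gamma> x + \<beta> x)) * (\<bar>u x\<bar> powr \<gamma> x * \<bar>Dw \<Omega> i u x\<bar> powr \<beta> x)) \<partial>Leb) \<le> ennreal (1/l) * energy i u" for i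
      proof -
        have "(\<integral>\<^sup>+x. ennreal (l powr (- (\<gamma> x + \<beta> x)) * (\<bar>u x\<bar> powr \<gamma> x * \<bar>Dw \<Omega> i u x\<bar> powr \<beta> x)) \<partial>Leb)
          \<le> (\<integral>\<^sup>+x. ennreal (1/l) * ennreal (\<bar>u x\<bar> powr \<gamma> x * \<bar>Dw \<Omega> i u x\<bar> powr \<beta> x) \<partial>Leb)"
        proof (rule nn_integral_mono)
          fix x assume "x \<in> space Leb"
          then have "\<gamma> x + \<beta> x \<ge> 1" using gamma(2) beta(2) unfolding space_Leb by force
          then show "ennreal (l powr (- (\<gamma> x + \<beta> x)) * (\<bar>u x\<bar> powr \<gamma> x * \<bar>Dw \<Omega> i u x\<bar> powr \<beta> x))
             \<le> ennreal (1/l) * ennreal (\<bar>u x\<bar> powr \<gamma> x * \<bar>Dw \<Omega> i u x\<bar> powr \<beta> x)"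
            using l mult_right_mono[OF dec[of "\<gamma> x + \<beta> x"], of "\<bar>u x\<bar> powr \<gamma> x * \<bar>Dw \<Omega> i u x\<bar> powr \<beta> x"]
            by (subst ennreal_mult'[symmetric]) (auto intro!: ennreal_leI)
        qed
        also have "\<dots> = ennreal (1/l) * energy i u" unfolding energy_def by (rule nn_integral_cmult) measurable
        finally show ?thesis .
      qed
      have l0: "l > 0" using l by simp
      show ?thesis unfolding scaled_eq[OF l0] by (intro add_mono sum_mono 1 2)
    qed
    also have "\<dots> = ennreal (1/l) * s" by (simp add: s_def distrib_left sum_distrib_left)
    also have "\<dots> \<le> ennreal (1/l) * ennreal l" by (intro mult_left_mono sl) simp
    also have "\<dots> = 1" using l by (simp add: ennreal_mult'[symmetric])
    finally have "X \<noteq> {}" using l unfolding X_def by (auto intro: exI[of _ l])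
    moreover have "Inf X < C + 1" using C pn by simp
    ultimately obtain k where k: "k \<in> X" "k < C + 1" using cInf_lessD by blast
    then have k0: "k > 0" "scaled k u \<le> 1" by (auto simp: X_def)
    have inc: "1 \<le> \<mu> powr Q * k powr (- e)" if "e \<le> Q" "e \<ge> 0" for e
    proof -
      have "k powr e \<le> \<mu> powr e" using k k0 that by (intro powr_mono2) (auto simp: \<mu>_def)
      also have "\<dots> \<le> \<mu> powr Q" using \<mu> that by (intro powr_mono) auto
      finally show ?thesis using k0 by (simp add: powr_minus field_simps)
    qed
    have m1: "mass u \<le> ennreal (\<mu> powr Q)"
    proof -
      have "mass u \<le> (\<integral>\<^sup>+x. ennreal (\<mu> powr Q) * ennreal (k powr (- \<theta> x) * \<bar>u x\<bar> powr \<theta> x) \<partial>Leb)"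
        unfolding mass_def
      proof (rule nn_integral_mono_AE)
        show "AE x in Leb. ennreal (\<bar>u x\<bar> powr \<theta> x) \<le> ennreal (\<mu> powr Q) * ennreal (k powr (- \<theta> x) * \<bar>u x\<bar> powr \<theta> x)"
          using theta_ge Q(3)
        proof eventually_elim
          case (elim x)
          have "1 * \<bar>u x\<bar> powr \<theta> x \<le> (\<mu> powr Q * k powr (- \<theta> x)) * \<bar>u x\<bar> powr \<theta> x"
            using elim by (intro mult_right_mono inc) auto
          then show ?case by (simp add: ennreal_mult'[symmetric] mult.assoc ennreal_leI)
        qed
      qed
      also have "\<dots> = ennreal (\<mu> powr Q) * (\<integral>\<^sup>+x. ennreal (k powr (- \<theta> x) * \<bar>u x\<bar> powr \<theta> x) \<partial>Leb)"
        by (rule nn_integral_cmult) measurable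
      also have "\<dots> \<le> ennreal (\<mu> powr Q) * 1"
        using k0(2) unfolding scaled_eq[OF k0(1)]
        by (intro mult_left_mono) (auto intro: order_trans[rotated])
      finally show ?thesis by simp
    qed
    have m2: "energy i u \<le> ennreal (\<mu> powr Q)" for i
    proof -
      let ?E = "\<lambda>i. \<integral>\<^sup>+x. ennreal (k powr (- (\<gamma> x + \<beta> x)) * (\<bar>u x\<bar> powr \<gamma> x * \<bar>Dw \<Omega> i u x\<bar> powr \<beta> x)) \<partial>Leb"
      have "energy i u \<le> (\<integral>\<^sup>+x. ennreal (\<mu> powr Q) * ennreal (k powr (- (\<gamma> x + \<beta> x)) * (\<bar>u x\<bar> powr \<gamma> x * \<bar>Dw \<Omega> i u x\<bar> powr \<beta> x)) \<partial>Leb)"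
        unfolding energy_def
      proof (rule nn_integral_mono)
        fix x assume "x \<in> space Leb"
        then have x: "x \<in> \<Omega>" unfolding space_Leb .
        then have "\<gamma> x + \<beta> x \<ge> 0" using gamma(2) beta(2) by force
        then have "1 * (\<bar>u x\<bar> powr \<gamma> x * \<bar>Dw \<Omega> i u x\<bar> powr \<beta> x) \<le> (\<mu> powr Q * k powr (- (\<gamma> x + \<beta> x))) * (\<bar>u x\<bar> powr \<gamma> x * \<bar>Dw \<Omega> i u x\<bar> powr \<beta> x)"
          using Q(2)[OF x] by (intro mult_right_mono inc) auto
        then show "ennreal (\<bar>u x\<bar> powr \<gamma> x * \<bar>Dw \<Omega> i u x\<bar> powr \<beta> x)
          \<le> ennreal (\<mu> powr Q) * ennreal (k powr (- (\<gamma> x + \<beta> x)) * (\<bar>u x\<bar> powr \<gamma> x * \<bar>Dw \<Omega> i u x\<bar> powr \<beta> x))"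
          by (simp add: ennreal_mult'[symmetric] mult.assoc ennreal_leI)
      qed
      also have "\<dots> = ennreal (\<mu> powr Q) * ?E i" by (rule nn_integral_cmult) measurable
      also have "\<dots> \<le> ennreal (\<mu> powr Q) * 1"
      proof (rule mult_left_mono)
        have "?E i \<le> (\<Sum>i\<in>UNIV. ?E i)" by (rule member_le_sum) auto
        also have "\<dots> \<le> scaled k u" unfolding scaled_eq[OF k0(1)] by simp
        finally show "?E i \<le> 1" using k0(2) by (rule order_trans)
      qed simp
      finally show ?thesis by simp
    qed
    show "bdd_by (\<mu> powr Q) u" unfolding bdd_by_def using u m1 m2 by simp
  qed
qed

text \<open>The constant 1, paid for by the finite measure of \<Omega>, absorbs every later
  comparison of a power with a higher one.\<close>

lemma total_bounds:
  assumes \<Lambda>: "\<Lambda> > 0" and u: "bdd_by \<Lambda> u"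
  shows "(\<integral>\<^sup>+x. ennreal (1 + \<bar>u x\<bar> powr \<theta> x) \<partial>Leb) \<le> ennreal (measure lborel \<Omega> + \<Lambda>)"
    and "(\<integral>\<^sup>+x. ennreal (1 + \<bar>u x\<bar> powr \<gamma> x * \<bar>Dw \<Omega> i u x\<bar> powr \<beta> x) \<partial>Leb) \<le> ennreal (measure lborel \<Omega> + \<Lambda>)"
proof -
  have uS: "u \<in> S_space \<Omega> \<gamma> \<beta> \<theta>" using u by (simp add: bdd_by_def)
  note [measurable] = S_measurable[OF uS]
  have m: "emeasure Leb (space Leb) = ennreal (measure lborel \<Omega>)"
    unfolding emeasure_Leb using fin_\<Omega>(1) by (intro emeasure_eq_ennreal_measure) auto
  have gen: "(\<integral>\<^sup>+x. ennreal (1 + f x) \<partial>Leb) \<le> ennreal (measure lborel \<Omega> + \<Lambda>)"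
    if [measurable]: "f \<in> borel_measurable Leb" and f0: "\<And>x. f x \<ge> 0" and le: "(\<integral>\<^sup>+x. ennreal (f x) \<partial>Leb) \<le> ennreal \<Lambda>" for f
  proof -
    have "(\<integral>\<^sup>+x. ennreal (1 + f x) \<partial>Leb) = (\<integral>\<^sup>+x. 1 + ennreal (f x) \<partial>Leb)"
      using f0 by (intro nn_integral_cong) (simp add: ennreal_plus)
    also have "\<dots> = (\<integral>\<^sup>+x. 1 \<partial>Leb) + (\<integral>\<^sup>+x. ennreal (f x) \<partial>Leb)" by (rule nn_integral_add) auto
    also have "\<dots> \<le> ennreal (measure lborel \<Omega>) + ennreal \<Lambda>" using le m by (intro add_mono) auto
    also have "\<dots> = ennreal (measure lborel \<Omega> + \<Lambda>)" using \<Lambda> by (simp add: ennreal_plus)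
    finally show ?thesis .
  qed
  show "(\<integral>\<^sup>+x. ennreal (1 + \<bar>u x\<bar> powr \<theta> x) \<partial>Leb) \<le> ennreal (measure lborel \<Omega> + \<Lambda>)"
    using u by (intro gen) (auto simp: bdd_by_def mass_def)
  show "(\<integral>\<^sup>+x. ennreal (1 + \<bar>u x\<bar> powr \<gamma> x * \<bar>Dw \<Omega> i u x\<bar> powr \<beta> x) \<partial>Leb) \<le> ennreal (measure lborel \<Omega> + \<Lambda>)"
    using u by (intro gen) (auto simp: bdd_by_def energy_def)
qed

section \<open>Local and uniform higher integrability\<close>

lemma lborel_le_Leb:
  assumes "AE x in Leb. F x \<le> H x" "\<And>x. x \<notin> \<Omega> \<Longrightarrow> F x = 0"
  shows "(\<integral>\<^sup>+x. F x \<partial>lborel) \<le> (\<integral>\<^sup>+x. H x \<partial>Leb)"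
proof -
  have "(\<integral>\<^sup>+x. F x \<partial>lborel) = (\<integral>\<^sup>+x. F x \<partial>lebesgue)" by (simp add: nn_integral_completion)
  also have "\<dots> = (\<integral>\<^sup>+x\<in>\<Omega>. F x \<partial>lebesgue)" using assms(2) by (intro nn_integral_cong) (auto simp: indicator_def)
  also have "\<dots> \<le> (\<integral>\<^sup>+x. H x \<partial>Leb)" unfolding nn_Leb by (rule nn_integral_mono_AE[OF assms(1)])
  finally show ?thesis .
qed

lemma powr_le_one_plus: "x \<ge> 0 \<Longrightarrow> 0 < a \<Longrightarrow> a \<le> b \<Longrightarrow> x powr a \<le> 1 + x powr b" for x a b :: real
proof (cases "x \<le> 1")
  case True
  assume "x \<ge> 0" "0 < a"
  then have "x powr a \<le> 1 powr a" using True by (intro powr_mono2) auto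
  then show ?thesis by (simp add: add_increasing2)
next
  case False
  assume "a \<le> b"
  then have "x powr a \<le> x powr b" using False by (intro powr_mono) auto
  then show ?thesis by simp
qed

text \<open>Near x0 the hypotheses with constant exponents follow from those with variable ones: s +
  1 <= \<gamma> + \<beta> <= \<theta> controls the L1 norm, and where |u| >= 1 the power s may be
  raised to \<gamma>/\<beta> and then b to \<beta>, at the price of a constant. The result depends
  on u only through \<Lambda>.\<close>

lemma local_bound:
  assumes \<Lambda>: "\<Lambda> > 0" and x0: "x0 \<in> closure \<Omega>"
  shows "\<exists>r K. r > 0 \<and> K \<ge> 0 \<and> (\<forall>u. bdd_by \<Lambda> u \<longrightarrow>
    (\<integral>\<^sup>+x. indicator (ball x0 r) x * ennreal (\<bar>u x\<bar> powr (p x + \<epsilon>/2)) \<partial>Leb) \<le> ennreal K)"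
proof -
  obtain P where P: "AE x in Leb. 1 \<le> p x \<and> p x \<le> P" using pM unfolding M0_def AE_Leb by blast
  obtain \<rho> s b q where ex: "\<rho> > 0" "s > 0" "b \<ge> 1" "q \<ge> b" "real CARD('n) / b - real CARD('n) / q < 1"
    and loc: "\<And>x. x \<in> \<Omega> \<inter> ball x0 \<rho> \<Longrightarrow> s \<le> \<gamma> x / \<beta> x \<and> b \<le> \<beta> x \<and> (p x \<le> P \<longrightarrow> p x + \<epsilon>/2 \<le> (s + 1) * q)"
    using local_exponents[OF cont_\<gamma> gamma(2) cont_\<beta> beta(2) eps pcrit x0, where P=P] by blast
  obtain r c d T where r: "r > 0" "r \<le> \<rho>" "d > 0" "T > 0"
    and cone: "\<forall>x t. x \<in> \<Omega> \<inter> ball x0 r \<longrightarrow> 0 < t \<longrightarrow> t \<le> T \<longrightarrow> (\<lambda>z. x + t *\<^sub>R z) ` cball c d \<subseteq> \<Omega> \<inter> ball x0 \<rho>"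
    using lipschitz_cone[OF dom x0 ex(1)] by (elim exE conjE) (rule that)
  obtain \<phi> where bump: "bump c d \<phi>" using bump_exists[OF r(3)] by blast
  interpret cd: cone_domain \<Omega> "\<Omega> \<inter> ball x0 \<rho>" "\<Omega> \<inter> ball x0 r" c d \<phi> T
    using open_\<Omega> bump r(2,4) by unfold_locales (use cone in \<open>auto intro: order_trans\<close>)
  define N where "N = measure lborel \<Omega> + \<Lambda>"
  have N: "N > 0" using \<Lambda> by (simp add: N_def add_nonneg_pos)
  have fin: "emeasure lborel (\<Omega> \<inter> ball x0 \<rho>) < \<infinity>"
    using emeasure_mono[of "\<Omega> \<inter> ball x0 \<rho>" \<Omega> lborel] fin_\<Omega>(1) by (auto intro: le_less_trans)
  obtain K where K: "\<forall>v h. (\<forall>i. wder \<Omega> v i (h i)) \<longrightarrow>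
     (\<integral>\<^sup>+x. indicator (\<Omega> \<inter> ball x0 \<rho>) x * ennreal (\<bar>v x\<bar> powr (s + 1)) \<partial>lborel) \<le> ennreal N \<longrightarrow>
     (\<forall>i. (\<integral>\<^sup>+x. indicator (\<Omega> \<inter> ball x0 \<rho>) x * ennreal (if \<bar>v x\<bar> < 1 then 0 else (\<bar>v x\<bar> powr s * \<bar>h i x\<bar>) powr b) \<partial>lborel) \<le> ennreal N) \<longrightarrow>
     (\<integral>\<^sup>+x. indicator (\<Omega> \<inter> ball x0 r) x * ennreal (\<bar>v x\<bar> powr ((s + 1) * q)) \<partial>lborel) \<le> ennreal K"
    using cd.piece_bound[OF ex(2-5) N fin] by (elim exE) (rule that)
  have main: "(\<integral>\<^sup>+x. indicator (ball x0 r) x * ennreal (\<bar>u x\<bar> powr (p x + \<epsilon>/2)) \<partial>Leb) \<le> ennreal (measure lborel \<Omega> + \<bar>K\<bar>)"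
    if u: "bdd_by \<Lambda> u" for u
  proof -
    have uS: "u \<in> S_space \<Omega> \<gamma> \<beta> \<theta>" using u by (simp add: bdd_by_def)
    obtain v h where w: "\<And>i. wder \<Omega> v i (h i)"
      and vh0: "AE x in lebesgue. x \<in> \<Omega> \<longrightarrow> v x = u x \<and> (\<forall>i. h i x = Dw \<Omega> i u x)"
      using borel_representative[OF open_\<Omega>] uS unfolding S_space_def by blast
    have vh: "AE x in Leb. v x = u x \<and> (\<forall>i. h i x = Dw \<Omega> i u x)" unfolding AE_Leb by (rule vh0)
    have [measurable]: "v \<in> borel_measurable borel" by (rule wderD(1)[OF w])
    have [measurable]: "\<Omega> \<inter> ball x0 r \<in> sets borel" by (simp add: borel_open open_\<Omega> open_Int)
    have h1: "(\<integral>\<^sup>+x. indicator (\<Omega> \<inter> ball x0 \<rho>) x * ennreal (\<bar>v x\<bar> powr (s + 1)) \<partial>lborel) \<le> ennreal N"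
    proof (rule order_trans[OF lborel_le_Leb total_bounds(1)[OF \<Lambda> u, folded N_def]])
      show "AE x in Leb. indicator (\<Omega> \<inter> ball x0 \<rho>) x * ennreal (\<bar>v x\<bar> powr (s + 1)) \<le> ennreal (1 + \<bar>u x\<bar> powr \<theta> x)"
        using vh theta_ge
      proof eventually_elim
        case (elim x)
        show ?case
        proof (cases "x \<in> ball x0 \<rho>")
          case True
          then have x: "x \<in> \<Omega> \<inter> ball x0 \<rho>" using elim by simp
          have g1: "\<gamma> x \<ge> 1" "\<beta> x \<ge> 1" using gamma(2) beta(2) elim by auto
          have "s \<le> \<gamma> x / \<beta> x" using loc[OF x] by simp
          also have "\<dots> \<le> \<gamma> x" using g1 by (simp add: divide_le_eq)
          finally have "s + 1 \<le> \<theta> x" using elim g1 by linarith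
          then have "\<bar>u x\<bar> powr (s + 1) \<le> 1 + \<bar>u x\<bar> powr \<theta> x" using ex by (intro powr_le_one_plus) auto
          then show ?thesis using x elim by (simp add: ennreal_leI del: ennreal_plus)
        qed simp
      qed
    qed auto
    have h2: "(\<integral>\<^sup>+x. indicator (\<Omega> \<inter> ball x0 \<rho>) x * ennreal (if \<bar>v x\<bar> < 1 then 0 else (\<bar>v x\<bar> powr s * \<bar>h i x\<bar>) powr b) \<partial>lborel) \<le> ennreal N" for i
    proof (rule order_trans[OF lborel_le_Leb total_bounds(2)[OF \<Lambda> u, folded N_def]])
      show "AE x in Leb. indicator (\<Omega> \<inter> ball x0 \<rho>) x * ennreal (if \<bar>v x\<bar> < 1 then 0 else (\<bar>v x\<bar> powr s * \<bar>h i x\<bar>) powr b)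
         \<le> ennreal (1 + \<bar>u x\<bar> powr \<gamma> x * \<bar>Dw \<Omega> i u x\<bar> powr \<beta> x)"
        using vh theta_ge
      proof eventually_elim
        case (elim x)
        show ?case
        proof (cases "x \<in> ball x0 \<rho> \<and> \<not> \<bar>u x\<bar> < 1")
          case True
          then have x: "x \<in> \<Omega> \<inter> ball x0 \<rho>" using elim by simp
          have g1: "\<beta> x \<ge> 1" using beta(2) elim by auto
          let ?D = "\<bar>Dw \<Omega> i u x\<bar>"
          have "\<bar>u x\<bar> powr s \<le> \<bar>u x\<bar> powr (\<gamma> x / \<beta> x)" using loc[OF x] True by (intro powr_mono) auto
          then have "(\<bar>u x\<bar> powr s * ?D) powr b \<le> (\<bar>u x\<bar> powr (\<gamma> x / \<beta> x) * ?D) powr b"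
            using ex by (intro powr_mono2 mult_right_mono) auto
          also have "\<dots> \<le> 1 + (\<bar>u x\<bar> powr (\<gamma> x / \<beta> x) * ?D) powr \<beta> x"
            using ex loc[OF x] by (intro powr_le_one_plus) auto
          also have "(\<bar>u x\<bar> powr (\<gamma> x / \<beta> x) * ?D) powr \<beta> x = \<bar>u x\<bar> powr \<gamma> x * ?D powr \<beta> x"
            using g1 by (simp add: powr_mult powr_powr)
          finally show ?thesis using x elim True by (simp add: ennreal_leI del: ennreal_plus)
        next
          case False
          then show ?thesis using elim by auto
        qed
      qed
    qed auto
    note KK = K[rule_format, OF w h1 h2]
    have ae: "AE x in Leb. indicator (ball x0 r) x * ennreal (\<bar>u x\<bar> powr (p x + \<epsilon>/2)) \<le>
        1 + indicator (\<Omega> \<inter> ball x0 r) x * ennreal (\<bar>v x\<bar> powr ((s + 1) * q))"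
      using vh theta_ge P
    proof eventually_elim
      case (elim x)
      show ?case
      proof (cases "x \<in> ball x0 r")
        case True
        then have x: "x \<in> \<Omega> \<inter> ball x0 r" "x \<in> \<Omega> \<inter> ball x0 \<rho>" using elim r by auto
        have "\<bar>u x\<bar> powr (p x + \<epsilon>/2) \<le> 1 + \<bar>u x\<bar> powr ((s + 1) * q)"
          using loc[OF x(2)] elim eps by (intro powr_le_one_plus) auto
        from ennreal_leI[OF this] show ?thesis using x elim by (simp add: ennreal_plus)
      qed simp
    qed
    have [measurable]: "(\<lambda>x. indicator (\<Omega> \<inter> ball x0 r) x * ennreal (\<bar>v x\<bar> powr ((s + 1) * q))) \<in> borel_measurable borel"
      by measurable
    have mL: "(\<lambda>x. indicator (\<Omega> \<inter> ball x0 r) x * ennreal (\<bar>v x\<bar> powr ((s + 1) * q))) \<in> borel_measurable Leb"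
      by (intro measurable_restrict_space1 measurable_completion) simp
    have "(\<integral>\<^sup>+x. indicator (ball x0 r) x * ennreal (\<bar>u x\<bar> powr (p x + \<epsilon>/2)) \<partial>Leb)
      \<le> (\<integral>\<^sup>+x. 1 + indicator (\<Omega> \<inter> ball x0 r) x * ennreal (\<bar>v x\<bar> powr ((s + 1) * q)) \<partial>Leb)"
      by (rule nn_integral_mono_AE[OF ae])
    also have "\<dots> = (\<integral>\<^sup>+x. 1 \<partial>Leb) + (\<integral>\<^sup>+x. indicator (\<Omega> \<inter> ball x0 r) x * ennreal (\<bar>v x\<bar> powr ((s + 1) * q)) \<partial>Leb)"
      by (rule nn_integral_add) (use mL in auto)
    also have "(\<integral>\<^sup>+x. indicator (\<Omega> \<inter> ball x0 r) x * ennreal (\<bar>v x\<bar> powr ((s + 1) * q)) \<partial>Leb)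
       = (\<integral>\<^sup>+x. indicator (\<Omega> \<inter> ball x0 r) x * ennreal (\<bar>v x\<bar> powr ((s + 1) * q)) \<partial>lborel)"
      unfolding nn_Leb[symmetric] nn_integral_completion
      by (rule nn_integral_cong) (auto simp: indicator_def)
    also have "(\<integral>\<^sup>+x. 1 \<partial>Leb) = ennreal (measure lborel \<Omega>)"
      using emeasure_Leb fin_\<Omega>(1) by (simp add: emeasure_eq_ennreal_measure)
    also have "ennreal (measure lborel \<Omega>) + (\<integral>\<^sup>+x. indicator (\<Omega> \<inter> ball x0 r) x * ennreal (\<bar>v x\<bar> powr ((s + 1) * q)) \<partial>lborel)
       \<le> ennreal (measure lborel \<Omega>) + ennreal \<bar>K\<bar>"
      by (intro add_left_mono order_trans[OF KK] ennreal_leI) simp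
    also have "\<dots> = ennreal (measure lborel \<Omega> + \<bar>K\<bar>)" by (simp add: ennreal_plus)
    finally show ?thesis .
  qed
  then show ?thesis using r(1) by (intro exI[of _ r] exI[of _ "measure lborel \<Omega> + \<bar>K\<bar>"]) auto
qed

text \<open>The radii of \<open>local_bound\<close> depend on the point and on \<Lambda> but not on
  u, so the finite cover of the compact closure is chosen before u.\<close>

lemma uniform_bound:
  assumes \<Lambda>: "\<Lambda> > 0"
  shows "\<exists>K\<ge>0. \<forall>u. bdd_by \<Lambda> u \<longrightarrow> (\<integral>\<^sup>+x. ennreal (\<bar>u x\<bar> powr (p x + \<epsilon>/2)) \<partial>Leb) \<le> ennreal K"
proof -
  have "\<forall>x0\<in>closure \<Omega>. \<exists>r K. r > 0 \<and> K \<ge> 0 \<and> (\<forall>u. bdd_by \<Lambda> u \<longrightarrow>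
    (\<integral>\<^sup>+x. indicator (ball x0 r) x * ennreal (\<bar>u x\<bar> powr (p x + \<epsilon>/2)) \<partial>Leb) \<le> ennreal K)"
    using local_bound[OF \<Lambda>] by (rule ballI)
  then obtain r K where K: "\<forall>x0\<in>closure \<Omega>. r x0 > 0 \<and> K x0 \<ge> 0 \<and> (\<forall>u. bdd_by \<Lambda> u \<longrightarrow>
    (\<integral>\<^sup>+x. indicator (ball x0 (r x0)) x * ennreal (\<bar>u x\<bar> powr (p x + \<epsilon>/2)) \<partial>Leb) \<le> ennreal (K x0))"
    unfolding bchoice_iff by (elim exE) (rule that)
  have rK: "r x0 > 0" "K x0 \<ge> 0"
    "bdd_by \<Lambda> u \<Longrightarrow> (\<integral>\<^sup>+x. indicator (ball x0 (r x0)) x * ennreal (\<bar>u x\<bar> powr (p x + \<epsilon>/2)) \<partial>Leb) \<le> ennreal (K x0)"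
    if "x0 \<in> closure \<Omega>" for x0 u
    using bspec[OF K that] by simp_all
  have "compact (closure \<Omega>)" using bounded_\<Omega> by simp
  then obtain D where D: "D \<subseteq> closure \<Omega>" "finite D" "closure \<Omega> \<subseteq> (\<Union>x0\<in>D. ball x0 (r x0))"
    by (rule compactE_image[of _ "closure \<Omega>" "\<lambda>x0. ball x0 (r x0)"]) (use rK(1) in force)+
  show ?thesis
  proof (intro exI[of _ "\<Sum>x0\<in>D. K x0"] conjI allI impI)
    show "(\<Sum>x0\<in>D. K x0) \<ge> 0" using D rK(2) by (intro sum_nonneg) auto
    fix u assume u: "bdd_by \<Lambda> u"
    have uS: "u \<in> S_space \<Omega> \<gamma> \<beta> \<theta>" using u by (simp add: bdd_by_def)
    note [measurable] = S_measurable(1)[OF uS]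
    have mb: "(\<lambda>x. indicator (ball x0 s) x :: ennreal) \<in> borel_measurable Leb" for x0 :: "real^'n" and s
      by (intro measurable_restrict_space1 measurable_completion borel_measurable_indicator) (simp add: borel_open)
    have "(\<integral>\<^sup>+x. ennreal (\<bar>u x\<bar> powr (p x + \<epsilon>/2)) \<partial>Leb)
      \<le> (\<integral>\<^sup>+x. (\<Sum>x0\<in>D. indicator (ball x0 (r x0)) x * ennreal (\<bar>u x\<bar> powr (p x + \<epsilon>/2))) \<partial>Leb)"
    proof (rule nn_integral_mono)
      fix x assume "x \<in> space Leb"
      then have "x \<in> closure \<Omega>" unfolding space_Leb using closure_subset by blast
      then obtain x0 where x0: "x0 \<in> D" "x \<in> ball x0 (r x0)" using D(3) by blast
      have "ennreal (\<bar>u x\<bar> powr (p x + \<epsilon>/2)) = indicator (ball x0 (r x0)) x * ennreal (\<bar>u x\<bar> powr (p x + \<epsilon>/2))" using x0 by simp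
      also have "\<dots> \<le> (\<Sum>x0\<in>D. indicator (ball x0 (r x0)) x * ennreal (\<bar>u x\<bar> powr (p x + \<epsilon>/2)))"
        by (rule member_le_sum[OF x0(1)]) (use D in auto)
      finally show "ennreal (\<bar>u x\<bar> powr (p x + \<epsilon>/2)) \<le> (\<Sum>x0\<in>D. indicator (ball x0 (r x0)) x * ennreal (\<bar>u x\<bar> powr (p x + \<epsilon>/2)))" .
    qed
    also have "\<dots> = (\<Sum>x0\<in>D. \<integral>\<^sup>+x. indicator (ball x0 (r x0)) x * ennreal (\<bar>u x\<bar> powr (p x + \<epsilon>/2)) \<partial>Leb)"
      by (rule nn_integral_sum) (use mb in measurable)
    also have "\<dots> \<le> (\<Sum>x0\<in>D. ennreal (K x0))" using D(1) u by (intro sum_mono rK(3)) auto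
    also have "\<dots> = ennreal (\<Sum>x0\<in>D. K x0)" using D(1) rK(2) by (intro sum_ennreal) auto
    finally show "(\<integral>\<^sup>+x. ennreal (\<bar>u x\<bar> powr (p x + \<epsilon>/2)) \<partial>Leb) \<le> ennreal (\<Sum>x0\<in>D. K x0)" .
  qed
qed

section \<open>Almost everywhere convergence of a subsequence\<close>

lemma AE_convergent_subsequence:
  fixes u :: "nat \<Rightarrow> 'n fn"
  assumes \<Lambda>: "\<Lambda> > 0" and u: "\<And>k. bdd_by \<Lambda> (u k)"
  shows "\<exists>r::nat\<Rightarrow>nat. strict_mono r \<and> (AE x in lebesgue. x \<in> \<Omega> \<longrightarrow> convergent (\<lambda>k. u (r k) x))"
proof -
  \<comment> \<open>Q bounds \<gamma>, hence also \<gamma>/\<beta>, at all points of \<Omega>, so a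
    single F serves the whole domain.\<close>
  obtain Q where Q: "Q \<ge> 1" "\<And>x. x \<in> \<Omega> \<Longrightarrow> \<gamma> x \<le> Q" using exponent_bound by metis
  have Q0: "Q > 0" using Q by simp
  have uS: "u k \<in> S_space \<Omega> \<gamma> \<beta> \<theta>" for k using u by (simp add: bdd_by_def)
  have "\<forall>k. \<exists>v h. (\<forall>i. wder \<Omega> v i (h i)) \<and> (AE x in lebesgue. x \<in> \<Omega> \<longrightarrow> v x = u k x \<and> (\<forall>i. h i x = Dw \<Omega> i (u k) x))"
  proof
    fix k
    have "has_weak_partials \<Omega> (u k)" using uS[of k] by (simp add: S_space_def)
    from borel_representative[OF open_\<Omega> this]
    show "\<exists>v h. (\<forall>i. wder \<Omega> v i (h i)) \<and> (AE x in lebesgue. x \<in> \<Omega> \<longrightarrow> v x = u k x \<and> (\<forall>i. h i x = Dw \<Omega> i (u k) x))" by blast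
  qed
  then obtain v h where "\<forall>k. (\<forall>i. wder \<Omega> (v k) i (h k i)) \<and>
      (AE x in lebesgue. x \<in> \<Omega> \<longrightarrow> v k x = u k x \<and> (\<forall>i. h k i x = Dw \<Omega> i (u k) x))"
    unfolding choice_iff by (elim exE) (rule that)
  then have w: "\<And>k i. wder \<Omega> (v k) i (h k i)"
    and vh0: "\<And>k. AE x in lebesgue. x \<in> \<Omega> \<longrightarrow> v k x = u k x \<and> (\<forall>i. h k i x = Dw \<Omega> i (u k) x)" by simp_all
  have vh: "AE x in Leb. v k x = u k x \<and> (\<forall>i. h k i x = Dw \<Omega> i (u k) x)" for k unfolding AE_Leb by (rule vh0)
  have cont: "continuous_on UNIV (\<lambda>t::real. min (\<bar>t\<bar> powr Q) 1)"
    by (intro continuous_on_min continuous_on_const continuous_on_powr' continuous_on_rabs continuous_on_id) (use Q0 in auto)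
  obtain F where F: "F 0 = 0" "\<And>t. (F has_real_derivative min (\<bar>t\<bar> powr Q) 1) (at t)"
    using continuous_antiderivative[OF cont] by metis
  note Fb = slow_antiderivative_bounds[OF Q0 F]
  define f where "f k x = F (v k x)" for k x
  define g where "g k i x = min (\<bar>v k x\<bar> powr Q) 1 * h k i x" for k i x
  have wf: "wder \<Omega> (f k) i (g k i)" for k i
    unfolding f_def[abs_def] g_def[abs_def] by (rule wder_chain[OF w open_\<Omega> F(2) cont, of 1]) simp
  define N where "N = measure lborel \<Omega> + \<Lambda>"
  have N: "N \<ge> 0" using \<Lambda> by (simp add: N_def)
  have fN: "(\<integral>\<^sup>+x. ennreal \<bar>indicator \<Omega> x * f k x\<bar> \<partial>lborel) \<le> ennreal N" for k
  proof (rule order_trans[OF lborel_le_Leb total_bounds(1)[OF \<Lambda> u, folded N_def, of k]])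
    show "AE x in Leb. ennreal \<bar>indicator \<Omega> x * f k x\<bar> \<le> ennreal (1 + \<bar>u k x\<bar> powr \<theta> x)"
      using vh[of k] theta_ge
    proof eventually_elim
      case (elim x)
      have "\<bar>f k x\<bar> \<le> \<bar>u k x\<bar>" unfolding f_def using Fb(1)[of "v k x"] elim by simp
      also have "\<dots> \<le> 1 + \<bar>u k x\<bar> powr \<theta> x" using elim by (intro le_one_plus_powr) auto
      finally show ?case using elim by (simp add: ennreal_leI del: ennreal_plus)
    qed
  qed simp
  have gN: "(\<integral>\<^sup>+x. ennreal \<bar>indicator \<Omega> x * g k i x\<bar> \<partial>lborel) \<le> ennreal N" for k i
  proof (rule order_trans[OF lborel_le_Leb total_bounds(2)[OF \<Lambda> u, folded N_def, of k i]])
    show "AE x in Leb. ennreal \<bar>indicator \<Omega> x * g k i x\<bar> \<le> ennreal (1 + \<bar>u k x\<bar> powr \<gamma> x * \<bar>Dw \<Omega> i (u k) x\<bar> powr \<beta> x)"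
      using vh[of k] theta_ge
    proof eventually_elim
      case (elim x)
      let ?U = "\<bar>u k x\<bar>" and ?D = "\<bar>Dw \<Omega> i (u k) x\<bar>"
      have g1: "\<gamma> x \<ge> 1" "\<beta> x \<ge> 1" "\<gamma> x \<le> Q" using gamma(2) beta(2) Q(2) elim by auto
      have "\<gamma> x / \<beta> x \<le> \<gamma> x" using g1 by (simp add: divide_le_eq)
      then have gQ: "\<gamma> x / \<beta> x \<le> Q" using g1 by linarith
      have "min (?U powr Q) 1 \<le> ?U powr (\<gamma> x / \<beta> x)"
      proof (cases "?U \<le> 1")
        case True
        then have "?U powr Q \<le> ?U powr (\<gamma> x / \<beta> x)" using gQ by (intro powr_mono') auto
        then show ?thesis by simp
      next
        case False
        then show ?thesis using g1 by (simp add: ge_one_powr_ge_zero min.coboundedI2)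
      qed
      then have "min (?U powr Q) 1 * ?D \<le> ?U powr (\<gamma> x / \<beta> x) * ?D" by (intro mult_right_mono) auto
      also have "\<dots> \<le> 1 + (?U powr (\<gamma> x / \<beta> x) * ?D) powr \<beta> x" using g1 by (intro le_one_plus_powr) auto
      also have "(?U powr (\<gamma> x / \<beta> x) * ?D) powr \<beta> x = ?U powr \<gamma> x * ?D powr \<beta> x" using g1 by (simp add: powr_mult powr_powr)
      finally show ?case using elim by (simp add: g_def abs_mult ennreal_leI del: ennreal_plus)
    qed
  qed simp
  obtain r :: "nat \<Rightarrow> nat" where r: "strict_mono r" and cv: "AE x in lborel. x \<in> \<Omega> \<longrightarrow> convergent (\<lambda>k. f (r k) x)"
    using rellich_AE[of \<Omega> f g N, OF open_\<Omega> wf fN gN N] by (elim exE conjE) (rule that)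
  have "AE x in lebesgue. \<forall>k. x \<in> \<Omega> \<longrightarrow> v k x = u k x"
    unfolding AE_all_countable
  proof
    fix k show "AE x in lebesgue. x \<in> \<Omega> \<longrightarrow> v k x = u k x" using vh0[of k] by eventually_elim blast
  qed
  moreover have "AE x in lebesgue. x \<in> \<Omega> \<longrightarrow> convergent (\<lambda>k. f (r k) x)" using cv by (rule AE_completion)
  ultimately have "AE x in lebesgue. x \<in> \<Omega> \<longrightarrow> convergent (\<lambda>k. u (r k) x)"
  proof eventually_elim
    case (elim x)
    show ?case
    proof
      assume x: "x \<in> \<Omega>"
      then have "convergent (\<lambda>k. F (u (r k) x))" using elim by (simp add: f_def)
      then show "convergent (\<lambda>k. u (r k) x)" by (rule Fb(2))
    qed
  qed
  with r show ?thesis by (intro exI[of _ r] conjI)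
qed

lemma S_subset_Lpx: "S_space \<Omega> \<gamma> \<beta> \<theta> \<subseteq> Lpx \<Omega> p"
proof
  fix u assume uS: "u \<in> S_space \<Omega> \<gamma> \<beta> \<theta>"
  note [measurable] = S_measurable(1)[OF uS]
  obtain \<Lambda> where \<Lambda>: "\<Lambda> > 0" "bdd_by \<Lambda> u" using S_bdd_by[OF uS] by metis
  obtain K where "\<forall>u. bdd_by \<Lambda> u \<longrightarrow> (\<integral>\<^sup>+x. ennreal (\<bar>u x\<bar> powr (p x + \<epsilon>/2)) \<partial>Leb) \<le> ennreal K"
    using uniform_bound[OF \<Lambda>(1)] by (elim exE conjE) (rule that)
  from this[rule_format, OF \<Lambda>(2)] have K: "(\<integral>\<^sup>+x. ennreal (\<bar>u x\<bar> powr (p x + \<epsilon>/2)) \<partial>Leb) \<le> ennreal K" .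
  obtain P where P: "AE x in Leb. 1 \<le> p x \<and> p x \<le> P" using pM unfolding M0_def AE_Leb by blast
  have "modular \<Omega> p u \<le> (\<integral>\<^sup>+x. 1 + ennreal (\<bar>u x\<bar> powr (p x + \<epsilon>/2)) \<partial>Leb)"
    unfolding modular_def nn_Leb
  proof (rule nn_integral_mono_AE)
    show "AE x in Leb. ennreal (\<bar>u x\<bar> powr p x) \<le> 1 + ennreal (\<bar>u x\<bar> powr (p x + \<epsilon>/2))"
      using P
    proof eventually_elim
      case (elim x)
      have "\<bar>u x\<bar> powr p x \<le> 1 + \<bar>u x\<bar> powr (p x + \<epsilon>/2)" using elim eps by (intro powr_le_one_plus) auto
      from ennreal_leI[OF this] show ?case by (simp add: ennreal_plus)
    qed
  qed
  also have "\<dots> = emeasure Leb (space Leb) + (\<integral>\<^sup>+x. ennreal (\<bar>u x\<bar> powr (p x + \<epsilon>/2)) \<partial>Leb)"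
    by (simp add: nn_integral_add)
  also have "\<dots> < \<infinity>" using fin_\<Omega>(1) le_less_trans[OF K ennreal_less_top] unfolding emeasure_Leb by simp
  finally show "u \<in> Lpx \<Omega> p" by (simp add: Lpx_def S_measurable(1)[OF uS])
qed

lemma compact_embedding:
  fixes u :: "nat \<Rightarrow> 'n fn"
  assumes uS: "\<And>k. u k \<in> S_space \<Omega> \<gamma> \<beta> \<theta>" and C: "\<And>k. S_pnorm \<Omega> \<gamma> \<beta> \<theta> (u k) \<le> C"
  shows "\<exists>r v. strict_mono r \<and> v \<in> Lpx \<Omega> p \<and> (\<lambda>k. lux_norm \<Omega> p (\<lambda>x. u (r k) x - v x)) \<longlonglongrightarrow> 0"
proof -
  obtain \<Lambda> where \<Lambda>0: "\<Lambda> > 0"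
    and bdd: "\<forall>u. u \<in> S_space \<Omega> \<gamma> \<beta> \<theta> \<longrightarrow> S_pnorm \<Omega> \<gamma> \<beta> \<theta> u \<le> C \<longrightarrow> bdd_by \<Lambda> u"
    using S_pnorm_bdd_by[of C] by (elim exE conjE) (rule that)
  have \<Lambda>: "\<Lambda> > 0" "\<And>k. bdd_by \<Lambda> (u k)" using \<Lambda>0 bdd[rule_format, OF uS C] by auto
  obtain K where K0: "K \<ge> 0"
    and Kb: "\<forall>u. bdd_by \<Lambda> u \<longrightarrow> (\<integral>\<^sup>+x. ennreal (\<bar>u x\<bar> powr (p x + \<epsilon>/2)) \<partial>Leb) \<le> ennreal K"
    using uniform_bound[OF \<Lambda>0] by (elim exE conjE) (rule that)
  note K = K0 Kb[rule_format, OF \<Lambda>(2)]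
  obtain r :: "nat \<Rightarrow> nat" where r: "strict_mono r" "AE x in lebesgue. x \<in> \<Omega> \<longrightarrow> convergent (\<lambda>k. u (r k) x)"
    using AE_convergent_subsequence[of \<Lambda> u, OF \<Lambda>] by (elim exE conjE) (rule that)
  have bd: "(\<integral>\<^sup>+x\<in>\<Omega>. ennreal (\<bar>u (r k) x\<bar> powr (p x + \<epsilon>/2)) \<partial>lebesgue) \<le> ennreal K" for k
    unfolding nn_Leb by (rule K(2))
  have "\<epsilon>/2 > 0" using eps by simp
  from vitali_lux_norm[OF \<Omega>_borel(2) fin_\<Omega>(2) pM this K(1) S_measurable(1)[OF uS] bd r(2)]
  obtain v where "v \<in> Lpx \<Omega> p" "(\<lambda>k. lux_norm \<Omega> p (\<lambda>x. u (r k) x - v x)) \<longlonglongrightarrow> 0"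
    by (elim exE conjE) (rule that)
  with r(1) show ?thesis by (intro exI[of _ r] exI[of _ v] conjI)
qed

end

theorem theorem3p11:
  fixes \<Omega> :: "(real^'n) set" and \<gamma> \<beta> \<theta> p :: "real^'n \<Rightarrow> real"
    and \<epsilon>0 \<epsilon> :: real
  assumes n2: "CARD('n) \<ge> 2"
    and dom: "bounded_lipschitz_domain \<Omega>"
    and gamma: "C1_closure \<Omega> \<gamma>" "\<forall>x\<in>\<Omega>. 1 \<le> \<gamma> x"
    and beta: "C1_closure \<Omega> \<beta>" "\<forall>x\<in>\<Omega>. 1 \<le> \<beta> x \<and> \<beta> x < real CARD('n)"
    and theta: "M0 \<Omega> \<theta>" "\<epsilon>0 > 0"
      "AE x in lebesgue. x \<in> \<Omega> \<longrightarrow> \<theta> x \<ge> \<gamma> x + \<beta> x + \<epsilon>0"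
    and pM: "M0 \<Omega> p"
    and eps: "\<epsilon> > 0"
    and pcrit: "\<forall>x\<in>\<Omega>. p x + \<epsilon> < real CARD('n) * (\<gamma> x + \<beta> x) / (real CARD('n) - \<beta> x)"
  shows "S_space \<Omega> \<gamma> \<beta> \<theta> \<subseteq> Lpx \<Omega> p \<and>
    (\<forall>u::nat \<Rightarrow> real^'n \<Rightarrow> real.
       (\<forall>k. u k \<in> S_space \<Omega> \<gamma> \<beta> \<theta>) \<and> (\<exists>C. \<forall>k. S_pnorm \<Omega> \<gamma> \<beta> \<theta> (u k) \<le> C) \<longrightarrow>
       (\<exists>r v. strict_mono r \<and> v \<in> Lpx \<Omega> p \<and>
          (\<lambda>k. lux_norm \<Omega> p (\<lambda>x. u (r k) x - v x)) \<longlonglongrightarrow> 0))"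
proof -
  interpret embedding_setting \<Omega> \<gamma> \<beta> \<theta> p \<epsilon>0 \<epsilon>
    by unfold_locales (fact dom gamma beta theta pM eps pcrit)+
  show ?thesis
  proof (intro conjI allI impI)
    show "S_space \<Omega> \<gamma> \<beta> \<theta> \<subseteq> Lpx \<Omega> p" by (rule S_subset_Lpx)
    fix u :: "nat \<Rightarrow> real^'n \<Rightarrow> real"
    assume u: "(\<forall>k. u k \<in> S_space \<Omega> \<gamma> \<beta> \<theta>) \<and> (\<exists>C. \<forall>k. S_pnorm \<Omega> \<gamma> \<beta> \<theta> (u k) \<le> C)"
    then obtain C where "\<forall>k. S_pnorm \<Omega> \<gamma> \<beta> \<theta> (u k) \<le> C" by (elim exE conjE) (rule that)
    with u show "\<exists>r v. strict_mono r \<and> v \<in> Lpx \<Omega> p \<and> (\<lambda>k. lux_norm \<Omega> p (\<lambda>x. u (r k) x - v x)) \<longlonglongrightarrow> 0"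
      by (intro compact_embedding[of u C]) simp_all
  qed
qed

end
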